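(* Let $\mathbb{K}$ be any field of characteristic $0$, and let $AGL(1,\mathbb{K}) = \mathbb{K}_+ \rtimes \mathbb{K}^*$. Then $AGL(1,\mathbb{K})$ embeds, as a subgroup, into a sharply $2$-transitive group $G$ of characteristic $0$ such that $G$ (in its sharply $2$-transitive action) contains no regular normal subgroup.
   Context: $\mathbb{K}_+$ denotes the additive group of $\mathbb{K}$, $\mathbb{K}^*$ its multiplicative group, and $\mathbb{K}_+ \rtimes \mathbb{K}^*$ is the group of affine maps $x\mapsto ax+b$ ($a\in\mathbb{K}^*$, $b\in\mathbb{K}$), with $\mathbb{K}^*$ acting on $\mathbb{K}_+$ by multiplication. A permutation group $G$ acting on a set $X$ with $|X|\ge 2$ is sharply $2$-transitive if for any two pairs $(x,y)$, $(x',y')$ of distinct elements of $X$ there is exactly one $g\in G$ with $g(x)=x'$ and $g(y)=y'$. In a sharply $2$-transitive group all involutions are conjugate; the group has characteristic $2$ if involutions have no fixed point, and otherwise the product of two distinct involutions has either a fixed prime order $p$ (characteristic $p$) or infinite order (characteristic $0$). A subgroup $N$ is regular if it acts regularly (simply transitively) on $X$; the sharply $2$-transitive group is called split if it contains a regular normal subgroup. *)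

theory Defs
  imports "HOL-Algebra.Algebra"
begin

text \<open>The affine group AGL(1,K) = K_+ semidirect K^*: the pair (a,b) with a nonzero
  stands for the affine map x |-> a*x + b; the product is composition of maps.\<close>
definition AGL1 :: "('k::field) itself \<Rightarrow> ('k \<times> 'k) monoid" where
  "AGL1 (T :: 'k itself) = \<lparr> carrier = {(a :: 'k, b :: 'k). a \<noteq> 0},
             monoid.mult = (\<lambda>(a :: 'k, b :: 'k) (c, d). (a * c, a * d + b)),
             monoid.one = (1 :: 'k, 0 :: 'k) \<rparr>"

definition perm_group :: "'x set \<Rightarrow> ('x \<Rightarrow> 'x) set \<Rightarrow> ('x \<Rightarrow> 'x) monoid" where
  "perm_group S G = (BijGroup S) \<lparr> carrier := G \<rparr>"

definition sharply_2_transitive :: "'x set \<Rightarrow> ('x \<Rightarrow> 'x) set \<Rightarrow> bool" where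
  "sharply_2_transitive S G \<longleftrightarrow>
     subgroup G (BijGroup S) \<and>
     (\<exists>x\<in>S. \<exists>y\<in>S. x \<noteq> y) \<and>
     (\<forall>x\<in>S. \<forall>y\<in>S. \<forall>x'\<in>S. \<forall>y'\<in>S. x \<noteq> y \<longrightarrow> x' \<noteq> y' \<longrightarrow>
        (\<exists>!g. g \<in> G \<and> g x = x' \<and> g y = y'))"

definition involutions :: "'x set \<Rightarrow> ('x \<Rightarrow> 'x) set \<Rightarrow> ('x \<Rightarrow> 'x) set" where
  "involutions S G = {i \<in> G. i \<noteq> \<one>\<^bsub>perm_group S G\<^esub> \<and>
                                 i \<otimes>\<^bsub>perm_group S G\<^esub> i = \<one>\<^bsub>perm_group S G\<^esub>}"

definition s2t_char_0 :: "'x set \<Rightarrow> ('x \<Rightarrow> 'x) set \<Rightarrow> bool" where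
  "s2t_char_0 S G \<longleftrightarrow>
     (\<forall>i\<in>involutions S G. \<exists>x\<in>S. i x = x) \<and>
     (\<forall>i\<in>involutions S G. \<forall>j\<in>involutions S G. i \<noteq> j \<longrightarrow>
        (\<forall>n::nat. n > 0 \<longrightarrow>
           (i \<otimes>\<^bsub>perm_group S G\<^esub> j) [^]\<^bsub>perm_group S G\<^esub> n \<noteq> \<one>\<^bsub>perm_group S G\<^esub>))"

definition regular_subgroup :: "'x set \<Rightarrow> ('x \<Rightarrow> 'x) set \<Rightarrow> bool" where
  "regular_subgroup S N \<longleftrightarrow> (\<forall>x\<in>S. \<forall>y\<in>S. \<exists>!n. n \<in> N \<and> n x = y)"

definition has_regular_normal_subgroup :: "'x set \<Rightarrow> ('x \<Rightarrow> 'x) set \<Rightarrow> bool" where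
  "has_regular_normal_subgroup S G \<longleftrightarrow>
     (\<exists>N. N \<lhd> perm_group S G \<and> regular_subgroup S N)"

end

theory Submission
  imports Defs
begin

text \<open>
  A sharply 2-transitive group of characteristic 0 acts on its involutions by conjugation, and it is
  enough to find a group \<open>W\<close> containing \<open>H = AGL(1, K)\<close> such that any two distinct involutions of \<open>W\<close>
  are simultaneously conjugate into \<open>H\<close> and such that \<open>x \<in> H\<close> whenever \<open>x\<close> conjugates a nontrivial
  translation of \<open>H\<close> to a translation. Such a \<open>W\<close> does not split as soon as some conjugate in \<open>W\<close> of
  an involution of \<open>H\<close> lies outside \<open>H\<close>: a regular normal subgroup would be abelian and contain
  all products of two involutions.

  \<open>W\<close> is the union of a chain of groups starting with \<open>H\<close>. In each of them two distinct involutions are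
  either simultaneously conjugate into \<open>H\<close> or contained in an infinite dihedral subgroup that is
  malnormal with respect to its translations. The next group is the HNN extension conjugating
  one dihedral subgroup from each conjugacy class to the dihedral group generated by
  \<open>x \<mapsto> -x\<close> and \<open>x \<mapsto> 1 - x\<close> in \<open>H\<close>, together with one free letter. It acts on its Bass-Serre tree;
  two involutions with a common fixed vertex are conjugate into the previous group, and otherwise they
  act as reflections on a line of the tree, whose stabilizer is a dihedral group of the required kind.
\<close>

section \<open>Groups and isolated dihedral subgroups\<close>

text \<open>The union of the chain needs all groups in one type, each literally contained in the
  next, so the extensions are not quotients of free products. Every group is a set of permutations
  of \<open>'k\<close> acting freely with as many orbits as \<open>'k\<close> has elements. The
  normal forms of the HNN extension, repeated once for each element of \<open>'k\<close>, carry a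
  free action of \<open>G\<close> with equally many orbits; the two actions are isomorphic, and the
  stable letters, which act on normal forms, become permutations of \<open>'k\<close>. The obstacle
  in the tree is that all dihedral groups are conjugated to one target whose translations have large
  centralizers. Fixed paths of translations stay short because a translation of \<open>H\<close> is
  conjugate to its square, which cannot happen in an isolated dihedral subgroup; so the two kinds of
  edge groups never share a conjugate translation. For the same reason \<open>H\<close> has no
  isolated dihedral subgroup at all, and the first extension is the free product with an infinite
  cyclic group: without the free letter the chain would never leave \<open>H\<close>.\<close>

class group_mult = monoid_mult + inverse +
  assumes group_left_inverse [simp]: "inverse a * a = 1"
begin

lemma group_left_cancel [simp]: "inverse a * (a * b) = b"
  by (metis group_left_inverse local.mult.assoc local.mult_1_left)

lemma group_right_inverse [simp]: "a * inverse a = 1"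
  by (metis group_left_cancel group_left_inverse local.mult.assoc local.mult_1_right)

lemma group_right_cancel [simp]: "a * (inverse a * b) = b"
  by (metis group_right_inverse local.mult.assoc local.mult_1_left)

lemma group_inverse_unique: "a * b = 1 \<Longrightarrow> inverse a = b"
  by (metis group_left_cancel local.mult_1_right)

lemma group_inverse_inverse [simp]: "inverse (inverse a) = a"
  by (simp add: group_inverse_unique)

lemma group_inverse_one [simp]: "inverse 1 = 1"
  by (simp add: group_inverse_unique)

lemma group_inverse_mult [simp]: "inverse (a * b) = inverse b * inverse a"
  by (rule group_inverse_unique) (simp add: local.mult.assoc)

lemma group_cancel_left [simp]: "a * b = a * c \<longleftrightarrow> b = c"
  by (metis group_left_cancel)

lemma group_cancel_right [simp]: "b * a = c * a \<longleftrightarrow> b = c"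
  by (metis group_right_inverse local.mult.assoc local.mult_1_right)

lemma group_conj_eq_one [simp]: "inverse x * a * x = 1 \<longleftrightarrow> a = 1"
proof
  assume "inverse x * a * x = 1"
  then have "inverse x * a * x = inverse x * 1 * x" by simp
  then show "a = 1" by (simp only: group_cancel_left group_cancel_right)
qed simp

end

definition subgrp :: "'g::group_mult set \<Rightarrow> bool" where
  "subgrp S \<longleftrightarrow> 1 \<in> S \<and> (\<forall>x\<in>S. \<forall>y\<in>S. x * y \<in> S) \<and> (\<forall>x\<in>S. inverse x \<in> S)"

lemma subgrpD:
  assumes "subgrp S"
  shows subgrp_one: "1 \<in> S"
    and subgrp_mult: "\<And>x y. x \<in> S \<Longrightarrow> y \<in> S \<Longrightarrow> x * y \<in> S"
    and subgrp_inverse: "\<And>x. x \<in> S \<Longrightarrow> inverse x \<in> S"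
  using assms unfolding subgrp_def by auto

lemma subgrp_inverse_iff:
  assumes "subgrp S" shows "inverse x \<in> S \<longleftrightarrow> x \<in> S"
  using subgrp_inverse[OF assms, of x] subgrp_inverse[OF assms, of "inverse x"] by auto

lemma subgrp_cancel_left:
  assumes "subgrp S" "x \<in> S" shows "x * y \<in> S \<longleftrightarrow> y \<in> S"
proof
  assume "x * y \<in> S"
  then have "inverse x * (x * y) \<in> S" by (rule subgrp_mult[OF assms(1) subgrp_inverse[OF assms]])
  then show "y \<in> S" by simp
qed (use assms in \<open>auto intro: subgrp_mult\<close>)

lemma subgrp_cancel_right:
  assumes "subgrp S" "y \<in> S" shows "x * y \<in> S \<longleftrightarrow> x \<in> S"
proof
  assume "x * y \<in> S"
  then have "x * y * inverse y \<in> S" by (rule subgrp_mult[OF assms(1) _ subgrp_inverse[OF assms]])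
  then show "x \<in> S" by (simp add: mult.assoc)
qed (use assms in \<open>auto intro: subgrp_mult\<close>)

definition involution :: "'g::group_mult \<Rightarrow> bool" where
  "involution i \<longleftrightarrow> i \<noteq> 1 \<and> i * i = 1"

lemma involution_inverse: "involution i \<Longrightarrow> inverse i = i"
  unfolding involution_def by (simp add: group_inverse_unique)

lemma involution_cancel: "involution i \<Longrightarrow> i * (i * x) = x"
  unfolding involution_def by (simp flip: mult.assoc)

lemma square_conj: "(inverse x * a * (x :: _ :: group_mult)) * (inverse x * a * x) = inverse x * (a * a) * x"
  by (simp add: mult.assoc)

lemma involution_conj [simp]: "involution (inverse x * i * x) \<longleftrightarrow> involution i"
  unfolding involution_def square_conj by simp

lemma involution_conj' [simp]: "involution (x * i * inverse x) \<longleftrightarrow> involution i"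
  using involution_conj[of "inverse x" i] by simp

lemma conj_eq_iff: "inverse (x :: _ :: group_mult) * a * x = b \<longleftrightarrow> a = x * b * inverse x"
proof
  assume "inverse x * a * x = b"
  then show "a = x * b * inverse x" by (auto simp: mult.assoc)
next
  assume "a = x * b * inverse x"
  then show "inverse x * a * x = b" by (simp add: mult.assoc)
qed

text \<open>\<open>(True, m)\<close> is the map k -> m + k of the integers and
  \<open>(False, m)\<close> the reflection k -> m - k; the product rule is their
  composition.\<close>

definition dihedral :: "(bool \<times> int \<Rightarrow> 'g::group_mult) \<Rightarrow> bool" where
  "dihedral \<delta> \<longleftrightarrow> inj \<delta> \<and>
     (\<forall>a m b n. \<delta> (a, m) * \<delta> (b, n) = \<delta> (a = b, if a then m + n else m - n))"

text \<open>Malnormality is required for translations only, the elements with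
  \<open>z * z \<noteq> 1\<close>. It must fail for reflections: in the groups below all involutions
  are conjugate, so elements outside the subgroup conjugate reflections of it to each other.\<close>

definition isolated :: "'g::group_mult set \<Rightarrow> (bool \<times> int \<Rightarrow> 'g) \<Rightarrow> bool" where
  "isolated G \<delta> \<longleftrightarrow> dihedral \<delta> \<and> range \<delta> \<subseteq> G \<and>
     (\<forall>x\<in>G. \<forall>z\<in>range \<delta>. z * z \<noteq> 1 \<longrightarrow> inverse x * z * x \<in> range \<delta> \<longrightarrow> x \<in> range \<delta>)"

lemma isolatedD:
  assumes "isolated G \<delta>"
  shows "dihedral \<delta>" and "range \<delta> \<subseteq> G"
    and "\<And>x z. \<lbrakk>x \<in> G; z \<in> range \<delta>; z * z \<noteq> 1; inverse x * z * x \<in> range \<delta>\<rbrakk> \<Longrightarrow> x \<in> range \<delta>"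
  using assms unfolding isolated_def by auto

context
  fixes \<delta> :: "bool \<times> int \<Rightarrow> 'g::group_mult"
  assumes dihedral: "dihedral \<delta>"
begin

lemma dihedral_mult: "\<delta> (a, m) * \<delta> (b, n) = \<delta> (a = b, if a then m + n else m - n)"
  using dihedral unfolding dihedral_def by blast

lemma dihedral_eq: "\<delta> x = \<delta> y \<longleftrightarrow> x = y"
  using dihedral unfolding dihedral_def by (auto dest: injD)

lemma dihedral_one: "\<delta> (True, 0) = 1"
proof -
  have "\<delta> (True, 0) * \<delta> (True, 0) = \<delta> (True, 0) * 1"
    by (simp add: dihedral_mult)
  then show ?thesis by (simp only: group_cancel_left)
qed

lemma dihedral_inverse: "inverse (\<delta> (a, m)) = \<delta> (a, if a then - m else m)"
  by (rule group_inverse_unique) (simp add: dihedral_mult dihedral_one)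

lemma dihedral_subgrp: "subgrp (range \<delta>)"
  unfolding subgrp_def
proof (intro conjI ballI)
  show "1 \<in> range \<delta>" by (metis dihedral_one rangeI)
next
  fix x y assume "x \<in> range \<delta>" "y \<in> range \<delta>"
  then show "x * y \<in> range \<delta>" by (auto simp: dihedral_mult)
next
  fix x assume "x \<in> range \<delta>"
  then show "inverse x \<in> range \<delta>" by (auto simp: dihedral_inverse)
qed

lemma dihedral_square: "\<delta> (a, m) * \<delta> (a, m) = 1 \<longleftrightarrow> \<not> a \<or> m = 0"
  by (simp add: dihedral_mult dihedral_eq flip: dihedral_one)

lemma dihedral_translationE:
  assumes "z \<in> range \<delta>" "z * z \<noteq> 1"
  obtains m where "z = \<delta> (True, m)" "m \<noteq> 0"
proof -
  obtain a m where z: "z = \<delta> (a, m)" using assms(1) by auto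
  then have "a" "m \<noteq> 0" using assms(2) dihedral_square by auto
  then show ?thesis using that z by auto
qed

lemma dihedral_involutionE:
  assumes "z \<in> range \<delta>" "involution z"
  obtains m where "z = \<delta> (False, m)"
proof -
  obtain a m where z: "z = \<delta> (a, m)" using assms(1) by auto
  have "\<not> a"
  proof
    assume a
    then have "m = 0" using assms(2) dihedral_square z unfolding involution_def by auto
    then show False using assms(2) z \<open>a\<close> dihedral_one unfolding involution_def by simp
  qed
  then show ?thesis using that z by auto
qed

lemma dihedral_conj:
  assumes "z \<in> range \<delta>" "z * z \<noteq> 1" "y \<in> range \<delta>"
  shows "inverse y * z * y = z \<or> inverse y * z * y = inverse z"
proof -
  obtain m where "z = \<delta> (True, m)"
    using dihedral_translationE[OF assms(1,2)] by blast
  moreover obtain a n where "y = \<delta> (a, n)" using assms(3) by auto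
  ultimately show ?thesis by (cases a) (simp_all add: dihedral_mult dihedral_inverse dihedral_eq)
qed

end

text \<open>A dihedral group is generated by elements conjugating a given translation to itself or
  its inverse, so an isolated one is determined by any of its translations.\<close>

lemma dihedral_subset_isolated:
  assumes "dihedral \<delta>" "range \<delta> \<subseteq> G" "isolated G \<delta>'" "subgrp G"
    and "z \<in> range \<delta>" "z \<in> range \<delta>'" "z * z \<noteq> 1"
  shows "range \<delta> \<subseteq> range \<delta>'"
proof
  fix y assume y: "y \<in> range \<delta>"
  have "inverse y * z * y \<in> range \<delta>'"
    using dihedral_conj[OF assms(1) assms(5) assms(7) y] assms(6)
      subgrp_inverse[OF dihedral_subgrp[OF isolatedD(1)[OF assms(3)]]] by auto
  then show "y \<in> range \<delta>'"
    using isolatedD(3)[OF assms(3) _ assms(6,7)] y assms(2) by blast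
qed

lemma isolated_eq:
  assumes "isolated G \<delta>" "isolated G \<delta>'" "subgrp G"
    and "z \<in> range \<delta>" "z \<in> range \<delta>'" "z * z \<noteq> 1"
  shows "range \<delta> = range \<delta>'"
proof (rule subset_antisym)
  show "range \<delta> \<subseteq> range \<delta>'"
    using isolatedD(1,2)[OF assms(1)] assms(2-) by (intro dihedral_subset_isolated)
  show "range \<delta>' \<subseteq> range \<delta>"
    using isolatedD(1,2)[OF assms(2)] assms(1,3-) by (intro dihedral_subset_isolated)
qed

lemma isolated_conj:
  assumes "isolated G \<delta>" "subgrp G" "g \<in> G"
  shows "isolated G (\<lambda>x. inverse g * \<delta> x * g)"
proof -
  let ?c = "\<lambda>x. inverse g * \<delta> x * g"
  have D: "dihedral \<delta>" using isolatedD(1)[OF assms(1)] .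
  have "dihedral ?c"
    unfolding dihedral_def
  proof (intro conjI allI)
    show "inj ?c" using D unfolding dihedral_def inj_def by simp
    fix a m b n
    have "?c (a, m) * ?c (b, n) = inverse g * (\<delta> (a, m) * \<delta> (b, n)) * g"
      by (simp add: mult.assoc)
    then show "?c (a, m) * ?c (b, n) = ?c (a = b, if a then m + n else m - n)"
      by (simp only: dihedral_mult[OF D])
  qed
  moreover have "range ?c \<subseteq> G"
    using isolatedD(2)[OF assms(1)] assms(2,3) by (auto simp: subgrp_mult subgrp_inverse)
  moreover have "x \<in> range ?c"
    if x: "x \<in> G" and z: "z \<in> range ?c" "z * z \<noteq> 1" and c: "inverse x * z * x \<in> range ?c" for x z
  proof -
    obtain z' where z': "z' \<in> range \<delta>" "z = inverse g * z' * g" using z by auto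
    obtain y where y: "y \<in> range \<delta>" "inverse x * z * x = inverse g * y * g" using c by auto
    let ?x = "g * x * inverse g"
    have "inverse ?x * z' * ?x = g * (inverse x * z * x) * inverse g"
      unfolding z' by (simp add: mult.assoc)
    also have "\<dots> = y" unfolding y(2) by (simp add: mult.assoc)
    finally have "inverse ?x * z' * ?x \<in> range \<delta>" using y(1) by simp
    moreover have "?x \<in> G" using x assms(2,3) by (simp add: subgrp_mult subgrp_inverse)
    moreover have "z' * z' \<noteq> 1" using z(2) unfolding z' square_conj by simp
    ultimately have "?x \<in> range \<delta>" using isolatedD(3)[OF assms(1)] z'(1) by blast
    then obtain u where u: "?x = \<delta> u" by auto
    have "x = inverse g * ?x * g" by (simp add: mult.assoc)
    then show ?thesis unfolding u by auto
  qed
  ultimately show ?thesis unfolding isolated_def by blast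
qed

section \<open>Group actions on trees\<close>

fun lcp_length :: "'a list \<Rightarrow> 'a list \<Rightarrow> nat" where
  "lcp_length (x # u) (y # w) = (if x = y then Suc (lcp_length u w) else 0)"
| "lcp_length u w = 0"

lemma lcp_length_Nil [simp]: "lcp_length [] w = 0" "lcp_length w [] = 0"
  by (cases w; simp)+

lemma lcp_length_commute: "lcp_length u w = lcp_length w u"
  by (induction u w rule: lcp_length.induct) auto

lemma lcp_length_le: "lcp_length u w \<le> length u" "lcp_length u w \<le> length w"
  by (induction u w rule: lcp_length.induct) auto

lemma lcp_length_eq_length: "lcp_length u w = length u \<longleftrightarrow> u = take (length u) w"
  by (induction u w rule: lcp_length.induct) auto

lemma lcp_length_take: "lcp_length (take m w) (take n w) = min (length w) (min m n)"
proof (induction w arbitrary: m n)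
  case (Cons x w)
  then show ?case by (cases m; cases n) auto
qed simp

lemma lcp_length_eq_0: "lcp_length u w = 0 \<longleftrightarrow> u = [] \<or> w = [] \<or> hd u \<noteq> hd w"
  by (cases u; cases w) auto

text \<open>A vertex is the list of labels read on the way down from the root, so the path between
  two vertices climbs to their longest common prefix and descends again.\<close>

definition tree_dist :: "'a list \<Rightarrow> 'a list \<Rightarrow> int" where
  "tree_dist u w = int (length u) + int (length w) - 2 * int (lcp_length u w)"

lemma tree_dist_Nil [simp]: "tree_dist [] w = int (length w)" "tree_dist w [] = int (length w)"
  by (simp_all add: tree_dist_def)

lemma tree_dist_commute: "tree_dist u w = tree_dist w u"
  by (simp add: tree_dist_def lcp_length_commute)

lemma tree_dist_nonneg: "0 \<le> tree_dist u w"
  using lcp_length_le[of u w] by (simp add: tree_dist_def)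

lemma tree_dist_take:
  "tree_dist (take m w) (take n w) = \<bar>int (min m (length w)) - int (min n (length w))\<bar>"
  unfolding tree_dist_def lcp_length_take by (auto simp: min_def)

lemma tree_dist_between_root:
  assumes "int (length v) + tree_dist v w = int (length w)"
  shows "v = take (length v) w"
proof -
  have "lcp_length v w = length v" using assms by (simp add: tree_dist_def)
  then show ?thesis by (simp add: lcp_length_eq_length)
qed

lemma tree_dist_eq_0 [simp]: "tree_dist u w = 0 \<longleftrightarrow> u = w"
proof
  assume "tree_dist u w = 0"
  then have "lcp_length u w = length u" "length u = length w"
    using lcp_length_le[of u w] by (auto simp: tree_dist_def)
  then show "u = w" by (metis lcp_length_eq_length take_all_iff order_refl)
next
  assume "u = w"
  then show "tree_dist u w = 0" using tree_dist_take[of "length u" u "length u"] by simp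
qed

lemma tree_dist_eq_1:
  assumes "tree_dist u w = 1"
  shows "(\<exists>x. w = u @ [x]) \<or> (\<exists>x. u = w @ [x])"
proof -
  have *: "\<exists>x. b = a @ [x]" if "lcp_length a b = length a" "length b = Suc (length a)" for a b :: "'a list"
  proof -
    have "a = take (length a) b" using that(1) by (simp add: lcp_length_eq_length)
    then have "b = a @ drop (length a) b" by (metis append_take_drop_id)
    moreover have "length (drop (length a) b) = Suc 0" using that(2) by simp
    then have "\<exists>x. drop (length a) b = [x]" by (cases "drop (length a) b") (auto simp del: length_drop)
    ultimately show ?thesis by metis
  qed
  have "lcp_length u w = length u \<and> length w = Suc (length u)
      \<or> lcp_length w u = length w \<and> length u = Suc (length w)"
    using assms lcp_length_le[of u w] lcp_length_commute[of u w] unfolding tree_dist_def by arith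
  then show ?thesis using *[of u w] *[of w u] by blast
qed

text \<open>The images of 0 and 1 decide everything: an integer is recovered from its distances to
  two adjacent ones.\<close>

lemma int_isometry:
  fixes \<sigma> :: "int \<Rightarrow> int"
  assumes "\<And>a b. \<bar>\<sigma> a - \<sigma> b\<bar> = \<bar>a - b\<bar>"
  shows "(\<forall>n. \<sigma> n = \<sigma> 0 + n) \<or> (\<forall>n. \<sigma> n = \<sigma> 0 - n)"
proof -
  have 1: "\<sigma> 1 = \<sigma> 0 + 1 \<or> \<sigma> 1 = \<sigma> 0 - 1" using assms[of 1 0] by arith
  have "\<sigma> n = \<sigma> 0 + n" if "\<sigma> 1 = \<sigma> 0 + 1" for n
    using assms[of n 0] assms[of n 1] that by arith
  moreover have "\<sigma> n = \<sigma> 0 - n" if "\<sigma> 1 = \<sigma> 0 - 1" for n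
    using assms[of n 0] assms[of n 1] that by arith
  ultimately show ?thesis using 1 by blast
qed

fun int_aff :: "bool \<times> int \<Rightarrow> int \<Rightarrow> int" where
  "int_aff (a, c) n = (if a then c + n else c - n)"

text \<open>The concatenation of the images of a segment \<open>c\<close> of length \<open>D\<close> under the dihedral group
  generated by reflections \<open>I\<close> and \<open>J\<close> in its two ends.\<close>

function unfold_path :: "int \<Rightarrow> (int \<Rightarrow> 'a) \<Rightarrow> ('a \<Rightarrow> 'a) \<Rightarrow> ('a \<Rightarrow> 'a) \<Rightarrow> int \<Rightarrow> 'a" where
  "unfold_path D c I J n =
     (if D \<le> 0 \<or> 0 \<le> n \<and> n \<le> D then c n
      else if n < 0 then I (unfold_path D c I J (- n))
      else J (unfold_path D c I J (2 * D - n)))"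
  by auto
termination
  by (relation "measure (\<lambda>(D, c, I, J, n). nat (2 * \<bar>n\<bar> + (if n < 0 then 1 else 0)))") auto

declare unfold_path.simps [simp del]

lemma reflection_induct:
  fixes n :: int
  assumes "0 < D"
    and "\<And>n. 0 \<le> n \<Longrightarrow> n \<le> D \<Longrightarrow> P n"
    and "\<And>n. P n \<Longrightarrow> P (- n)"
    and "\<And>n. P n \<Longrightarrow> P (2 * D - n)"
  shows "P n"
\<comment> \<open>Reflection in 0 keeps the absolute value; the summand 1 for negative numbers makes
  this step decrease the measure as well.\<close>
proof (induction "nat (2 * \<bar>n\<bar> + (if n < 0 then 1 else 0))" arbitrary: n rule: less_induct)
  case less
  consider "0 \<le> n" "n \<le> D" | "n < 0" | "n > D" by linarith
  then show ?case
  proof cases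
    case 1
    then show ?thesis by (rule assms(2))
  next
    case 2
    then have "P (- n)" by (intro less) auto
    then show ?thesis using assms(3)[of "- n"] by simp
  next
    case 3
    then have "P (2 * D - n)" using assms(1) by (intro less) auto
    then show ?thesis using assms(4)[of "2 * D - n"] by simp
  qed
qed

text \<open>The last three assumptions mention only the root because the action is transitive on
  vertices. \<open>stab_three\<close> is a weak acylindricity: only elements with square 1 may fix a
  path of length three. \<open>stab_commute\<close> disposes of those in
  \<open>line_faithful\<close>.\<close>

locale tree_action =
  fixes \<Gamma> :: "'g::group_mult set" and V :: "'v list set" and act :: "'g \<Rightarrow> 'v list \<Rightarrow> 'v list"
  assumes subgrp: "subgrp \<Gamma>"
    and Nil_in_V: "[] \<in> V"
    and take_in_V: "w \<in> V \<Longrightarrow> take n w \<in> V"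
    and act_in_V: "x \<in> \<Gamma> \<Longrightarrow> w \<in> V \<Longrightarrow> act x w \<in> V"
    and act_one: "w \<in> V \<Longrightarrow> act 1 w = w"
    and act_mult: "x \<in> \<Gamma> \<Longrightarrow> y \<in> \<Gamma> \<Longrightarrow> w \<in> V \<Longrightarrow> act (x * y) w = act x (act y w)"
    and act_isometry: "x \<in> \<Gamma> \<Longrightarrow> u \<in> V \<Longrightarrow> w \<in> V \<Longrightarrow> tree_dist (act x u) (act x w) = tree_dist u w"
    and act_transitive: "w \<in> V \<Longrightarrow> \<exists>x\<in>\<Gamma>. act x [] = w"
    and no_inversion_root: "x \<in> \<Gamma> \<Longrightarrow> act x [] = [a] \<Longrightarrow> act x [a] \<noteq> []"
    and stab_commute: "\<lbrakk>x \<in> \<Gamma>; y \<in> \<Gamma>; act x [] = []; act y [] = []; involution x; involution y;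
           x * y = y * x\<rbrakk> \<Longrightarrow> x = y"
    and stab_three: "\<lbrakk>x \<in> \<Gamma>; act x [] = []; w \<in> V; length w = 3; act x w = w\<rbrakk> \<Longrightarrow> x * x = 1"
begin

lemmas grp_mult = subgrp_mult[OF subgrp] and grp_inverse = subgrp_inverse[OF subgrp]
  and grp_one = subgrp_one[OF subgrp]

lemma grp_conj: "x \<in> \<Gamma> \<Longrightarrow> y \<in> \<Gamma> \<Longrightarrow> inverse x * y * x \<in> \<Gamma>"
  by (simp add: grp_mult grp_inverse)

lemma act_inverse_cancel [simp]:
  assumes "x \<in> \<Gamma>" "w \<in> V"
  shows "act (inverse x) (act x w) = w" "act x (act (inverse x) w) = w"
  using assms act_mult[of "inverse x" x w] act_mult[of x "inverse x" w]
  by (simp_all add: act_one grp_inverse)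

lemma act_eq_iff: "\<lbrakk>x \<in> \<Gamma>; u \<in> V; w \<in> V\<rbrakk> \<Longrightarrow> act x u = act x w \<longleftrightarrow> u = w"
  by (metis act_inverse_cancel(1))

lemma act_conj:
  assumes "x \<in> \<Gamma>" "y \<in> \<Gamma>" "w \<in> V"
  shows "act (inverse x * y * x) w = act (inverse x) (act y (act x w))"
  using assms by (simp add: act_mult act_in_V grp_mult grp_inverse)

lemma move_to_root: "w \<in> V \<Longrightarrow> \<exists>x\<in>\<Gamma>. act x w = []"
proof -
  assume "w \<in> V"
  then obtain x where "x \<in> \<Gamma>" "act x [] = w" using act_transitive by blast
  then show ?thesis using act_inverse_cancel(1)[OF _ Nil_in_V, of x] grp_inverse by blast
qed

text \<open>With \<open>a\<close> moved to the root, a vertex on the geodesic becomes a prefix of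
  the image of \<open>b\<close>, and its length is its distance from \<open>a\<close>.\<close>

lemma geodesic_unique:
  assumes "a \<in> V" "b \<in> V" "u \<in> V" "v \<in> V"
    and "tree_dist a u + tree_dist u b = tree_dist a b"
    and "tree_dist a v = tree_dist a u" "tree_dist v b = tree_dist u b"
  shows "u = v"
proof -
  obtain x where x: "x \<in> \<Gamma>" "act x a = []" using move_to_root assms(1) by blast
  have d: "int (length (act x w)) = tree_dist a w" if "w \<in> V" for w
    using act_isometry[OF x(1) assms(1) that] x(2) by simp
  have "act x w = take (nat (tree_dist a u)) (act x b)"
    if "w \<in> V" "tree_dist a w = tree_dist a u" "tree_dist w b = tree_dist u b" for w
  proof -
    have "act x w = take (length (act x w)) (act x b)"
      using d[OF that(1)] d[OF assms(2)] act_isometry[OF x(1) that(1) assms(2)] that assms(5)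
      by (intro tree_dist_between_root) simp
    moreover have "length (act x w) = nat (tree_dist a u)" using d[OF that(1)] that(2) by simp
    ultimately show ?thesis by simp
  qed
  from this[of u] this[of v] have "act x u = act x v" using assms by simp
  then show ?thesis using act_eq_iff x(1) assms by blast
qed

lemma no_inversion:
  assumes "x \<in> \<Gamma>" "u \<in> V" "v \<in> V" "tree_dist u v = 1" "act x u = v"
  shows "act x v \<noteq> u"
proof
  assume c: "act x v = u"
  obtain y where y: "y \<in> \<Gamma>" "act y [] = u" using act_transitive assms(2) by blast
  let ?v = "act (inverse y) v" and ?x = "inverse y * x * y"
  have "int (length ?v) = tree_dist u v"
    using act_isometry[of "inverse y" u v] y assms(2,3) act_inverse_cancel(1)[OF y(1) Nil_in_V]
    by (simp add: grp_inverse)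
  then obtain a where a: "?v = [a]"
    using assms(4) by (cases ?v) auto
  have "act ?x [] = [a]" using act_conj[OF y(1) assms(1) Nil_in_V] y assms(5) a by simp
  moreover have "act ?x [a] = []"
    using act_conj[OF y(1) assms(1), of "?v"] y assms(3) a c act_in_V[of "inverse y" v]
      act_inverse_cancel(1)[OF y(1) Nil_in_V] act_inverse_cancel(2)[OF y(1) assms(3)]
    by (simp add: grp_inverse)
  ultimately show False using no_inversion_root grp_conj[OF y(1) assms(1)] by blast
qed

text \<open>Such an element reverses the geodesic from the root to its image, hence fixes the midpoint:
  the geodesic has even length since there are no inversions.\<close>

lemma square_one_fixes_vertex:
  assumes "i \<in> \<Gamma>" "i * i = 1"
  shows "\<exists>v\<in>V. act i v = v"
proof -
  define w where "w = act i []"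
  define n where "n = length w"
  have w: "w \<in> V" "act i w = []"
    using act_in_V[OF assms(1) Nil_in_V] act_mult[OF assms(1) assms(1) Nil_in_V] assms(2)
    by (auto simp: w_def act_one Nil_in_V)
  have rev: "act i (take k w) = take (n - k) w" if "k \<le> n" for k
  proof -
    let ?v = "act i (take k w)"
    have k: "take k w \<in> V" using w take_in_V by blast
    have 1: "tree_dist ?v w = int k"
      using act_isometry[OF assms(1) k Nil_in_V] that by (simp add: w_def[symmetric] n_def)
    have 2: "int (length ?v) = int (n - k)"
      using act_isometry[OF assms(1) k w(1)] w(2) that tree_dist_take[of k w "length w"]
      by (simp add: n_def)
    have "?v = take (length ?v) w"
      using 1 2 that by (intro tree_dist_between_root) (simp add: n_def)
    then show ?thesis using 2 by simp
  qed
  show ?thesis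
  proof (cases "even n")
    case True
    then obtain k where "n = 2 * k" by (rule evenE)
    then have "act i (take k w) = take k w" using rev[of k] by (simp add: mult_2)
    then show ?thesis using take_in_V[OF w(1)] by blast
  next
    case False
    then obtain k where k: "n = Suc (2 * k)" by (auto elim: oddE)
    have "act i (take k w) = take (Suc k) w" "act i (take (Suc k) w) = take k w"
      using rev[of k] rev[of "Suc k"] k by (simp_all add: Suc_diff_le mult_2)
    moreover have "tree_dist (take k w) (take (Suc k) w) = 1"
      using k by (simp add: tree_dist_take flip: n_def)
    ultimately have False using no_inversion[OF assms(1)] take_in_V[OF w(1)] by blast
    then show ?thesis ..
  qed
qed

lemma geodesic_exists:
  assumes "u \<in> V" "v \<in> V"
  obtains c where "c 0 = u" "c (tree_dist u v) = v" "\<And>a. c a \<in> V"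
    "\<And>a b. \<lbrakk>0 \<le> a; a \<le> tree_dist u v; 0 \<le> b; b \<le> tree_dist u v\<rbrakk> \<Longrightarrow> tree_dist (c a) (c b) = \<bar>a - b\<bar>"
proof -
  obtain x where x: "x \<in> \<Gamma>" "act x [] = u" using act_transitive assms(1) by blast
  define w where "w = act (inverse x) v"
  have w: "w \<in> V" "act x w = v" using x assms by (simp_all add: w_def act_in_V grp_inverse)
  have D: "tree_dist u v = int (length w)"
    using act_isometry[OF x(1) Nil_in_V w(1)] x(2) w(2) by simp
  define c where "c a = act x (take (nat a) w)" for a
  show thesis
  proof
    show "c 0 = u" "c (tree_dist u v) = v" using x w D by (simp_all add: c_def)
    show "c a \<in> V" for a using x(1) w(1) by (simp add: c_def act_in_V take_in_V)
    show "tree_dist (c a) (c b) = \<bar>a - b\<bar>"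
      if "0 \<le> a" "a \<le> tree_dist u v" "0 \<le> b" "b \<le> tree_dist u v" for a b
      using that D x(1) w(1) by (simp add: c_def act_isometry take_in_V tree_dist_take)
  qed
qed

section \<open>Lines in the tree\<close>

lemma reduced_ray_length:
  assumes "q 0 = []"
    and "\<And>k::nat. tree_dist (q k) (q (Suc k)) = 1" and "\<And>k. q k \<noteq> q (Suc (Suc k))"
  shows "length (q k) = k"
proof -
  have "length (q k) = k \<and> (\<exists>x. q (Suc k) = q k @ [x])"
  proof (induction k)
    case 0
    then show ?case using assms(1) assms(2)[of 0] by (cases "q 1") auto
  next
    case (Suc k)
    then obtain x where x: "q (Suc k) = q k @ [x]" "length (q k) = k" by blast
    \<comment> \<open>An upward step from \<open>q (Suc k)\<close> could only lead back to its
      parent \<open>q k\<close>, so a reduced path that has started to descend keeps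
      descending.\<close>
    have "\<not> (\<exists>y. q (Suc k) = q (Suc (Suc k)) @ [y])"
      using assms(3)[of k] x(1) by auto
    then show ?case using tree_dist_eq_1[OF assms(2)[of "Suc k"]] x by auto
  qed
  then show ?thesis ..
qed

definition line :: "(int \<Rightarrow> 'v list) \<Rightarrow> bool" where
  "line p \<longleftrightarrow> range p \<subseteq> V \<and> (\<forall>a b. tree_dist (p a) (p b) = \<bar>a - b\<bar>)"

lemma lineD: "line p \<Longrightarrow> p a \<in> V" "line p \<Longrightarrow> tree_dist (p a) (p b) = \<bar>a - b\<bar>"
  unfolding line_def by auto

lemma line_eq_iff: "line p \<Longrightarrow> p a = p b \<longleftrightarrow> a = b"
  using lineD(2)[of p a b] tree_dist_eq_0[of "p a" "p b"] by auto

text \<open>Absence of backtracking is a local condition. With \<open>p a\<close> moved to the root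
  the path can only descend, which yields all distances from \<open>p a\<close>.\<close>

lemma reduced_path_line:
  assumes "\<And>n. p n \<in> V" and "\<And>n. tree_dist (p n) (p (n + 1)) = 1"
    and "\<And>n. p (n - 1) \<noteq> p (n + 1)"
  shows "line p"
proof -
  have *: "tree_dist (p a) (p (a + int k)) = int k" for a k
  proof -
    obtain x where x: "x \<in> \<Gamma>" "act x (p a) = []" using move_to_root assms(1) by blast
    define q where "q k = act x (p (a + int k))" for k
    have "length (q k) = k"
    proof (rule reduced_ray_length)
      show "q 0 = []" using x by (simp add: q_def)
      show "tree_dist (q k) (q (Suc k)) = 1" for k
        using assms(1) assms(2)[of "a + int k"] x(1) by (simp add: q_def act_isometry ac_simps)
      show "q k \<noteq> q (Suc (Suc k))" for k
        using assms(1) assms(3)[of "a + int k + 1"] x(1) by (simp add: q_def act_eq_iff ac_simps)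
    qed
    then show ?thesis using act_isometry[OF x(1) assms(1) assms(1), of a "a + int k"] x(2) by (simp add: q_def)
  qed
  have "tree_dist (p a) (p b) = \<bar>a - b\<bar>" for a b
    using *[of a "nat (b - a)"] *[of b "nat (a - b)"] tree_dist_commute[of "p a" "p b"]
    by (cases "a \<le> b") auto
  then show ?thesis using assms(1) unfolding line_def by auto
qed

lemma line_act: "x \<in> \<Gamma> \<Longrightarrow> line p \<Longrightarrow> line (\<lambda>n. act x (p n))"
  by (auto simp: line_def act_isometry act_in_V image_subset_iff)

text \<open>As \<open>z\<close> shifts both lines, corresponding points stay at a constant distance
  in both directions. Far out, the two ends of \<open>q\<close> lie in different branches at the
  root and the nearby points of \<open>p\<close> lie in the same branches, so the geodesic between
  those, a part of \<open>p\<close>, passes through the root.\<close>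

lemma lines_meet_root:
  assumes "line p" "line q" "z \<in> \<Gamma>" "m \<noteq> 0" "m' \<noteq> 0"
    and p: "\<And>n. act z (p n) = p (n + m)" and q: "\<And>n. act z (q n) = q (n + m')"
    and "q 0 = []"
  shows "[] \<in> range p"
proof -
  note V = lineD(1)[OF assms(1)] lineD(1)[OF assms(2)]
  define D where "D = tree_dist (p 0) (q 0)"
  have shift: "tree_dist (p (n + m)) (q (n' + m')) = tree_dist (p n) (q n')" for n n'
    using act_isometry[OF assms(3) V(1)[of n] V(2)[of n']] p q by simp
  have D: "tree_dist (p (int k * m)) (q (int k * m')) = D
     \<and> tree_dist (p (- (int k * m))) (q (- (int k * m'))) = D" for k
  proof (induction k)
    case (Suc k)
    then show ?case
      using shift[of "int k * m" "int k * m'"] shift[of "- (int (Suc k) * m)" "- (int (Suc k) * m')"]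
      by (simp add: algebra_simps)
  qed (simp add: D_def)
  \<comment> \<open>\<open>D + 1\<close> shifts bring \<open>q\<close> to a distance from the root
    larger than its distance \<open>D\<close> from \<open>p\<close>, so the two points share their
    first edge.\<close>
  define k where "k = nat (D + 1)"
  have k: "int k = D + 1" using tree_dist_nonneg[of "p 0" "q 0"] by (simp add: k_def D_def)
  define a where "a = int k * m"
  let ?b = "int k * m'"
  have b: "\<bar>?b\<bar> > D"
  proof -
    have "1 \<le> \<bar>m'\<bar>" using assms(5) by linarith
    then have "int k * 1 \<le> int k * \<bar>m'\<bar>" by (intro mult_left_mono) auto
    then show ?thesis using k by (simp add: abs_mult)
  qed
  have len_q: "int (length (q n)) = \<bar>n\<bar>" for n
    using lineD(2)[OF assms(2), of 0 n] assms(8) by simp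
  have "lcp_length (q ?b) (q (- ?b)) = 0"
    using lineD(2)[OF assms(2), of ?b "- ?b"] len_q[of ?b] len_q[of "- ?b"]
    unfolding tree_dist_def by linarith
  moreover have "lcp_length (p a) (q ?b) \<noteq> 0"
    using D[of k] len_q[of ?b] b unfolding a_def tree_dist_def by linarith
  moreover have "lcp_length (p (- a)) (q (- ?b)) \<noteq> 0"
    using D[of k] len_q[of "- ?b"] b unfolding a_def tree_dist_def by linarith
  ultimately have "lcp_length (p a) (p (- a)) = 0"
    unfolding lcp_length_eq_0 by auto
  then have sum: "int (length (p a)) + int (length (p (- a))) = \<bar>2 * a\<bar>"
    using lineD(2)[OF assms(1), of a "- a"] unfolding tree_dist_def by linarith
  \<comment> \<open>The root must lie on \<open>p\<close> at distance \<open>length (p a)\<close>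
    from \<open>p a\<close>, in the direction of \<open>p (- a)\<close>.\<close>
  define s where "s = (if a \<ge> 0 then a - int (length (p a)) else a + int (length (p a)))"
  have s: "tree_dist (p a) (p s) = int (length (p a))" "tree_dist (p s) (p (- a)) = int (length (p (- a)))"
    unfolding lineD(2)[OF assms(1)] s_def using sum by (auto split: if_splits)
  have "[] = p s"
    by (rule geodesic_unique[OF V(1)[of a] V(1)[of "- a"] Nil_in_V V(1)])
       (use s sum lineD(2)[OF assms(1), of a "- a"] in auto)
  then show ?thesis by auto
qed

text \<open>Uniqueness of the axis of a shifting element: any point of \<open>q\<close> can be moved
  to the root, where the preceding lemma applies.\<close>

lemma lines_agree:
  assumes "line p" "line q" "z \<in> \<Gamma>" "m \<noteq> 0" "m' \<noteq> 0"
    and p: "\<And>n. act z (p n) = p (n + m)" and q: "\<And>n. act z (q n) = q (n + m')"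
  shows "q n \<in> range p"
proof -
  note V = lineD(1)[OF assms(1)] lineD(1)[OF assms(2)]
  obtain x where x: "x \<in> \<Gamma>" "act (inverse x) (q n) = []"
  proof -
    obtain y where "y \<in> \<Gamma>" "act y (q n) = []" using move_to_root V(2) by blast
    then show thesis using that[of "inverse y"] grp_inverse by simp
  qed
  let ?x = "inverse x"
  have "[] \<in> range (\<lambda>k. act ?x (p k))"
  proof (rule lines_meet_root)
    show "line (\<lambda>k. act ?x (p k))" using assms(1) x(1) by (simp add: line_act grp_inverse)
    have "line (\<lambda>k. q (n + k))" using assms(2) unfolding line_def by auto
    then show "line (\<lambda>k. act ?x (q (n + k)))" using x(1) by (simp add: line_act grp_inverse)
    show "?x * z * x \<in> \<Gamma>" using x(1) assms(3) by (rule grp_conj)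
    show "m \<noteq> 0" "m' \<noteq> 0" by fact+
    show "act (?x * z * x) (act ?x (p k)) = act ?x (p (k + m))" for k
      using x(1) assms(3) V by (simp add: act_conj act_in_V grp_inverse p)
    show "act (?x * z * x) (act ?x (q (n + k))) = act ?x (q (n + (k + m')))" for k
      using x(1) assms(3) V by (simp add: act_conj act_in_V grp_inverse q add.assoc)
    show "act ?x (q (n + 0)) = []" using x(2) by simp
  qed
  then obtain k where "act ?x (p k) = act ?x (q n)" unfolding x(2) by (metis imageE)
  then show ?thesis using act_eq_iff[OF grp_inverse[OF x(1)] V, of k n] by (metis rangeI)
qed

end

section \<open>Stabilizers of lines\<close>

context tree_action
begin

definition moves :: "(int \<Rightarrow> 'v list) \<Rightarrow> 'g \<Rightarrow> bool \<times> int \<Rightarrow> bool" where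
  "moves p x s \<longleftrightarrow> (\<forall>n. act x (p n) = p (int_aff s n))"

lemma moves_mult:
  assumes "line p" "x \<in> \<Gamma>" "y \<in> \<Gamma>" "moves p x (a, m)" "moves p y (b, n)"
  shows "moves p (x * y) (a = b, if a then m + n else m - n)"
  using assms lineD(1)[OF assms(1)] by (auto simp: moves_def act_mult algebra_simps)

lemma moves_inverse:
  assumes "line p" "x \<in> \<Gamma>" "moves p x (True, m)"
  shows "moves p (inverse x) (True, - m)"
  unfolding moves_def
proof
  fix n
  have "act x (p (n - m)) = p n" using assms(3) by (simp add: moves_def)
  then show "act (inverse x) (p n) = p (int_aff (True, - m) n)"
    using act_inverse_cancel(1)[OF assms(2) lineD(1)[OF assms(1)], of "n - m"] by simp
qed

lemma moves_unique:
  assumes "line p" "moves p x s" "moves p x s'"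
  shows "s = s'"
proof -
  have e: "int_aff s n = int_aff s' n" for n
    using assms line_eq_iff[OF assms(1)] by (auto simp: moves_def)
  show ?thesis using e[of 0] e[of 1] by (cases s; cases s') (auto split: if_splits)
qed

lemma moves_exists:
  assumes "line p" "x \<in> \<Gamma>" "\<And>n. act x (p n) \<in> range p"
  shows "\<exists>s. moves p x s"
proof -
  have "\<forall>n. \<exists>k. act x (p n) = p k" using assms(3) by (metis imageE)
  then obtain \<sigma> where \<sigma>: "\<And>n. act x (p n) = p (\<sigma> n)" by metis
  have "\<bar>\<sigma> a - \<sigma> b\<bar> = \<bar>a - b\<bar>" for a b
    using act_isometry[OF assms(2) lineD(1)[OF assms(1)] lineD(1)[OF assms(1)], of a b] \<sigma>
    by (simp add: lineD(2)[OF assms(1)])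
  then have "(\<forall>n. \<sigma> n = \<sigma> 0 + n) \<or> (\<forall>n. \<sigma> n = \<sigma> 0 - n)" by (rule int_isometry)
  then show ?thesis
  proof
    assume h: "\<forall>n. \<sigma> n = \<sigma> 0 + n"
    have "act x (p n) = p (int_aff (True, \<sigma> 0) n)" for n
      using \<sigma>[of n] spec[OF h, of n] by (simp only: int_aff.simps if_True)
    then show ?thesis unfolding moves_def by blast
  next
    assume h: "\<forall>n. \<sigma> n = \<sigma> 0 - n"
    have "act x (p n) = p (int_aff (False, \<sigma> 0) n)" for n
      using \<sigma>[of n] spec[OF h, of n] by (simp only: int_aff.simps if_False)
    then show ?thesis unfolding moves_def by blast
  qed
qed

lemma stab_three_line:
  assumes "line p" "x \<in> \<Gamma>" "moves p x (True, 0)"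
  shows "x * x = 1"
proof -
  have V: "p n \<in> V" for n using lineD(1)[OF assms(1)] .
  have fx: "act x (p n) = p n" for n using assms(3) by (simp add: moves_def)
  obtain y where y: "y \<in> \<Gamma>" "act y [] = p 0" using act_transitive V by blast
  have y0: "act (inverse y) (p 0) = []"
    using act_inverse_cancel(1)[OF y(1) Nil_in_V] y(2) by simp
  let ?x = "inverse y * x * y" and ?w = "act (inverse y) (p 3)"
  have w: "?w \<in> V" "act y ?w = p 3" using y(1) V by (simp_all add: act_in_V grp_inverse)
  have "?x * ?x = 1"
  proof (rule stab_three)
    show "?x \<in> \<Gamma>" using y assms(2) by (simp add: grp_conj)
    show "act ?x [] = []" using act_conj[OF y(1) assms(2) Nil_in_V] fx y y0 by simp
    show "?w \<in> V" by fact
    show "act ?x ?w = ?w" using act_conj[OF y(1) assms(2) w(1)] fx w by simp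
    show "length ?w = 3"
      using act_isometry[OF grp_inverse[OF y(1)] V V, of 0 3] y0 lineD(2)[OF assms(1), of 0 3] by simp
  qed
  then show ?thesis unfolding square_conj by simp
qed

lemma commuting_involutions_fixing:
  assumes "v \<in> V" "x \<in> \<Gamma>" "y \<in> \<Gamma>" "act x v = v" "act y v = v" "involution x" "involution y"
    and "x * y = y * x"
  shows "x = y"
proof -
  obtain g where g: "g \<in> \<Gamma>" "act g [] = v" using act_transitive assms(1) by blast
  have g0: "act (inverse g) v = []" using act_inverse_cancel(1)[OF g(1) Nil_in_V] g(2) by simp
  have "inverse g * x * g = inverse g * y * g"
  proof (rule stab_commute)
    show "inverse g * x * g \<in> \<Gamma>" "inverse g * y * g \<in> \<Gamma>" using assms g by (simp_all add: grp_conj)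
    show "act (inverse g * x * g) [] = []" "act (inverse g * y * g) [] = []"
      using act_conj[OF g(1) _ Nil_in_V] assms g g0 by simp_all
    have "inverse g * x * g * (inverse g * y * g) = inverse g * (x * y) * g"
      by (simp add: mult.assoc)
    also have "\<dots> = inverse g * y * g * (inverse g * x * g)"
      unfolding assms(8) by (simp add: mult.assoc)
    finally show "inverse g * x * g * (inverse g * y * g) = inverse g * y * g * (inverse g * x * g)" .
  qed (use assms in simp_all)
  then show ?thesis by simp
qed

text \<open>The pointwise stabilizer of a line has exponent two. A nontrivial element \<open>x\<close> of it commutes
  with its conjugate under the reflection \<open>i\<close>, so that \<open>x\<close> commutes with \<open>i\<close> and hence equals it.\<close>

lemma line_faithful:
  assumes "line p" "i \<in> \<Gamma>" "involution i" "moves p i (False, 0)"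
    and "x \<in> \<Gamma>" "moves p x (True, 0)"
  shows "x = 1"
proof (rule ccontr)
  assume "x \<noteq> 1"
  have V: "p n \<in> V" for n using lineD(1)[OF assms(1)] .
  note invol = stab_three_line[OF assms(1)]
  have x: "involution x" using invol assms(5,6) \<open>x \<noteq> 1\<close> unfolding involution_def by blast
  let ?y = "i * x * i"
  have ii: "inverse i = i" using assms(3) by (rule involution_inverse)
  have y: "?y \<in> \<Gamma>" using assms by (simp add: grp_mult)
  have yi: "involution ?y" using x involution_conj[of i x] ii by simp
  have ym: "moves p ?y (True, 0)"
    using moves_mult[OF assms(1) grp_mult[OF assms(2,5)] assms(2) moves_mult[OF assms(1,2,5,4,6)] assms(4)]
    by simp
  have "(x * ?y) * (x * ?y) = 1"
    using moves_mult[OF assms(1,5) y assms(6) ym] grp_mult[OF assms(5) y] by (intro invol) simp_all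
  then have "inverse (x * ?y) = x * ?y" by (rule group_inverse_unique)
  moreover have "inverse (x * ?y) = inverse ?y * inverse x" by (rule group_inverse_mult)
  then have "inverse (x * ?y) = ?y * x"
    by (simp only: involution_inverse[OF x] involution_inverse[OF yi])
  ultimately have "x * ?y = ?y * x" by simp
  then have "x = ?y"
    using commuting_involutions_fixing[OF V[of 0] assms(5) y _ _ x yi] assms(6) ym by (simp add: moves_def)
  then have "i * x = i * (i * (x * i))" by (simp add: mult.assoc)
  then have "x * i = i * x" by (simp only: involution_cancel[OF assms(3)])
  then have "x = i"
    using commuting_involutions_fixing[OF V[of 0] assms(5,2) _ _ x assms(3)] assms(4,6) by (simp add: moves_def)
  then show False using moves_unique[OF assms(1) assms(4)] assms(6) by blast
qed

text \<open>The shifts of the line form a subgroup of the integers, nonzero because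
  \<open>j * i\<close> shifts by \<open>c\<close>, hence generated by its least positive element
  \<open>d\<close>. By \<open>line_faithful\<close> an element is determined by its motion of the
  line, so the stabilizer is dihedral; it is isolated because a shift has only one axis.\<close>

lemma line_stabilizer_isolated:
  assumes p: "line p" and i: "i \<in> \<Gamma>" "involution i" "moves p i (False, 0)"
    and j: "j \<in> \<Gamma>" "moves p j (False, c)" "c \<noteq> 0"
  obtains \<delta> where "isolated \<Gamma> \<delta>" "range \<delta> = {x \<in> \<Gamma>. \<exists>s. moves p x s}"
proof -
  note faithful = line_faithful[OF p i]
  note mm = moves_mult[OF p]
  define T where "T m \<longleftrightarrow> (\<exists>x\<in>\<Gamma>. moves p x (True, m))" for m
  have T_minus: "T (- m)" if "T m" for m
    using that moves_inverse[OF p] grp_inverse unfolding T_def by blast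
  have T_add: "T (m + n)" if T: "T m" "T n" for m n

  proof -
    obtain x y where xy: "x \<in> \<Gamma>" "moves p x (True, m)" "y \<in> \<Gamma>" "moves p y (True, n)"
      using T unfolding T_def by blast
    show ?thesis using mm[OF xy(1,3,2,4)] grp_mult[OF xy(1,3)] unfolding T_def by auto
  qed
  have T_0: "T 0" using act_one lineD(1)[OF p] grp_one unfolding T_def moves_def by auto
  have "T \<bar>c\<bar>"
  proof -
    have "T c" using mm[OF j(1) i(1) j(2) i(3)] grp_mult[OF j(1) i(1)] unfolding T_def by auto
    then show ?thesis using T_minus by (simp add: abs_if)
  qed
  then have ex: "\<exists>n::nat. 0 < n \<and> T (int n)" using j(3) by (intro exI[of _ "nat \<bar>c\<bar>"]) auto
  define d where "d = int (LEAST n. 0 < n \<and> T (int n))"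
  have d: "0 < d" "T d" using LeastI_ex[OF ex] by (simp_all add: d_def)
  have d_min: "d \<le> m" if "0 < m" "T m" for m
    using Least_le[of "\<lambda>n. 0 < n \<and> T (int n)" "nat m"] that by (simp add: d_def)
  have T_mult: "T (d * n)" for n
  proof -
    have *: "T (d * int n)" for n
      by (induction n) (use T_0 T_add[OF d(2)] in \<open>auto simp: ring_distribs\<close>)
    show ?thesis using *[of "nat n"] T_minus[OF *[of "nat (- n)"]] by (cases "0 \<le> n") auto
  qed
  have T_dvd: "\<exists>n. m = d * n" if "T m" for m
  proof -
    have "T (m mod d)"
      using T_add[OF that T_minus[OF T_mult[of "m div d"]]] by (simp add: minus_mult_div_eq_mod)
    then have "m mod d = 0"
      using d_min[of "m mod d"] pos_mod_bound[OF d(1), of m] pos_mod_sign[OF d(1), of m] by force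
    then have "d dvd m" by (rule mod_0_imp_dvd)
    then show ?thesis unfolding dvd_def .
  qed
  define B where "B = {x \<in> \<Gamma>. \<exists>s. moves p x s}"
  have ex_elt: "\<exists>x\<in>\<Gamma>. moves p x (a, d * n)" for a n
  proof -
    obtain x where x: "x \<in> \<Gamma>" "moves p x (True, d * n)" using T_mult unfolding T_def by blast
    then have "moves p (x * i) (False, d * n)" using mm[OF x(1) i(1) x(2) i(3)] by simp
    then show ?thesis using x grp_mult[OF x(1) i(1)] by (cases a) auto
  qed
  have uniq: "x = y" if "x \<in> \<Gamma>" "y \<in> \<Gamma>" "moves p x s" "moves p y s" for x y s
  proof -
    have "moves p (inverse x * y) (True, 0)"
      unfolding moves_def
    proof
      fix n
      have "act (inverse x * y) (p n) = act (inverse x) (act x (p n))"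
        using that lineD(1)[OF p] by (simp add: act_mult grp_inverse moves_def)
      then show "act (inverse x * y) (p n) = p (int_aff (True, 0) n)"
        using that(1) lineD(1)[OF p] by simp
    qed
    then have "inverse x * y = 1" using faithful that by (simp add: grp_mult grp_inverse)
    then show ?thesis by (metis group_right_cancel mult_1_right)
  qed
  define \<delta> where "\<delta> s = (SOME x. x \<in> \<Gamma> \<and> moves p x (fst s, d * snd s))" for s
  have \<delta>: "\<delta> (a, n) \<in> \<Gamma>" "moves p (\<delta> (a, n)) (a, d * n)" for a n
    using someI_ex[OF ex_elt[of a n, unfolded Bex_def]] by (simp_all add: \<delta>_def)
  have range: "range \<delta> = B"
  proof (intro subset_antisym subsetI)
    fix x assume "x \<in> range \<delta>"
    then obtain a n where "x = \<delta> (a, n)" by auto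
    then show "x \<in> B" using \<delta>[of a n] unfolding B_def by blast
  next
    fix x assume "x \<in> B"
    then obtain a m where x: "x \<in> \<Gamma>" "moves p x (a, m)" by (auto simp: B_def)
    have "T m"
    proof (cases a)
      case True
      then show ?thesis using x unfolding T_def by auto
    next
      case False
      then have "moves p (x * i) (True, m)" using mm[OF x(1) i(1) x(2) i(3)] by simp
      then show ?thesis using grp_mult[OF x(1) i(1)] unfolding T_def by blast
    qed
    then obtain n where "m = d * n" using T_dvd by blast
    then have "x = \<delta> (a, n)" using uniq[OF x(1) \<delta>(1)] \<delta>(2) x(2) by blast
    then show "x \<in> range \<delta>" by blast
  qed
  have dih: "dihedral \<delta>"
    unfolding dihedral_def
  proof (intro conjI allI)
    show "inj \<delta>"
    proof (rule injI)
      fix s s' assume eq: "\<delta> s = \<delta> s'"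
      obtain a m b n where s: "s = (a, m)" "s' = (b, n)" by (cases s; cases s')
      have "(a, d * m) = (b, d * n)"
        by (rule moves_unique[OF p \<delta>(2)]) (use eq \<delta>(2) s in simp)
      then show "s = s'" using s d(1) by simp
    qed
    fix a m b n
    have "moves p (\<delta> (a, m) * \<delta> (b, n)) (a = b, if a then d * m + d * n else d * m - d * n)"
      by (rule mm) (rule \<delta>)+
    then have "moves p (\<delta> (a, m) * \<delta> (b, n)) (a = b, d * (if a then m + n else m - n))"
      by (simp add: algebra_simps split: if_splits)
    then show "\<delta> (a, m) * \<delta> (b, n) = \<delta> (a = b, if a then m + n else m - n)"
      by (rule uniq[OF grp_mult[OF \<delta>(1) \<delta>(1)] \<delta>(1) _ \<delta>(2)])
  qed
  have transl: "\<exists>m. m \<noteq> 0 \<and> moves p z (True, m)" if z: "z \<in> range \<delta>" "z * z \<noteq> 1" for z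
  proof -
    obtain m where "z = \<delta> (True, m)" "m \<noteq> 0" using dihedral_translationE[OF dih z] by blast
    then show ?thesis using \<delta>(2)[of True m] d(1) by (intro exI[of _ "d * m"]) auto
  qed
  have "isolated \<Gamma> \<delta>"
    unfolding isolated_def
  proof (intro conjI ballI impI)
    show "dihedral \<delta>" by fact
    show "range \<delta> \<subseteq> \<Gamma>" unfolding range B_def by blast
    fix x z assume x: "x \<in> \<Gamma>" and z: "z \<in> range \<delta>" "z * z \<noteq> 1" "inverse x * z * x \<in> range \<delta>"
    let ?z = "inverse x * z * x"
    have zG: "z \<in> \<Gamma>" "?z \<in> \<Gamma>" using z unfolding range B_def by blast+
    have "?z * ?z \<noteq> 1" using z(2) unfolding square_conj by simp
    then obtain m m' where m: "m \<noteq> 0" "moves p z (True, m)" "m' \<noteq> 0" "moves p ?z (True, m')"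
      using transl z by blast
    \<comment> \<open>Since \<open>?z\<close> shifts \<open>p\<close>, its conjugate
      \<open>z\<close> shifts the image of \<open>p\<close> under \<open>x\<close>; but
      \<open>z\<close> also shifts \<open>p\<close>, so the two lines coincide.\<close>
    have "act x (p n) \<in> range p" for n
    proof (rule lines_agree[OF p line_act[OF x p] zG(1) m(1,3)])
      show "act z (p n) = p (n + m)" for n using m(2) by (simp add: moves_def add.commute)
      have xz: "x * ?z = z * x" by (simp add: mult.assoc)
      show "act z (act x (p n)) = act x (p (n + m'))" for n
        using m(4) act_mult[OF x zG(2) lineD(1)[OF p]] act_mult[OF zG(1) x lineD(1)[OF p]]
        unfolding xz by (simp add: moves_def add.commute)
    qed
    then show "x \<in> range \<delta>" unfolding range B_def using moves_exists[OF p x] x by blast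
  qed
  then show thesis using that range unfolding B_def by blast
qed

text \<open>Two involutions without common fixed vertex generate a dihedral group acting on the line
  obtained by unfolding the shortest path between their fixed vertices.\<close>

lemma reflection_line:
  assumes i: "i \<in> \<Gamma>" "involution i" and j: "j \<in> \<Gamma>" "involution j"
    and disjoint: "\<And>v. v \<in> V \<Longrightarrow> act i v = v \<Longrightarrow> act j v \<noteq> v"
  obtains p c where "line p" "moves p i (False, 0)" "moves p j (False, c)" "c \<noteq> 0"
proof -
  have ii: "act i (act i v) = v" if "v \<in> V" for v
    using act_mult[OF i(1) i(1) that] i(2) act_one[OF that] unfolding involution_def by simp
  have jj: "act j (act j v) = v" if "v \<in> V" for v
    using act_mult[OF j(1) j(1) that] j(2) act_one[OF that] unfolding involution_def by simp
  define F where "F = {(u, v). u \<in> V \<and> v \<in> V \<and> act i u = u \<and> act j v = v}"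
  have "F \<noteq> {}"
    using square_one_fixes_vertex[OF i(1)] square_one_fixes_vertex[OF j(1)] i(2) j(2)
    unfolding F_def involution_def by blast
  then obtain f where f: "f \<in> F"
      "\<And>f'. f' \<in> F \<Longrightarrow> nat (case_prod tree_dist f) \<le> nat (case_prod tree_dist f')"
    using ex_has_least_nat[of "\<lambda>f. f \<in> F" _ "\<lambda>f. nat (case_prod tree_dist f)"] by blast
  obtain u v where uv: "f = (u, v)" by force
  have u: "u \<in> V" "act i u = u" and v: "v \<in> V" "act j v = v" using f(1) by (auto simp: F_def uv)
  define D where "D = tree_dist u v"
  have D_min: "D \<le> tree_dist u' v'"
    if "u' \<in> V" "v' \<in> V" "act i u' = u'" "act j v' = v'" for u' v'
    using f(2)[of "(u', v')"] that tree_dist_nonneg[of u v] tree_dist_nonneg[of u' v']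
    by (auto simp: F_def uv D_def)
  have "u \<noteq> v" using disjoint u v by blast
  then have D: "0 < D" using tree_dist_nonneg[of u v] tree_dist_eq_0[of u v] unfolding D_def by linarith
  obtain c where c: "c 0 = u" "c D = v" "\<And>a. c a \<in> V"
    and cd: "\<And>a b. \<lbrakk>0 \<le> a; a \<le> D; 0 \<le> b; b \<le> D\<rbrakk> \<Longrightarrow> tree_dist (c a) (c b) = \<bar>a - b\<bar>"
    using geodesic_exists[OF u(1) v(1)] unfolding D_def by blast
  define p where "p = unfold_path D c (act i) (act j)"
  have p_mid: "p n = c n" if "0 \<le> n" "n \<le> D" for n
    unfolding p_def using that by (subst unfold_path.simps) simp
  have p_neg: "p n = act i (p (- n))" if "n < 0" for n
    unfolding p_def using that D by (subst unfold_path.simps) simp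
  have p_big: "p n = act j (p (2 * D - n))" if "D < n" for n
    unfolding p_def using that D by (subst unfold_path.simps) simp
  have pV: "p n \<in> V" for n
  \<comment> \<open>This repeats the descent of the definition instead of using
    \<open>reflection_induct\<close>, whose steps would need \<open>sym_i\<close> and
    \<open>sym_j\<close>, and these rest on \<open>pV\<close>.\<close>
  proof (induction n rule: measure_induct_rule[where f = "\<lambda>n. nat (2 * \<bar>n\<bar> + (if n < 0 then 1 else 0))"])
    case (less n)
    consider "0 \<le> n" "n \<le> D" | "n < 0" | "n > D" by linarith
    then show ?case
    proof cases
      case 1
      then show ?thesis using c(3) by (simp add: p_mid)
    next
      case 2
      then show ?thesis using less[of "- n"] act_in_V[OF i(1)] p_neg[of n] by simp
    next
      case 3
      then show ?thesis using less[of "2 * D - n"] act_in_V[OF j(1)] p_big[of n] D by simp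
    qed
  qed
  have sym_i: "act i (p n) = p (- n)" for n
    using p_neg[of n] p_neg[of "- n"] ii[OF pV] u(2) c(1) p_mid[of 0] D
    by (cases n "0 :: int" rule: linorder_cases) auto
  have sym_j: "act j (p n) = p (2 * D - n)" for n
    using p_big[of n] p_big[of "2 * D - n"] jj[OF pV] v(2) c(2) p_mid[of D] D
    by (cases n D rule: linorder_cases) auto
  define Q where "Q n \<longleftrightarrow> tree_dist (p n) (p (n + 1)) = 1 \<and> tree_dist (p n) (p (n - 1)) = 1
    \<and> p (n - 1) \<noteq> p (n + 1)" for n
  have Q: "Q n" for n
  proof (induction n rule: reflection_induct[OF D])
    case (1 n)
    have right: "tree_dist (p n) (p (n + 1)) = 1" if "n < D"
      using that 1 cd[of n "n + 1"] by (simp add: p_mid)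
    have left: "tree_dist (p n) (p (n - 1)) = 1" if "0 < n"
      using that 1 cd[of n "n - 1"] by (simp add: p_mid)
    consider "n = 0" | "n = D" | "0 < n" "n < D" using 1 by linarith
    then show ?case
    proof cases
      case n: 1
      \<comment> \<open>If the path turned back at \<open>u\<close>, the next vertex would be fixed
        by \<open>i\<close> and closer to \<open>v\<close>, against the minimality of
        \<open>D\<close>.\<close>
      have "p (- 1) \<noteq> p 1"
      proof
        assume "p (- 1) = p 1"
        then have "act i (c 1) = c 1" using sym_i[of 1] p_mid[of 1] D by simp
        then have "D \<le> tree_dist (c 1) v" using D_min c(3) v by blast
        then show False using cd[of 1 D] c(2) D by simp
      qed
      moreover have "tree_dist (p 0) (p (- 1)) = tree_dist (p 0) (p 1)"
        using act_isometry[OF i(1) pV[of 0] pV[of 1]] sym_i by simp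
      ultimately show ?thesis using n right D unfolding Q_def by simp
    next
      case n: 2
      have refl: "p (D + 1) = act j (p (D - 1))" "act j (p D) = p D"
        using sym_j[of "D - 1"] sym_j[of D] by (simp_all add: algebra_simps)
      have "p (D - 1) \<noteq> p (D + 1)"
      proof
        assume "p (D - 1) = p (D + 1)"
        then have "act j (c (D - 1)) = c (D - 1)" using refl p_mid[of "D - 1"] D by simp
        then have "D \<le> tree_dist u (c (D - 1))" using D_min c(3) u by blast
        then show False using cd[of 0 "D - 1"] c(1) D by simp
      qed
      moreover have "tree_dist (p D) (p (D + 1)) = tree_dist (p D) (p (D - 1))"
        using act_isometry[OF j(1) pV[of D] pV[of "D - 1"]] refl by simp
      ultimately show ?thesis using n left D unfolding Q_def by simp
    next
      case n: 3
      have "tree_dist (p (n - 1)) (p (n + 1)) = 2"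
        using n cd[of "n - 1" "n + 1"] by (simp add: p_mid)
      then show ?thesis using right left n tree_dist_eq_0[of "p (n - 1)" "p (n + 1)"] unfolding Q_def by auto
    qed
  next
    case (2 n)
    have e: "- n + 1 = - (n - 1)" "- n - 1 = - (n + 1)" by auto
    show ?case
      using 2 unfolding Q_def e sym_i[symmetric] act_isometry[OF i(1) pV pV] act_eq_iff[OF i(1) pV pV] by auto
  next
    case (3 n)
    have e: "2 * D - n + 1 = 2 * D - (n - 1)" "2 * D - n - 1 = 2 * D - (n + 1)" by auto
    show ?case
      using 3 unfolding Q_def e sym_j[symmetric] act_isometry[OF j(1) pV pV] act_eq_iff[OF j(1) pV pV] by auto
  qed
  have "line p"
    using pV Q unfolding Q_def by (intro reduced_path_line) blast+
  moreover have "moves p i (False, 0)" "moves p j (False, 2 * D)"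
    using sym_i sym_j by (simp_all add: moves_def)
  ultimately show thesis using that D by simp
qed

theorem involutions_without_common_fixed_vertex:
  assumes "i \<in> \<Gamma>" "involution i" "j \<in> \<Gamma>" "involution j"
    and "\<And>v. v \<in> V \<Longrightarrow> act i v = v \<Longrightarrow> act j v \<noteq> v"
  shows "\<exists>\<delta>. isolated \<Gamma> \<delta> \<and> i \<in> range \<delta> \<and> j \<in> range \<delta>"
proof -
  obtain p c where p: "line p" "moves p i (False, 0)" "moves p j (False, c)" "c \<noteq> 0"
    by (rule reflection_line[OF assms])
  obtain \<delta> where "isolated \<Gamma> \<delta>" "range \<delta> = {x \<in> \<Gamma>. \<exists>s. moves p x s}"
    by (rule line_stabilizer_isolated[OF p(1) assms(1,2) p(2) assms(3) p(3,4)])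
  then show ?thesis using p assms by blast
qed

end

section \<open>Free actions and HNN extensions\<close>

typedef 'u sym = "{f :: 'u \<Rightarrow> 'u. bij f}"
  morphisms app Sym
  by (rule exI[of _ id]) simp

lemma bij_app: "bij (app p)"
  using app[of p] by simp

lemma app_Sym: "bij f \<Longrightarrow> app (Sym f) = f"
  by (simp add: Sym_inverse)

instantiation sym :: (type) group_mult
begin

definition one_sym :: "'a sym" where "one_sym = Sym id"
definition times_sym :: "'a sym \<Rightarrow> 'a sym \<Rightarrow> 'a sym" where "p * q = Sym (app p \<circ> app q)"
definition inverse_sym :: "'a sym \<Rightarrow> 'a sym" where "inverse p = Sym (inv_into UNIV (app p))"
definition divide_sym :: "'a sym \<Rightarrow> 'a sym \<Rightarrow> 'a sym" where "divide p q = p * inverse (q :: 'a sym)"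

lemma app_one [simp]: "app 1 u = u"
  by (simp add: one_sym_def app_Sym)

lemma app_mult [simp]: "app (p * q) u = app p (app q u)"
  by (simp add: times_sym_def app_Sym bij_app bij_comp)

lemma app_inverse: "app (inverse p) = inv_into UNIV (app p)"
  by (simp add: inverse_sym_def app_Sym bij_app bij_imp_bij_inv)

lemma sym_eqI: "(\<And>u. app p u = app q u) \<Longrightarrow> p = q"
  by (metis app_inject ext)

instance
proof
  fix p q r :: "'a sym"
  show "p * q * r = p * (q * r)" "1 * p = p" "p * 1 = p"
    by (auto intro: sym_eqI)
  show "inverse p * p = 1"
    using bij_app[of p] by (auto intro!: sym_eqI simp: app_inverse bij_def)
qed

end

lemma app_inverse_cancel [simp]: "app (inverse p) (app p u) = u" "app p (app (inverse p) u) = u"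
  by (simp_all flip: app_mult)

text \<open>\<open>c\<close> is constant on orbits and onto, so it witnesses at least as many orbits
  as \<open>'u\<close> has elements.\<close>

locale free_action =
  fixes G :: "'g::group_mult set" and P :: "'a set" and \<alpha> :: "'g \<Rightarrow> 'a \<Rightarrow> 'a" and c :: "'a \<Rightarrow> 'u"
  assumes G: "subgrp G"
    and closed: "g \<in> G \<Longrightarrow> x \<in> P \<Longrightarrow> \<alpha> g x \<in> P"
    and one: "x \<in> P \<Longrightarrow> \<alpha> 1 x = x"
    and mult: "g \<in> G \<Longrightarrow> h \<in> G \<Longrightarrow> x \<in> P \<Longrightarrow> \<alpha> (g * h) x = \<alpha> g (\<alpha> h x)"
    and free: "g \<in> G \<Longrightarrow> x \<in> P \<Longrightarrow> \<alpha> g x = x \<Longrightarrow> g = 1"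
    and invariant: "g \<in> G \<Longrightarrow> x \<in> P \<Longrightarrow> c (\<alpha> g x) = c x"
    and onto: "c ` P = UNIV"
begin

definition orbit_rep :: "'a \<Rightarrow> 'a" where
  "orbit_rep x = (SOME y. \<exists>g\<in>G. y = \<alpha> g x)"

lemma cancel: "g \<in> G \<Longrightarrow> x \<in> P \<Longrightarrow> \<alpha> (inverse g) (\<alpha> g x) = x"
  using mult[of "inverse g" g x] one subgrp_inverse[OF G] by simp

lemma orbit_rep_ex: "\<exists>g\<in>G. orbit_rep x = \<alpha> g x"
  unfolding orbit_rep_def by (rule someI_ex) (use subgrp_one[OF G] in blast)

lemma orbit_rep_in: "x \<in> P \<Longrightarrow> orbit_rep x \<in> P"
  using orbit_rep_ex[of x] closed by auto

lemma orbit_rep_act: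
  assumes "g \<in> G" "x \<in> P" shows "orbit_rep (\<alpha> g x) = orbit_rep x"
proof -
  have "(\<exists>h\<in>G. y = \<alpha> h (\<alpha> g x)) \<longleftrightarrow> (\<exists>h\<in>G. y = \<alpha> h x)" for y
  proof
    assume "\<exists>h\<in>G. y = \<alpha> h (\<alpha> g x)"
    then show "\<exists>h\<in>G. y = \<alpha> h x" using mult[OF _ assms] subgrp_mult[OF G _ assms(1)] by metis
  next
    assume "\<exists>h\<in>G. y = \<alpha> h x"
    then obtain h where h: "h \<in> G" "y = \<alpha> h x" by blast
    have i: "inverse g \<in> G" using subgrp_inverse[OF G assms(1)] .
    have "\<alpha> (h * inverse g) (\<alpha> g x) = \<alpha> h x"
      using mult[OF h(1) i closed[OF assms]] cancel[OF assms] by simp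
    then show "\<exists>h\<in>G. y = \<alpha> h (\<alpha> g x)" using h subgrp_mult[OF G h(1) i] by metis
  qed
  then show ?thesis by (simp add: orbit_rep_def)
qed

lemma orbit_rep_idem: "x \<in> P \<Longrightarrow> orbit_rep (orbit_rep x) = orbit_rep x"
  using orbit_rep_ex[of x] orbit_rep_act by auto

text \<open>By freeness every orbit is a copy of \<open>G\<close>; this is the place of
  \<open>x\<close> in its orbit, counted from the representative.\<close>

definition coord :: "'a \<Rightarrow> 'g" where
  "coord x = (SOME g. g \<in> G \<and> x = \<alpha> g (orbit_rep x))"

lemma coord:
  assumes "x \<in> P" shows "coord x \<in> G" "\<alpha> (coord x) (orbit_rep x) = x"
proof -
  obtain g where g: "g \<in> G" "orbit_rep x = \<alpha> g x" using orbit_rep_ex by blast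
  have "\<exists>g. g \<in> G \<and> x = \<alpha> g (orbit_rep x)"
    using cancel[OF g(1) assms] g subgrp_inverse[OF G g(1)] by metis
  then have "coord x \<in> G \<and> x = \<alpha> (coord x) (orbit_rep x)"
    unfolding coord_def by (rule someI_ex)
  then show "coord x \<in> G" "\<alpha> (coord x) (orbit_rep x) = x" by auto
qed

lemma act_inj:
  assumes "g \<in> G" "h \<in> G" "x \<in> P" "\<alpha> g x = \<alpha> h x" shows "g = h"
proof -
  have "\<alpha> (inverse h * g) x = x"
    using mult[OF subgrp_inverse[OF G assms(2)] assms(1,3)] assms(4) cancel[OF assms(2,3)] by simp
  then have "inverse h * g = 1"
    using free assms(3) subgrp_mult[OF G subgrp_inverse[OF G assms(2)] assms(1)] by blast
  then have "h * (inverse h * g) = h * 1" by simp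
  then show ?thesis by simp
qed

lemma coord_act:
  assumes "g \<in> G" "x \<in> P" shows "coord (\<alpha> g x) = g * coord x"
proof (rule act_inj)
  show "\<alpha> (coord (\<alpha> g x)) (orbit_rep x) = \<alpha> (g * coord x) (orbit_rep x)"
    using coord(2)[OF closed[OF assms]] coord[OF assms(2)] orbit_rep_act[OF assms]
      mult[OF assms(1) _ orbit_rep_in[OF assms(2)], of "coord x"] by simp
qed (use assms coord closed orbit_rep_in subgrp_mult[OF G] in auto)

lemma injects: "\<exists>f :: 'u \<Rightarrow> 'a. inj f \<and> range f \<subseteq> orbit_rep ` P"
proof -
  have "\<forall>u. \<exists>x\<in>P. c x = u" using onto by (metis UNIV_I imageE)
  then obtain s where s: "\<And>u. s u \<in> P" "\<And>u. c (s u) = u" by metis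
  have "c (orbit_rep (s u)) = u" for u
    using orbit_rep_ex[of "s u"] invariant[OF _ s(1)] s(2) by auto
  then have "inj (orbit_rep \<circ> s)" by (intro injI) (metis comp_apply)
  moreover have "range (orbit_rep \<circ> s) \<subseteq> orbit_rep ` P" using s by auto
  ultimately show ?thesis by blast
qed

end

text \<open>The assumptions on \<open>c\<close>, \<open>c'\<close>, \<open>i\<close>, \<open>j\<close> force both actions to have as many orbits as
  \<open>'u\<close> has elements.\<close>

lemma free_actions_isomorphic:
  fixes c :: "'a \<Rightarrow> 'u" and c' :: "'b \<Rightarrow> 'u"
  assumes "free_action G P \<alpha> c" "free_action G Q \<beta> c'"
    and "inj_on (i :: 'a \<Rightarrow> 'u) P" "inj_on (j :: 'b \<Rightarrow> 'u) Q"
  obtains \<psi> where "bij_betw \<psi> P Q" "\<And>g x. g \<in> G \<Longrightarrow> x \<in> P \<Longrightarrow> \<psi> (\<alpha> g x) = \<beta> g (\<psi> x)"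
proof -
  interpret P: free_action G P \<alpha> c by fact
  interpret Q: free_action G Q \<beta> c' by fact
  let ?S = "P.orbit_rep ` P" and ?T = "Q.orbit_rep ` Q"
  have S: "?S \<subseteq> P" and T: "?T \<subseteq> Q" using P.orbit_rep_in Q.orbit_rep_in by auto
  obtain f :: "'u \<Rightarrow> 'a" where f: "inj f" "range f \<subseteq> ?S" using P.injects by blast
  obtain f' :: "'u \<Rightarrow> 'b" where f': "inj f'" "range f' \<subseteq> ?T" using Q.injects by blast
  have "inj_on (f' \<circ> i) ?S" "inj_on (f \<circ> j) ?T"
    using f f' assms(3,4) S T by (auto intro!: comp_inj_on intro: inj_on_subset)
  moreover have "(f' \<circ> i) ` ?S \<subseteq> ?T" "(f \<circ> j) ` ?T \<subseteq> ?S" using f f' by auto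
  ultimately obtain \<theta> where \<theta>: "bij_betw \<theta> ?S ?T" using Schroeder_Bernstein by metis
  \<comment> \<open>The bijection between representatives comes from injections in both directions
    through \<open>'u\<close>. It extends to all points by equivariance, every orbit being a copy of
    \<open>G\<close>.\<close>
  define \<psi> where "\<psi> x = \<beta> (P.coord x) (\<theta> (P.orbit_rep x))" for x
  have \<theta>T: "\<theta> (P.orbit_rep x) \<in> ?T" if "x \<in> P" for x using \<theta> that bij_betwE by blast
  have \<theta>Q: "\<theta> (P.orbit_rep x) \<in> Q" if "x \<in> P" for x using \<theta>T[OF that] T by blast
  have rep: "Q.orbit_rep (\<psi> x) = \<theta> (P.orbit_rep x)" if "x \<in> P" for x
  proof -
    have "Q.orbit_rep (\<psi> x) = Q.orbit_rep (\<theta> (P.orbit_rep x))"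
      unfolding \<psi>_def by (rule Q.orbit_rep_act[OF P.coord(1)[OF that] \<theta>Q[OF that]])
    also have "\<dots> = \<theta> (P.orbit_rep x)" using \<theta>T[OF that] Q.orbit_rep_idem by auto
    finally show ?thesis .
  qed
  have equi: "\<psi> (\<alpha> g x) = \<beta> g (\<psi> x)" if "g \<in> G" "x \<in> P" for g x
    unfolding \<psi>_def using that P.coord_act P.orbit_rep_act Q.mult \<theta>Q P.coord(1) by simp
  have "inj_on \<psi> P"
  proof (rule inj_onI)
    fix x y assume xy: "x \<in> P" "y \<in> P" "\<psi> x = \<psi> y"
    have "\<theta> (P.orbit_rep x) = \<theta> (P.orbit_rep y)" using rep xy by metis
    then have r: "P.orbit_rep x = P.orbit_rep y"
      using \<theta> xy(1,2) by (auto dest: bij_betw_imp_inj_on inj_onD)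
    then have "P.coord x = P.coord y"
      using xy unfolding \<psi>_def by (intro Q.act_inj[OF P.coord(1) P.coord(1) \<theta>Q]) auto
    then show "x = y" using r P.coord(2) xy(1,2) by metis
  qed
  moreover have "\<psi> ` P = Q"
  proof (intro subset_antisym subsetI)
    fix y assume "y \<in> \<psi> ` P"
    then show "y \<in> Q" unfolding \<psi>_def using Q.closed P.coord(1) \<theta>Q by auto
  next
    fix y assume y: "y \<in> Q"
    then have "Q.orbit_rep y \<in> \<theta> ` ?S" using \<theta> by (simp add: bij_betw_def)
    then obtain x where x: "x \<in> P" "\<theta> (P.orbit_rep x) = Q.orbit_rep y" by auto
    let ?r = "P.orbit_rep x"
    have r: "?r \<in> P" using P.orbit_rep_in x(1) .
    have "P.coord ?r = 1"
      using P.coord[OF r] P.one[OF r] P.orbit_rep_idem[OF x(1)] P.free[OF P.coord(1)[OF r] r] by simp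
    then have "\<psi> ?r = Q.orbit_rep y"
      unfolding \<psi>_def P.orbit_rep_idem[OF x(1)] x(2) using Q.one[OF Q.orbit_rep_in[OF y]] by simp
    then have "\<psi> (\<alpha> (Q.coord y) ?r) = y" using equi[OF Q.coord(1)[OF y] r] Q.coord(2)[OF y] by simp
    then show "y \<in> \<psi> ` P" using P.closed[OF Q.coord(1)[OF y] r] by (metis imageI)
  qed
  ultimately show thesis using that equi unfolding bij_betw_def by blast
qed

section \<open>Normal forms in an HNN extension\<close>

definition bar :: "'i \<times> bool \<Rightarrow> 'i \<times> bool" where
  "bar e = (fst e, \<not> snd e)"

lemma bar_simps [simp]: "bar (bar e) = e" "bar e \<noteq> e" "e \<noteq> bar e" "bar (i, s) = (i, \<not> s)" "fst (bar e) = fst e"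
    "snd (bar e) \<longleftrightarrow> \<not> snd e"
  by (cases e; simp add: bar_def)+

text \<open>Data of a multiple HNN extension of \<open>G\<close>: the stable letters are \<open>(i, False)\<close> with inverses
  \<open>(i, True)\<close> for \<open>i \<in> I\<close>, and \<open>a e = e (\<phi> e a)\<close> is imposed for \<open>a \<in> A e\<close>.\<close>

locale hnn =
  fixes G :: "'g::group_mult set" and I :: "'g set"
    and A :: "'g \<times> bool \<Rightarrow> 'g set" and \<phi> :: "'g \<times> bool \<Rightarrow> 'g \<Rightarrow> 'g"
  assumes G: "subgrp G" and I: "I \<subseteq> G"
    and A: "fst e \<in> I \<Longrightarrow> subgrp (A e)" "fst e \<in> I \<Longrightarrow> A e \<subseteq> G"
    and \<phi>_in: "fst e \<in> I \<Longrightarrow> a \<in> A e \<Longrightarrow> \<phi> e a \<in> A (bar e)"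
    and \<phi>_mult: "fst e \<in> I \<Longrightarrow> a \<in> A e \<Longrightarrow> b \<in> A e \<Longrightarrow> \<phi> e (a * b) = \<phi> e a * \<phi> e b"
    and \<phi>_bar: "fst e \<in> I \<Longrightarrow> a \<in> A e \<Longrightarrow> \<phi> (bar e) (\<phi> e a) = a"
begin

lemma \<phi>_one: "fst e \<in> I \<Longrightarrow> \<phi> e 1 = 1"
  using \<phi>_mult[of e 1 1] subgrp_one[OF A(1), of e] group_cancel_left[of "\<phi> e 1" "\<phi> e 1" 1] by simp

text \<open>A left transversal of \<open>A e\<close>. The coset \<open>A e\<close> itself is
  represented by 1, so that a letter followed by its inverse is visible in the list; the choice
  depends on the coset of \<open>g\<close> only.\<close>

definition coset_rep :: "'g \<times> bool \<Rightarrow> 'g \<Rightarrow> 'g" where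
  "coset_rep e g = (if g \<in> A e then 1 else SOME r. inverse r * g \<in> A e)"

lemma coset_rep_diff: "fst e \<in> I \<Longrightarrow> inverse (coset_rep e g) * g \<in> A e"
proof -
  assume e: "fst e \<in> I"
  have "inverse (SOME r. inverse r * g \<in> A e) * g \<in> A e"
    by (rule someI[of _ g]) (simp add: subgrp_one[OF A(1)[OF e]])
  then show ?thesis by (simp add: coset_rep_def)
qed

lemma coset_rep_mult:
  assumes "fst e \<in> I" "a \<in> A e" shows "coset_rep e (g * a) = coset_rep e g"
  using subgrp_cancel_right[OF A(1)[OF assms(1)] assms(2)]
  unfolding coset_rep_def by (simp flip: mult.assoc)

lemma coset_rep_in: "fst e \<in> I \<Longrightarrow> g \<in> G \<Longrightarrow> coset_rep e g \<in> G"
  using coset_rep_diff[of e g] A(2)[of e] subgrp_cancel_right[OF G, of g] subgrp_inverse_iff[OF G]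
  by blast

lemma coset_rep_idem: "fst e \<in> I \<Longrightarrow> coset_rep e (coset_rep e g) = coset_rep e g"
  using coset_rep_mult[OF _ coset_rep_diff, of e "coset_rep e g" g] by simp

lemma coset_rep_eq_1: "fst e \<in> I \<Longrightarrow> coset_rep e g = 1 \<longleftrightarrow> g \<in> A e"
  using coset_rep_diff[of e g] by (auto simp: coset_rep_def)

lemma coset_rep_eqD:
  assumes "fst e \<in> I" "coset_rep e g = coset_rep e h" shows "inverse g * h \<in> A e"
proof -
  have "inverse (inverse (coset_rep e g) * g) * (inverse (coset_rep e h) * h) \<in> A e"
    by (rule subgrp_mult[OF A(1) subgrp_inverse[OF A(1) coset_rep_diff] coset_rep_diff]) (rule assms(1))+
  then show ?thesis unfolding assms(2) by (simp add: mult.assoc)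
qed

text \<open>Write \<open>g = r * b\<close> with \<open>r\<close> the representative and
  \<open>b\<close> in \<open>A e\<close>. Then \<open>g e = r e (\<phi> e b)\<close>, and
  \<open>\<phi> e b\<close> is what emerges to the right of the letter.\<close>

definition coset_diff :: "'g \<times> bool \<Rightarrow> 'g \<Rightarrow> 'g" where
  "coset_diff e g = \<phi> e (inverse (coset_rep e g) * g)"

lemma coset_diff_in: "fst e \<in> I \<Longrightarrow> coset_diff e g \<in> A (bar e)"
  unfolding coset_diff_def by (intro \<phi>_in coset_rep_diff)

lemma coset_diff_in_G: "fst e \<in> I \<Longrightarrow> coset_diff e g \<in> G"
  using coset_diff_in[of e g] A(2)[of "bar e"] by auto

lemma coset_diff_mult:
  assumes "fst e \<in> I"
  shows "coset_diff e (g * h) = coset_diff e (g * coset_rep e h) * coset_diff e h"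
proof -
  let ?b = "inverse (coset_rep e h) * h"
  have gh: "g * h = g * coset_rep e h * ?b" by (simp add: mult.assoc)
  have "coset_rep e (g * h) = coset_rep e (g * coset_rep e h)"
    unfolding gh by (rule coset_rep_mult[OF assms coset_rep_diff[OF assms]])
  then have "inverse (coset_rep e (g * h)) * (g * h)
      = inverse (coset_rep e (g * coset_rep e h)) * (g * coset_rep e h) * ?b"
    by (simp add: mult.assoc)
  then show ?thesis
    unfolding coset_diff_def using \<phi>_mult[OF assms coset_rep_diff coset_rep_diff] assms by simp
qed

lemma coset_rep_mult_rep:
  assumes "fst e \<in> I" shows "coset_rep e (g * coset_rep e h) = coset_rep e (g * h)"
  using coset_rep_mult[OF assms coset_rep_diff[OF assms], of "g * coset_rep e h" h] by (simp add: mult.assoc)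

text \<open>The list \<open>[(r\<^sub>1, e\<^sub>1), \<dots>, (r\<^sub>n, e\<^sub>n)]\<close> stands for the coset \<open>r\<^sub>1 e\<^sub>1 \<cdots> r\<^sub>n e\<^sub>n G\<close>, a vertex
  of the Bass-Serre tree.\<close>

definition starts :: "'g \<times> bool \<Rightarrow> ('g \<times> 'g \<times> bool) list \<Rightarrow> bool" where
  "starts e w \<longleftrightarrow> w \<noteq> [] \<and> hd w = (1, e)"

text \<open>The normal form of an HNN extension: chosen coset representatives, and no letter
  directly followed by its inverse.\<close>

fun reduced :: "('g \<times> 'g \<times> bool) list \<Rightarrow> bool" where
  "reduced [] \<longleftrightarrow> True"
| "reduced ((r, e) # w) \<longleftrightarrow> r \<in> G \<and> fst e \<in> I \<and> coset_rep e r = r \<and> \<not> starts (bar e) w \<and> reduced w"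

text \<open>\<open>g\<close> is pushed to the right through the letters: \<open>vact\<close>
  collects the new representatives, and \<open>cocycle\<close> is the element of \<open>G\<close>
  left at the end. \<open>G_mult_word\<close> confirms this inside the extension.\<close>

fun vact :: "'g \<Rightarrow> ('g \<times> 'g \<times> bool) list \<Rightarrow> ('g \<times> 'g \<times> bool) list" where
  "vact g [] = []"
| "vact g ((r, e) # w) = (coset_rep e (g * r), e) # vact (coset_diff e (g * r)) w"

fun cocycle :: "'g \<Rightarrow> ('g \<times> 'g \<times> bool) list \<Rightarrow> 'g" where
  "cocycle g [] = g"
| "cocycle g ((r, e) # w) = cocycle (coset_diff e (g * r)) w"

text \<open>Left multiplication by the letter \<open>e\<close>, with cancellation.\<close>

definition eact :: "'g \<times> bool \<Rightarrow> ('g \<times> 'g \<times> bool) list \<Rightarrow> ('g \<times> 'g \<times> bool) list" where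
  "eact e w = (if starts (bar e) w then tl w else (1, e) # w)"

lemma starts_iff: "starts e w \<longleftrightarrow> (\<exists>w'. w = (1, e) # w')"
  unfolding starts_def by (cases w) auto

lemma starts_simps [simp]: "\<not> starts e []" "starts e ((r, e') # w) \<longleftrightarrow> r = 1 \<and> e' = e"
  unfolding starts_def by auto

lemma reduced_take: "reduced w \<Longrightarrow> reduced (take n w)"
proof (induction w arbitrary: n rule: reduced.induct)
  case (2 r e w)
  have "\<not> starts (bar e) (take m w)" for m
    using 2(2) by (cases m; cases w) auto
  then show ?case using 2 by (cases n) auto
qed simp

lemma length_vact [simp]: "length (vact g w) = length w"
  by (induction g w rule: vact.induct) auto

text \<open>An element of \<open>A e\<close> preserves the coset \<open>A e\<close>, so it neither
  creates nor destroys an initial \<open>(1, e)\<close>. This keeps words reduced under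
  \<open>vact\<close>, because what emerges from a letter \<open>e\<close> lies in
  \<open>A (bar e)\<close>.\<close>

lemma starts_vact:
  assumes "reduced w" "g \<in> A e" "fst e \<in> I" shows "starts e (vact g w) \<longleftrightarrow> starts e w"
proof (cases w)
  case (Cons x w')
  obtain r e' where x: "x = (r, e')" by (cases x)
  have "coset_rep e (g * r) = 1 \<longleftrightarrow> r = 1" if "e' = e"
    using assms Cons x that coset_rep_eq_1[OF assms(3), of "g * r"] coset_rep_eq_1[OF assms(3), of r]
      subgrp_cancel_left[OF A(1)[OF assms(3)] assms(2)] by auto
  then show ?thesis using Cons x by auto
qed simp

lemma reduced_vact: "reduced w \<Longrightarrow> g \<in> G \<Longrightarrow> reduced (vact g w)"
proof (induction g w rule: vact.induct)
  case (2 g r e w)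
  then show ?case
    using starts_vact[of w "coset_diff e (g * r)" "bar e"]
    by (simp add: coset_rep_in coset_rep_idem coset_diff_in coset_diff_in_G subgrp_mult[OF G])
qed simp

lemma cocycle_in: "reduced w \<Longrightarrow> g \<in> G \<Longrightarrow> cocycle g w \<in> G"
  by (induction g w rule: cocycle.induct) (auto simp: coset_diff_in_G)

lemma vact_one: "reduced w \<Longrightarrow> vact 1 w = w"
  by (induction w rule: reduced.induct) (auto simp: coset_diff_def \<phi>_one)

lemma cocycle_one: "reduced w \<Longrightarrow> cocycle 1 w = 1"
  by (induction w rule: reduced.induct) (auto simp: coset_diff_def \<phi>_one)

lemma vact_mult: "reduced w \<Longrightarrow> vact (g * h) w = vact g (vact h w)"
proof (induction w arbitrary: g h rule: reduced.induct)
  case (2 r e w)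
  then show ?case
    using coset_diff_mult[of e g "h * r"] coset_rep_mult_rep[of e g "h * r"] by (simp add: mult.assoc)
qed simp

lemma cocycle_mult: "reduced w \<Longrightarrow> cocycle (g * h) w = cocycle g (vact h w) * cocycle h w"
proof (induction w arbitrary: g h rule: reduced.induct)
  case (2 r e w)
  then show ?case using coset_diff_mult[of e g "h * r"] by (simp add: mult.assoc)
qed simp

text \<open>Traced back letter by letter: \<open>\<phi> e\<close> is injective, so an element that
  emerges as 1 and leaves the coset of \<open>r\<close> in place was a conjugate of 1.\<close>

lemma vact_free: "reduced w \<Longrightarrow> g \<in> G \<Longrightarrow> vact g w = w \<Longrightarrow> cocycle g w = 1 \<Longrightarrow> g = 1"
proof (induction w arbitrary: g rule: reduced.induct)
  case (2 r e w)
  have e: "fst e \<in> I" and r: "coset_rep e (g * r) = r" using 2 by auto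
  have "coset_diff e (g * r) = 1" using 2 coset_diff_in_G by simp
  then have "inverse r * (g * r) = 1"
    using \<phi>_bar[OF e coset_rep_diff[OF e, of "g * r"]] r \<phi>_one[of "bar e"] e
    unfolding coset_diff_def by simp
  then have "inverse r * g * r = 1" by (simp add: mult.assoc)
  then show ?case by simp
qed simp

lemma reduced_eact: "fst e \<in> I \<Longrightarrow> reduced w \<Longrightarrow> reduced (eact e w)"
  using subgrp_one[OF G] subgrp_one[OF A(1)] coset_rep_eq_1[of e 1]
  by (cases w) (auto simp: eact_def)

lemma eact_bar: "reduced w \<Longrightarrow> eact (bar e) (eact e w) = w"
proof (cases "starts (bar e) w")
  case True
  assume "reduced w"
  moreover obtain w' where "w = (1, bar e) # w'" using True by (auto simp: starts_iff)
  ultimately show ?thesis by (simp add: eact_def)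
qed (simp add: eact_def)

text \<open>The HNN relation \<open>a e = e (\<phi> e a)\<close> on words; if the letter cancels, it
  is the relation of \<open>bar e\<close> read backwards.\<close>

lemma vact_eact:
  assumes "fst e \<in> I" "a \<in> A e" "reduced w"
  shows "vact a (eact e w) = eact e (vact (\<phi> e a) w)"
    and "cocycle a (eact e w) = cocycle (\<phi> e a) w"
proof -
  have be: "fst (bar e) \<in> I" "\<phi> e a \<in> A (bar e)" using assms \<phi>_in by auto
  have 1: "coset_rep e a = 1" "coset_rep (bar e) (\<phi> e a) = 1"
    using assms be coset_rep_eq_1 by auto
  have d: "coset_diff e a = \<phi> e a" "coset_diff (bar e) (\<phi> e a) = a"
    using 1 \<phi>_bar[OF assms(1,2)] by (simp_all add: coset_diff_def)
  have "vact a (eact e w) = eact e (vact (\<phi> e a) w)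
    \<and> cocycle a (eact e w) = cocycle (\<phi> e a) w"
  proof (cases "starts (bar e) w")
    case True
    then obtain w' where "w = (1, bar e) # w'" by (auto simp: starts_iff)
    then show ?thesis using 1 d by (simp add: eact_def)
  next
    case False
    then show ?thesis using starts_vact[OF assms(3) be(2,1)] 1 d by (simp add: eact_def)
  qed
  then show "vact a (eact e w) = eact e (vact (\<phi> e a) w)"
    "cocycle a (eact e w) = cocycle (\<phi> e a) w" by auto
qed

lemma vact_isometry:
  assumes "reduced u" "reduced w" "g \<in> G"
  shows "tree_dist (vact g u) (vact g w) = tree_dist u w"
proof -
  have "lcp_length (vact g u) (vact g w) = lcp_length u w"
    using assms
  proof (induction u w arbitrary: g rule: lcp_length.induct)
    case (1 x u y w)
    obtain r e r' e' where xy: "x = (r, e)" "y = (r', e')" by (cases x; cases y) auto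
    have "(coset_rep e (g * r), e) = (coset_rep e' (g * r'), e') \<longleftrightarrow> x = y"
    proof
      assume eq: "(coset_rep e (g * r), e) = (coset_rep e' (g * r'), e')"
      then have e: "e = e'" "fst e \<in> I" and rr: "coset_rep e r = r" "coset_rep e r' = r'"
        using 1(2,3) xy by auto
      have "inverse r * r' \<in> A e"
        using coset_rep_eqD[OF e(2), of "g * r" "g * r'"] eq e(1) by (simp add: mult.assoc)
      then have "coset_rep e (r * (inverse r * r')) = coset_rep e r" by (rule coset_rep_mult[OF e(2)])
      then show "x = y" using rr e xy by simp
    qed (use xy in auto)
    moreover have "coset_diff e (g * r) \<in> G" using 1(2) xy coset_diff_in_G by auto
    ultimately show ?case using 1 xy by auto
  qed simp_all
  then show ?thesis by (simp add: tree_dist_def)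
qed

text \<open>The critical case is a letter that cancels in one word only. Then one length drops, the
  other grows, and the words have no common prefix before or after, the latter by
  reducedness.\<close>

lemma eact_isometry:
  assumes "reduced u" "reduced w"
  shows "tree_dist (eact e u) (eact e w) = tree_dist u w"
proof -
  have *: "tree_dist (tl u) ((1, e) # w) = tree_dist u w"
    if "starts (bar e) u" "\<not> starts (bar e) w" "reduced u" for u w
  proof -
    obtain u' where u: "u = (1, bar e) # u'" using \<open>starts (bar e) u\<close> by (auto simp: starts_iff)
    have "lcp_length u' ((1, e) # w) = 0"
      using that(3) u unfolding lcp_length_eq_0 by (cases u') auto
    moreover have "lcp_length u w = 0"
      using that(2) u unfolding lcp_length_eq_0 by (cases w) auto
    ultimately show ?thesis using u by (simp add: tree_dist_def)
  qed
  have **: "tree_dist (tl u) (tl w) = tree_dist u w" if "starts e u" "starts e w" for e u w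
    using that by (auto simp: starts_iff tree_dist_def)
  show ?thesis
    using *[of u w] *[of w u] **[of "bar e" u w] assms tree_dist_commute[of u w]
      tree_dist_commute[of "(1, e) # u" "tl w"]
    by (auto simp: eact_def) (simp add: tree_dist_def)
qed

end

section \<open>Cardinality of the set of normal forms\<close>

lemma infinite_inj_pair:
  assumes "infinite (UNIV :: 'u set)"
  obtains p :: "'u \<times> 'u \<Rightarrow> 'u" where "inj p"
proof -
  have "|UNIV \<times> UNIV :: ('u \<times> 'u) set| =o |UNIV :: 'u set|"
    by (rule card_of_Times_same_infinite[OF assms])
  then obtain p :: "'u \<times> 'u \<Rightarrow> 'u" where "bij_betw p (UNIV \<times> UNIV) UNIV"
    using card_of_ordIso by blast
  then show thesis using that by (auto simp: bij_betw_def)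
qed

text \<open>Lists coded by single elements through a pairing \<open>p\<close>; the constants
  \<open>a\<close> and \<open>b\<close> distinguish the end from a continuation.\<close>

fun encode_list :: "('u \<times> 'u \<Rightarrow> 'u) \<Rightarrow> 'u \<Rightarrow> 'u \<Rightarrow> 'u list \<Rightarrow> 'u" where
  "encode_list p a b [] = p (a, a)"
| "encode_list p a b (x # xs) = p (b, p (x, encode_list p a b xs))"

lemma inj_encode_list:
  assumes "inj p" "a \<noteq> b" shows "inj (encode_list p a b)"
proof (rule injI)
  fix x y assume "encode_list p a b x = encode_list p a b y"
  then show "x = y"
  proof (induction x arbitrary: y)
    case Nil
    then show ?case using assms by (cases y) (auto simp: inj_eq)
  next
    case (Cons x xs)
    then show ?case using assms by (cases y) (auto simp: inj_eq)
  qed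
qed

text \<open>A free action with as many orbits as points: the function \<open>c\<close> separates sufficiently many
  orbits. This leaves room to realize extensions of \<open>G\<close> by permutations of the same set.\<close>

definition roomy :: "'u sym set \<Rightarrow> bool" where
  "roomy G \<longleftrightarrow> (\<forall>g\<in>G. \<forall>u. app g u = u \<longrightarrow> g = 1) \<and>
     (\<exists>c :: 'u \<Rightarrow> 'u. surj c \<and> (\<forall>g\<in>G. \<forall>u. c (app g u) = c u))"

lemma roomy_inj:
  assumes "roomy G" "subgrp G" shows "inj_on (\<lambda>g. app g u) G"
proof (rule inj_onI)
  fix g h assume gh: "g \<in> G" "h \<in> G" "app g u = app h u"
  then have "app (inverse h * g) u = u" by simp
  then have "inverse h * g = 1"
    using assms gh subgrp_mult[OF assms(2) subgrp_inverse[OF assms(2) gh(2)] gh(1)] unfolding roomy_def by blast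
  then have "h * (inverse h * g) = h * 1" by simp
  then show "g = h" by simp
qed

text \<open>The upper bound for the number of orbits on normal forms. The map \<open>f\<close> will
  be evaluation at a point, which is injective on a freely acting group.\<close>

lemma (in hnn) words_inject:
  fixes f :: "'g \<Rightarrow> 'u"
  assumes "infinite (UNIV :: 'u set)" "inj_on f G"
  shows "\<exists>j :: (('g \<times> 'g \<times> bool) list \<times> 'g) \<times> 'u \<Rightarrow> 'u. inj_on j (({w. reduced w} \<times> G) \<times> UNIV)"
proof -
  obtain p :: "'u \<times> 'u \<Rightarrow> 'u" where p: "inj p" using infinite_inj_pair assms(1) by blast
  obtain a b :: 'u where ab: "a \<noteq> b"
    using assms(1) by (metis (full_types) UNIV_eq_I finite.emptyI finite_insert singletonI)
  define k where "k = (\<lambda>(r, i, s). p (f r, p (f i, if s then a else b)))"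
  define j where "j = (\<lambda>((w, g), c). p (encode_list p a b (map k w), p (f g, c)))"
  have k: "x = y" if "k x = k y" "fst x \<in> G" "fst (snd x) \<in> G" "fst y \<in> G" "fst (snd y) \<in> G" for x y
    using that ab assms(2) by (cases x; cases y) (auto simp: k_def inj_eq[OF p] inj_on_eq_iff split: if_splits)
  have w: "w = w'" if "map k w = map k w'" "reduced w" "reduced w'" for w w'
    using that
  proof (induction w arbitrary: w' rule: reduced.induct)
    case (2 r e w)
    obtain x v where w': "w' = x # v" using 2(2) by (cases w') auto
    have "(r, e) = x" by (rule k) (use 2 w' I in \<open>cases x, auto\<close>)+
    moreover have "w = v" by (rule 2(1)) (use 2 w' in \<open>cases x, auto\<close>)+
    ultimately show ?case using w' by simp
  qed simp
  have "inj_on j (({w. reduced w} \<times> G) \<times> UNIV)"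
    unfolding j_def
    by (intro inj_onI)
       (auto simp: inj_eq[OF p] inj_eq[OF inj_encode_list[OF p ab]] inj_on_eq_iff[OF assms(2)] dest: w)
  then show ?thesis by blast
qed

text \<open>A pair \<open>(w, h)\<close> stands for the normal form \<open>word w * h\<close>, so
  the target of \<open>\<psi>\<close> is the HNN extension acted on from the left, one copy for each
  \<open>c\<close>. The bijection \<open>\<psi>\<close> identifies the given action of
  \<open>G\<close> with its action there.\<close>

locale hnn_realization = hnn G I A \<phi>
  for G :: "'u sym set" and I :: "'u sym set"
    and A :: "'u sym \<times> bool \<Rightarrow> 'u sym set" and \<phi> :: "'u sym \<times> bool \<Rightarrow> 'u sym \<Rightarrow> 'u sym" +
  fixes \<psi> :: "'u \<Rightarrow> (('u sym \<times> 'u sym \<times> bool) list \<times> 'u sym) \<times> 'u"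
  assumes \<psi>: "bij_betw \<psi> UNIV (({w. reduced w} \<times> G) \<times> UNIV)"
    and \<psi>_equiv: "g \<in> G \<Longrightarrow> \<psi> u = ((w, h), c) \<Longrightarrow> \<psi> (app g u) = ((vact g w, cocycle g w * h), c)"

lemma hnn_realization_exists:
  fixes G :: "'u sym set"
  assumes "hnn G I A \<phi>" "roomy G" "infinite (UNIV :: 'u set)"
  obtains \<psi> where "hnn_realization G I A \<phi> \<psi>"
proof -
  interpret hnn G I A \<phi> by fact
  obtain c :: "'u \<Rightarrow> 'u" where c: "surj c" "\<And>g u. g \<in> G \<Longrightarrow> c (app g u) = c u"
    using assms(2) unfolding roomy_def by blast
  let ?Q = "({w. reduced w} \<times> G) \<times> (UNIV :: 'u set)"
  define \<beta> where "\<beta> g x = (case x of ((w, h), c) \<Rightarrow> ((vact g w, cocycle g w * h), c))"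
    for g and x :: "(('u sym \<times> 'u sym \<times> bool) list \<times> 'u sym) \<times> 'u"
  have 1: "free_action G UNIV app c"
    using G c assms(2) by unfold_locales (auto simp: roomy_def)
  have 2: "free_action G ?Q \<beta> snd"
  proof
    show "subgrp G" by (rule G)
    show "\<beta> g x \<in> ?Q" if "g \<in> G" "x \<in> ?Q" for g x
      using that by (auto simp: \<beta>_def reduced_vact cocycle_in subgrp_mult[OF G])
    show "\<beta> 1 x = x" if "x \<in> ?Q" for x
      using that by (auto simp: \<beta>_def vact_one cocycle_one)
    show "\<beta> (g * h) x = \<beta> g (\<beta> h x)" if "x \<in> ?Q" for g h x
      using that by (auto simp: \<beta>_def vact_mult cocycle_mult mult.assoc)
    show "g = 1" if "g \<in> G" "x \<in> ?Q" "\<beta> g x = x" for g x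
    proof -
      obtain w h d where x: "x = ((w, h), d)" by (metis surj_pair)
      have "cocycle g w * h = 1 * h" using that(3) by (simp add: \<beta>_def x)
      then have "cocycle g w = 1" by (simp only: group_cancel_right)
      then show ?thesis using vact_free[of w g] that by (simp add: \<beta>_def x)
    qed
    show "snd (\<beta> g x) = snd x" for g x by (auto simp: \<beta>_def split: prod.splits)
    have "((([], 1), u) :: (('u sym \<times> 'u sym \<times> bool) list \<times> 'u sym) \<times> 'u) \<in> ?Q" for u
      using subgrp_one[OF G] by simp
    then show "snd ` ?Q = UNIV" by (metis UNIV_eq_I image_eqI snd_conv)
  qed
  obtain j :: "(('u sym \<times> 'u sym \<times> bool) list \<times> 'u sym) \<times> 'u \<Rightarrow> 'u" where j: "inj_on j ?Q"
    using words_inject[OF assms(3) roomy_inj[OF assms(2) G]] by blast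
  obtain \<psi> where "bij_betw \<psi> UNIV ?Q" "\<And>g x. g \<in> G \<Longrightarrow> x \<in> UNIV \<Longrightarrow> \<psi> (app g x) = \<beta> g (\<psi> x)"
    using free_actions_isomorphic[OF 1 2 inj_on_id j] by blast
  then have "hnn_realization G I A \<phi> \<psi>"
    by unfold_locales (auto simp: \<beta>_def)
  then show thesis by (rule that)
qed

section \<open>The HNN extension as a permutation group\<close>

context hnn_realization
begin

abbreviation (input) \<Psi> where "\<Psi> \<equiv> inv_into UNIV \<psi>"

lemma \<psi>_\<Psi>: "reduced w \<Longrightarrow> h \<in> G \<Longrightarrow> \<psi> (\<Psi> ((w, h), c)) = ((w, h), c)"
  using \<psi> by (simp add: bij_betw_def f_inv_into_f)

lemma \<Psi>_\<psi>: "\<Psi> (\<psi> u) = u"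
  using \<psi> by (simp add: bij_betw_def)

lemma \<psi>_range:
  assumes "\<psi> u = ((w, h), c)" shows "reduced w" "h \<in> G"
  using assms \<psi> unfolding bij_betw_def by (metis UNIV_I imageI mem_Collect_eq mem_Sigma_iff)+

lemma \<psi>_eqD: "\<psi> u = \<psi> v \<Longrightarrow> u = v"
  by (metis \<Psi>_\<psi>)

text \<open>By \<open>\<Gamma>_tracks\<close> the vertex reached depends neither on the group
  coordinate of the chosen point nor on its copy. The value 1 lets \<open>twist\<close> read off its
  factor directly.\<close>

definition act :: "'u sym \<Rightarrow> ('u sym \<times> 'u sym \<times> bool) list \<Rightarrow> ('u sym \<times> 'u sym \<times> bool) list" where
  "act x w = fst (fst (\<psi> (app x (\<Psi> ((w, 1), undefined)))))"

definition twist :: "'u sym \<Rightarrow> ('u sym \<times> 'u sym \<times> bool) list \<Rightarrow> 'u sym" where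
  "twist x w = snd (fst (\<psi> (app x (\<Psi> ((w, 1), undefined)))))"

text \<open>The shape of a left multiplication on normal forms: it commutes with right
  multiplication by \<open>G\<close> and respects each copy. The two maps determine the permutation,
  so identities between permutations can be checked on words.\<close>

definition tracks where
  "tracks x S \<kappa> \<longleftrightarrow> (\<forall>w h c. reduced w \<longrightarrow> h \<in> G \<longrightarrow>
     \<psi> (app x (\<Psi> ((w, h), c))) = ((S w, \<kappa> w * h), c))"

lemma tracksD: "tracks x S \<kappa> \<Longrightarrow> \<psi> u = ((w, h), c) \<Longrightarrow> \<psi> (app x u) = ((S w, \<kappa> w * h), c)"
  using \<psi>_range[of u w h c] \<Psi>_\<psi>[of u] unfolding tracks_def by metis

lemma tracksI:
  "(\<And>u w h c. \<psi> u = ((w, h), c) \<Longrightarrow> \<psi> (app x u) = ((S w, \<kappa> w * h), c)) \<Longrightarrow> tracks x S \<kappa>"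
  using \<psi>_\<Psi> unfolding tracks_def by metis

lemma tracks_act:
  assumes "tracks x S \<kappa>" "reduced w"
  shows "act x w = S w" "twist x w = \<kappa> w"
  using assms subgrp_one[OF G] by (simp_all add: act_def twist_def tracks_def)

lemma tracks_in:
  assumes "tracks x S \<kappa>" "reduced w"
  shows "reduced (S w)" "\<kappa> w \<in> G"
  using tracksD[OF assms(1) \<psi>_\<Psi>[OF assms(2) subgrp_one[OF G]], of undefined] \<psi>_range by fastforce+

lemma tracks_cong:
  assumes "tracks x S \<kappa>" "\<And>w. reduced w \<Longrightarrow> S w = S' w" "\<And>w. reduced w \<Longrightarrow> \<kappa> w = \<kappa>' w"
  shows "tracks x S' \<kappa>'"
  using assms unfolding tracks_def by simp

lemma tracks_eq:
  assumes "tracks x S \<kappa>" "tracks y S \<kappa>" shows "x = y"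
proof (rule sym_eqI)
  fix u
  obtain w h c where "\<psi> u = ((w, h), c)" by (metis surj_pair)
  then show "app x u = app y u" using tracksD assms by (intro \<psi>_eqD) simp
qed

lemma tracks_mult:
  assumes "tracks x S \<kappa>" "tracks y T \<theta>"
  shows "tracks (x * y) (\<lambda>w. S (T w)) (\<lambda>w. \<kappa> (T w) * \<theta> w)"
  using tracksD[OF assms(1) tracksD[OF assms(2)]] by (intro tracksI) (simp add: mult.assoc)

lemma tracks_G: "g \<in> G \<Longrightarrow> tracks g (vact g) (cocycle g)"
  using \<psi>_equiv by (intro tracksI) simp

definition letter :: "'u sym \<times> bool \<Rightarrow> 'u sym" where
  "letter e = Sym (\<lambda>u. \<Psi> (apfst (apfst (eact e)) (\<psi> u)))"

lemma app_letter:
  assumes "fst e \<in> I"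
  shows "app (letter e) u = \<Psi> (apfst (apfst (eact e)) (\<psi> u))"
proof -
  let ?f = "\<lambda>e u. \<Psi> (apfst (apfst (eact e)) (\<psi> u))"
  have *: "?f (bar e) (?f e u) = u" if "fst e \<in> I" for e u
  proof -
    obtain w h c where u: "\<psi> u = ((w, h), c)" by (metis surj_pair)
    have r: "reduced w" "h \<in> G" using \<psi>_range[OF u] by auto
    have "\<psi> (?f e u) = ((eact e w, h), c)"
      unfolding u using \<psi>_\<Psi>[OF reduced_eact[OF that r(1)] r(2)] by simp
    then show ?thesis using eact_bar[OF r(1)] \<Psi>_\<psi>[of u] by (simp add: u)
  qed
  have "bij (?f e)"
    using *[OF assms] *[of "bar e"] assms
    by (intro o_bij[of "?f (bar e)"]) (simp_all add: fun_eq_iff)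
  then show ?thesis by (simp add: letter_def app_Sym)
qed

lemma tracks_letter:
  assumes "fst e \<in> I" shows "tracks (letter e) (eact e) (\<lambda>w. 1)"
  unfolding tracks_def using assms by (simp add: app_letter \<psi>_\<Psi> reduced_eact)

lemma tracks_one: "tracks 1 (\<lambda>w. w) (\<lambda>w. 1)"
  by (intro tracksI) simp

lemma letter_bar:
  assumes "fst e \<in> I" shows "letter (bar e) * letter e = 1"
proof (rule tracks_eq)
  show "tracks (letter (bar e) * letter e) (\<lambda>w. w) (\<lambda>w. 1)"
    by (rule tracks_cong[OF tracks_mult[OF tracks_letter tracks_letter]]) (use assms eact_bar in auto)
qed (rule tracks_one)

lemma letter_commute:
  assumes "fst e \<in> I" "a \<in> A e" shows "a * letter e = letter e * \<phi> e a"
proof (rule tracks_eq)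
  have a: "a \<in> G" "\<phi> e a \<in> G" using assms A(2)[OF assms(1)] A(2)[of "bar e"] \<phi>_in[OF assms] by auto
  show "tracks (a * letter e) (\<lambda>w. eact e (vact (\<phi> e a) w)) (\<lambda>w. 1 * cocycle (\<phi> e a) w)"
    by (rule tracks_cong[OF tracks_mult[OF tracks_G[OF a(1)] tracks_letter[OF assms(1)]]])
       (use vact_eact[OF assms] in auto)
  show "tracks (letter e * \<phi> e a) (\<lambda>w. eact e (vact (\<phi> e a) w)) (\<lambda>w. 1 * cocycle (\<phi> e a) w)"
    by (rule tracks_mult[OF tracks_letter[OF assms(1)] tracks_G[OF a(2)]])
qed

inductive_set \<Gamma> :: "'u sym set" where
  one_in_\<Gamma>: "1 \<in> \<Gamma>"
| G_mult_in_\<Gamma>: "g \<in> G \<Longrightarrow> x \<in> \<Gamma> \<Longrightarrow> g * x \<in> \<Gamma>"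
| letter_mult_in_\<Gamma>: "fst e \<in> I \<Longrightarrow> x \<in> \<Gamma> \<Longrightarrow> letter e * x \<in> \<Gamma>"

lemma G_subset: "g \<in> G \<Longrightarrow> g \<in> \<Gamma>"
  using G_mult_in_\<Gamma>[OF _ one_in_\<Gamma>] by simp

lemma letter_in: "fst e \<in> I \<Longrightarrow> letter e \<in> \<Gamma>"
  using letter_mult_in_\<Gamma>[OF _ one_in_\<Gamma>] by simp

lemma \<Gamma>_mult: "x \<in> \<Gamma> \<Longrightarrow> y \<in> \<Gamma> \<Longrightarrow> x * y \<in> \<Gamma>"
  by (induction rule: \<Gamma>.induct) (simp_all add: \<Gamma>.intros mult.assoc)

lemma inverse_letter: "fst e \<in> I \<Longrightarrow> inverse (letter e) = letter (bar e)"
  using letter_bar[of "bar e"] by (intro group_inverse_unique) simp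

lemma \<Gamma>_subgrp: "subgrp \<Gamma>"
proof -
  have "inverse x \<in> \<Gamma>" if "x \<in> \<Gamma>" for x
    using that
  proof (induction rule: \<Gamma>.induct)
    case (G_mult_in_\<Gamma> g x)
    then show ?case using G_subset[OF subgrp_inverse[OF G]] by (simp add: \<Gamma>_mult)
  next
    case (letter_mult_in_\<Gamma> e x)
    then show ?case by (simp add: \<Gamma>_mult inverse_letter letter_in)
  qed (simp add: one_in_\<Gamma>)
  then show ?thesis unfolding subgrp_def by (simp add: one_in_\<Gamma> \<Gamma>_mult)
qed

lemma \<Gamma>_tracks:
  assumes "x \<in> \<Gamma>"
  shows "tracks x (act x) (twist x)"
    and "\<And>u w. reduced u \<Longrightarrow> reduced w \<Longrightarrow> tree_dist (act x u) (act x w) = tree_dist u w"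
proof -
  have "\<exists>S \<kappa>. tracks x S \<kappa> \<and> (\<forall>u w. reduced u \<longrightarrow> reduced w \<longrightarrow> tree_dist (S u) (S w) = tree_dist u w)"
    using assms
  proof (induction rule: \<Gamma>.induct)
    case one_in_\<Gamma>
    then show ?case using tracks_one by (intro exI[of _ "\<lambda>w. w"]) auto
  next
    case (G_mult_in_\<Gamma> g x)
    then obtain S \<kappa> where S: "tracks x S \<kappa>"
      "\<And>u w. reduced u \<Longrightarrow> reduced w \<Longrightarrow> tree_dist (S u) (S w) = tree_dist u w" by blast
    show ?case
      using tracks_mult[OF tracks_G[OF G_mult_in_\<Gamma>(1)] S(1)] S(2) tracks_in(1)[OF S(1)]
        vact_isometry[OF _ _ G_mult_in_\<Gamma>(1)] by (intro exI conjI) auto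
  next
    case (letter_mult_in_\<Gamma> e x)
    then obtain S \<kappa> where S: "tracks x S \<kappa>"
      "\<And>u w. reduced u \<Longrightarrow> reduced w \<Longrightarrow> tree_dist (S u) (S w) = tree_dist u w" by blast
    show ?case
      using tracks_mult[OF tracks_letter[OF letter_mult_in_\<Gamma>(1)] S(1)] S(2) tracks_in(1)[OF S(1)]
        eact_isometry[of _ _ e] by (intro exI conjI) auto
  qed
  then obtain S \<kappa> where S: "tracks x S \<kappa>"
    "\<And>u w. reduced u \<Longrightarrow> reduced w \<Longrightarrow> tree_dist (S u) (S w) = tree_dist u w" by blast
  show "tracks x (act x) (twist x)"
    by (rule tracks_cong[OF S(1)]) (simp_all add: tracks_act[OF S(1)])
  show "tree_dist (act x u) (act x w) = tree_dist u w" if "reduced u" "reduced w" for u w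
    using S that by (simp add: tracks_act[OF S(1)])
qed

lemma reduced_act: "x \<in> \<Gamma> \<Longrightarrow> reduced w \<Longrightarrow> reduced (act x w)"
  using tracks_in(1)[OF \<Gamma>_tracks(1)] .

lemma act_mult: "x \<in> \<Gamma> \<Longrightarrow> y \<in> \<Gamma> \<Longrightarrow> reduced w \<Longrightarrow> act (x * y) w = act x (act y w)"
  using tracks_act(1)[OF tracks_mult[OF \<Gamma>_tracks(1) \<Gamma>_tracks(1)]] .

lemma act_G: "g \<in> G \<Longrightarrow> reduced w \<Longrightarrow> act g w = vact g w"
  using tracks_act(1)[OF tracks_G] .

lemma act_letter: "fst e \<in> I \<Longrightarrow> reduced w \<Longrightarrow> act (letter e) w = eact e w"
  using tracks_act(1)[OF tracks_letter] .

lemma act_one: "reduced w \<Longrightarrow> act 1 w = w"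
  using tracks_act(1)[OF tracks_one] .

fun word :: "('u sym \<times> 'u sym \<times> bool) list \<Rightarrow> 'u sym" where
  "word [] = 1"
| "word ((r, e) # w) = r * (letter e * word w)"

lemma word_in: "reduced w \<Longrightarrow> word w \<in> \<Gamma>"
  by (induction w rule: reduced.induct) (auto intro: \<Gamma>.intros)

lemma act_word: "reduced w \<Longrightarrow> act (word w) [] = w"
proof (induction w rule: reduced.induct)
  case (2 r e w)
  then have "act (letter e * word w) [] = (1, e) # w"
    by (simp add: act_mult letter_in word_in act_letter) (simp add: eact_def)
  moreover have "act r ((1, e) # w) = (r, e) # w"
  proof -
    have "coset_diff e r = 1" using 2(2) \<phi>_one by (simp add: coset_diff_def)
    moreover have "reduced ((1, e) # w)"
      using 2(2) reduced_eact[of e w] by (simp add: eact_def)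
    ultimately show ?thesis using 2(2) by (simp add: act_G vact_one)
  qed
  ultimately show ?case
    using 2(2) by (simp add: act_mult G_subset \<Gamma>_mult letter_in word_in)
qed (simp add: act_one)

lemma G_mult_word: "reduced w \<Longrightarrow> g \<in> G \<Longrightarrow> g * word w = word (vact g w) * cocycle g w"
proof (induction w arbitrary: g rule: reduced.induct)
  case (2 r e w)
  then have e: "fst e \<in> I" by simp
  let ?s = "coset_rep e (g * r)"
  have "g * r * letter e = ?s * (inverse ?s * (g * r) * letter e)" by (simp add: mult.assoc)
  also have "\<dots> = ?s * (letter e * coset_diff e (g * r))"
    unfolding coset_diff_def letter_commute[OF e coset_rep_diff[OF e]] ..
  finally have "g * word ((r, e) # w) = ?s * (letter e * (coset_diff e (g * r) * word w))"
    by (simp flip: mult.assoc)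
  then show ?case using 2 coset_diff_in_G[OF e] by (simp add: mult.assoc)
qed simp

lemma letter_mult_word: "fst e \<in> I \<Longrightarrow> letter e * word w = word (eact e w)"
proof (cases "starts (bar e) w")
  case True
  assume e: "fst e \<in> I"
  obtain w' where "w = (1, bar e) # w'" using True by (auto simp: starts_iff)
  then show ?thesis using letter_bar[of "bar e"] e by (simp add: eact_def flip: mult.assoc)
qed (simp add: eact_def)

lemma \<Gamma>_normal_form:
  assumes "x \<in> \<Gamma>"
  shows "\<exists>w g. reduced w \<and> g \<in> G \<and> x = word w * g"
  using assms
proof (induction rule: \<Gamma>.induct)
  case one_in_\<Gamma>
  then show ?case using subgrp_one[OF G] by (intro exI[of _ "[]"]) auto
next
  case (G_mult_in_\<Gamma> h x)
  then obtain w g where x: "reduced w" "g \<in> G" "x = word w * g" by blast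
  have "h * x = word (vact h w) * (cocycle h w * g)"
    using G_mult_word[OF x(1) G_mult_in_\<Gamma>(1)] x(3) by (simp flip: mult.assoc)
  then show ?case
    using reduced_vact[OF x(1) G_mult_in_\<Gamma>(1)] cocycle_in[OF x(1) G_mult_in_\<Gamma>(1)] x(2) subgrp_mult[OF G]
    by blast
next
  case (letter_mult_in_\<Gamma> e x)
  then obtain w g where x: "reduced w" "g \<in> G" "x = word w * g" by blast
  have "letter e * x = word (eact e w) * g"
    using letter_mult_word[OF letter_mult_in_\<Gamma>(1)] x(3) by (simp flip: mult.assoc)
  then show ?case using reduced_eact[OF letter_mult_in_\<Gamma>(1) x(1)] x(2) by blast
qed

lemma act_root_eq:
  assumes "x \<in> \<Gamma>" "act x [] = w"
  obtains g where "g \<in> G" "x = word w * g"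
proof -
  obtain v g where v: "reduced v" "g \<in> G" "x = word v * g" using \<Gamma>_normal_form[OF assms(1)] by blast
  have "act x [] = v" using v by (simp add: act_mult word_in G_subset act_G act_word)
  then show thesis using that v assms(2) by blast
qed

lemma stabilizer_root:
  assumes "x \<in> \<Gamma>" shows "act x [] = [] \<longleftrightarrow> x \<in> G"
proof
  assume "act x [] = []"
  then show "x \<in> G" using act_root_eq[OF assms] by auto
qed (simp add: act_G)

text \<open>A permutation fixing a point fixes the vertex of that point. Conjugated to the root it
  lies in \<open>G\<close> and still has a fixed point, so \<open>vact_free\<close> applies. The
  copies provide the orbits.\<close>

lemma \<Gamma>_roomy: "roomy \<Gamma>"
  unfolding roomy_def
proof (intro conjI ballI allI impI)
  fix x u assume x: "x \<in> \<Gamma>" "app x u = u"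
  obtain w h c where u: "\<psi> u = ((w, h), c)" by (metis surj_pair)
  have w: "reduced w" using \<psi>_range u by blast
  have fix_w: "act x w = w" using tracksD[OF \<Gamma>_tracks(1)[OF x(1)] u] x(2) u by simp
  let ?y = "inverse (word w) * x * word w" and ?u = "app (inverse (word w)) u"
  have i: "inverse (word w) \<in> \<Gamma>" by (rule subgrp_inverse[OF \<Gamma>_subgrp word_in[OF w]])
  have y: "?y \<in> \<Gamma>" using x(1) word_in[OF w] i by (simp add: \<Gamma>_mult)
  have "act (inverse (word w)) w = []"
    using act_mult[OF i word_in[OF w], of "[]"] act_word[OF w] by (simp add: act_one)
  then have "act ?y [] = []"
    using x(1) word_in[OF w] i w fix_w by (simp add: act_mult \<Gamma>_mult reduced_act act_word)
  then have yG: "?y \<in> G" using stabilizer_root[OF y] by simp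
  obtain w' h' c' where u': "\<psi> ?u = ((w', h'), c')" by (metis surj_pair)
  have "app ?y ?u = ?u" using x(2) by simp
  then have v: "vact ?y w' = w'" "cocycle ?y w' * h' = 1 * h'"
    using \<psi>_equiv[OF yG u'] u' by simp_all
  from v(2) have "cocycle ?y w' = 1" by (simp only: group_cancel_right)
  then have "?y = 1" using vact_free[OF \<psi>_range(1)[OF u'] yG v(1)] by blast
  then show "x = 1" by simp
next
  have "snd (\<psi> (\<Psi> (([], 1), u))) = u" for u using \<psi>_\<Psi>[of "[]" 1] subgrp_one[OF G] by simp
  then have "surj (\<lambda>u. snd (\<psi> u))" by (metis surjI)
  moreover have "snd (\<psi> (app x u)) = snd (\<psi> u)" if "x \<in> \<Gamma>" for x u
    using tracksD[OF \<Gamma>_tracks(1)[OF that], of u] by (metis prod.exhaust_sel snd_conv)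
  ultimately show "\<exists>c :: 'u \<Rightarrow> 'u. surj c \<and> (\<forall>g\<in>\<Gamma>. \<forall>u. c (app g u) = c u)"
    by (intro exI[of _ "\<lambda>u. snd (\<psi> u)"]) blast
qed

end

text \<open>The letters \<open>(i, True)\<close> are those whose edge groups may have large intersections with their
  conjugates; the edge groups of the others share no translations. As the two ends of an
  edge have opposite types, translations fix only paths of length at most two.\<close>

locale separated_hnn = hnn_realization +
  assumes commuting_involutions: "\<lbrakk>i \<in> G; j \<in> G; involution i; involution j; i * j = j * i\<rbrakk> \<Longrightarrow> i = j"
    and separated: "\<lbrakk>fst e \<in> I; fst e' \<in> I; r \<in> G; z \<in> A e; z * z \<noteq> 1; inverse r * z * r \<in> A e'\<rbrakk>
      \<Longrightarrow> e = e' \<and> r \<in> A e \<or> snd e \<and> snd e'"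
begin

text \<open>Conjugation by \<open>r * letter e\<close> moves the first vertex of the fixed path to
  the root and turns \<open>y\<close> into an element of the opposite edge group that fixes the
  rest.\<close>

lemma fix_step:
  assumes "reduced ((r, e) # w)" "y * y \<noteq> 1" "vact y ((r, e) # w) = (r, e) # w"
  shows "inverse r * y * r \<in> A e" and "\<phi> e (inverse r * y * r) \<in> A (bar e)"
    and "\<phi> e (inverse r * y * r) * \<phi> e (inverse r * y * r) \<noteq> 1"
    and "vact (\<phi> e (inverse r * y * r)) w = w"
proof -
  have e: "fst e \<in> I" and r: "coset_rep e (y * r) = r" using assms by auto
  show a: "inverse r * y * r \<in> A e" using coset_rep_diff[OF e, of "y * r"] r by (simp add: mult.assoc)
  show "\<phi> e (inverse r * y * r) \<in> A (bar e)" by (rule \<phi>_in[OF e a])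
  show "vact (\<phi> e (inverse r * y * r)) w = w"
    using assms(3) r by (simp add: coset_diff_def mult.assoc)
  show "\<phi> e (inverse r * y * r) * \<phi> e (inverse r * y * r) \<noteq> 1"
  proof
    assume "\<phi> e (inverse r * y * r) * \<phi> e (inverse r * y * r) = 1"
    then have "\<phi> e (inverse r * (y * y) * r) = 1"
      using \<phi>_mult[OF e a a] by (simp add: square_conj)
    then have "inverse r * (y * y) * r = 1"
      using \<phi>_bar[OF e subgrp_mult[OF A(1)[OF e] a a]] \<phi>_one[of "bar e"] e by (simp add: square_conj)
    then show False using assms(2) by simp
  qed
qed

text \<open>At the inner vertex the ends \<open>bar e\<close> and \<open>e'\<close> meet.
  Reducedness excludes that they belong to the same edge of the tree, so \<open>separated\<close>
  leaves only two ends of type \<open>True\<close>.\<close>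

lemma fix_turn:
  assumes "reduced ((r, e) # (r', e') # w)" "y * y \<noteq> 1"
    and "vact y ((r, e) # (r', e') # w) = (r, e) # (r', e') # w"
  shows "\<not> snd e" "snd e'"
proof -
  let ?y = "\<phi> e (inverse r * y * r)"
  note s = fix_step[OF assms]
  have s': "inverse r' * ?y * r' \<in> A e'"
    by (rule fix_step(1)[OF _ s(3,4)]) (use assms(1) in simp)
  have r': "fst e \<in> I" "fst e' \<in> I" "r' \<in> G" "coset_rep e' r' = r'" "\<not> (r' = 1 \<and> e' = bar e)"
    using assms(1) by auto
  have "bar e = e' \<and> r' \<in> A (bar e) \<or> snd (bar e) \<and> snd e'"
    by (rule separated[OF _ r'(2,3) s(2,3) s']) (use r' in simp)
  moreover have "\<not> (bar e = e' \<and> r' \<in> A (bar e))"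
    using r' coset_rep_eq_1[of e' r'] by auto
  ultimately show "\<not> snd e" "snd e'" by auto
qed

text \<open>The middle letter would be of type \<open>True\<close> because of the turn before it and
  of type \<open>False\<close> because of the turn after it.\<close>

lemma fix_three:
  assumes "reduced w" "vact y w = w" "length w = 3"
  shows "y * y = 1"
proof (rule ccontr)
  assume y: "y * y \<noteq> 1"
  obtain r e r' e' x where w: "w = [(r, e), (r', e'), x]"
    using assms(3) by (auto simp: numeral_3_eq_3 length_Suc_conv)
  have red: "reduced ((r', e') # [x])" using assms(1) w by simp
  obtain r'' e'' where x: "x = (r'', e'')" by (cases x)
  have "snd e'" using fix_turn(2) assms(1,2) y w by blast
  moreover have "\<not> snd e'"
    using fix_turn(1)[OF red[unfolded x] fix_step(3)[OF assms(1)[unfolded w] y]]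
      fix_step(4)[OF assms(1)[unfolded w] y] assms(2) w x by simp
  ultimately show False by simp
qed

sublocale tree_action \<Gamma> "{w. reduced w}" act
proof
  show "subgrp \<Gamma>" by (rule \<Gamma>_subgrp)
  show "[] \<in> {w. reduced w}" by simp
  show "take n w \<in> {w. reduced w}" if "w \<in> {w. reduced w}" for w n using that reduced_take by simp
  show "act x w \<in> {w. reduced w}" if "x \<in> \<Gamma>" "w \<in> {w. reduced w}" for x w
    using that reduced_act by simp
  show "act 1 w = w" if "w \<in> {w. reduced w}" for w using that act_one by simp
  show "act (x * y) w = act x (act y w)" if "x \<in> \<Gamma>" "y \<in> \<Gamma>" "w \<in> {w. reduced w}" for x y w
    using that act_mult by simp
  show "tree_dist (act x u) (act x w) = tree_dist u w"
    if "x \<in> \<Gamma>" "u \<in> {w. reduced w}" "w \<in> {w. reduced w}" for x u w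
    using that \<Gamma>_tracks(2) by simp
  show "\<exists>x\<in>\<Gamma>. act x [] = w" if "w \<in> {w. reduced w}" for w
    using that act_word word_in by blast
  show "act x [a] \<noteq> []" if x: "x \<in> \<Gamma>" "act x [] = [a]" for x a
  proof
    assume c: "act x [a] = []"
    obtain r e where a: "a = (r, e)" by (cases a)
    have red: "reduced [(r, e)]" using reduced_act[OF x(1), of "[]"] x(2) a by simp
    then have r: "r \<in> G" "fst e \<in> I" by auto
    obtain g where g: "g \<in> G" "x = r * (letter e * g)"
      using act_root_eq[OF x] a by (auto simp: mult.assoc)
    have rg: "reduced [(coset_rep e (g * r), e)]" using reduced_vact[OF red g(1)] by simp
    \<comment> \<open>The letter \<open>e\<close> of \<open>x\<close> meets a path that begins with
      \<open>e\<close> and not with \<open>bar e\<close>, so nothing cancels and the image has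
      length two.\<close>
    have "act x [(r, e)] = act r (eact e [(coset_rep e (g * r), e)])"
      unfolding g(2) using r g(1) red rg
      by (simp add: act_mult G_subset \<Gamma>_mult letter_in act_G act_letter reduced_act del: reduced.simps)
    also have "\<dots> = vact r (eact e [(coset_rep e (g * r), e)])"
      using r rg by (intro act_G reduced_eact)
    finally have "length (act x [(r, e)]) = 2" by (simp add: eact_def)
    then show False using c a by simp
  qed
  show "x = y" if "x \<in> \<Gamma>" "y \<in> \<Gamma>" "act x [] = []" "act y [] = []" "involution x" "involution y"
    "x * y = y * x" for x y
    using that stabilizer_root commuting_involutions by blast
  show "x * x = 1" if "x \<in> \<Gamma>" "act x [] = []" "w \<in> {w. reduced w}" "length w = 3" "act x w = w" for x w
    using that stabilizer_root fix_three act_G by auto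
qed

end

section \<open>Extending admissible groups\<close>

definition affine_rep :: "('k::field_char_0 \<times> 'k \<Rightarrow> 'g::group_mult) \<Rightarrow> bool" where
  "affine_rep \<eta> \<longleftrightarrow> inj_on \<eta> {(a, b). a \<noteq> 0} \<and>
     (\<forall>a b c d. a \<noteq> 0 \<longrightarrow> c \<noteq> 0 \<longrightarrow> \<eta> (a, b) * \<eta> (c, d) = \<eta> (a * c, a * d + b))"

definition affine_group :: "('k::field_char_0 \<times> 'k \<Rightarrow> 'g::group_mult) \<Rightarrow> 'g set" where
  "affine_group \<eta> = \<eta> ` {(a, b). a \<noteq> 0}"

definition translation_group :: "('k::field_char_0 \<times> 'k \<Rightarrow> 'g::group_mult) \<Rightarrow> 'g set" where
  "translation_group \<eta> = range (\<lambda>b. \<eta> (1, b))"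

definition conj_class :: "'g::group_mult set \<Rightarrow> 'g set \<Rightarrow> 'g set set" where
  "conj_class G S = {(\<lambda>x. inverse g * x * g) ` S | g. g \<in> G}"

text \<open>The invariant of the inductive construction. In the limit the second alternative of the last
  clause disappears, since each step conjugates all isolated dihedral subgroups into the affine group.\<close>

definition admissible :: "('k::field_char_0 \<times> 'k \<Rightarrow> 'g::group_mult) \<Rightarrow> 'g set \<Rightarrow> bool" where
  "admissible \<eta> G \<longleftrightarrow> subgrp G \<and> affine_group \<eta> \<subseteq> G \<and>
     (\<forall>i\<in>G. involution i \<longrightarrow> (\<exists>x\<in>G. inverse x * i * x = \<eta> (-1, 0))) \<and>
     (\<forall>x\<in>G. \<forall>b. b \<noteq> 0 \<longrightarrow> inverse x * \<eta> (1, b) * x \<in> translation_group \<eta> \<longrightarrow> x \<in> affine_group \<eta>) \<and>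
     (\<forall>i\<in>G. \<forall>j\<in>G. involution i \<longrightarrow> involution j \<longrightarrow> i \<noteq> j \<longrightarrow>
        (\<exists>x\<in>G. inverse x * i * x \<in> affine_group \<eta> \<and> inverse x * j * x \<in> affine_group \<eta>) \<or>
        (\<exists>\<delta>. isolated G \<delta> \<and> i \<in> range \<delta> \<and> j \<in> range \<delta>))"

lemma admissibleD:
  assumes "admissible \<eta> G"
  shows "subgrp G" "affine_group \<eta> \<subseteq> G"
    and "\<And>i. i \<in> G \<Longrightarrow> involution i \<Longrightarrow> \<exists>x\<in>G. inverse x * i * x = \<eta> (-1, 0)"
    and "\<And>x b. x \<in> G \<Longrightarrow> b \<noteq> 0 \<Longrightarrow> inverse x * \<eta> (1, b) * x \<in> translation_group \<eta> \<Longrightarrow> x \<in> affine_group \<eta>"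
    and "\<And>i j. \<lbrakk>i \<in> G; j \<in> G; involution i; involution j; i \<noteq> j\<rbrakk> \<Longrightarrow>
        (\<exists>x\<in>G. inverse x * i * x \<in> affine_group \<eta> \<and> inverse x * j * x \<in> affine_group \<eta>) \<or>
        (\<exists>\<delta>. isolated G \<delta> \<and> i \<in> range \<delta> \<and> j \<in> range \<delta>)"
  using assms unfolding admissible_def by blast+

section \<open>Representatives of isolated subgroups\<close>

lemma conj_class_self: "subgrp G \<Longrightarrow> S \<in> conj_class G S"
  unfolding conj_class_def using subgrp_one by (auto intro!: exI[of _ 1])

lemma conj_class_conj:
  assumes "subgrp G" "r \<in> G"
  shows "conj_class G ((\<lambda>x. inverse r * x * r) ` S) = conj_class G S"
proof (intro subset_antisym subsetI)
  fix B assume "B \<in> conj_class G ((\<lambda>x. inverse r * x * r) ` S)"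
  then obtain g where g: "g \<in> G" "B = (\<lambda>x. inverse g * x * g) ` (\<lambda>x. inverse r * x * r) ` S"
    unfolding conj_class_def by blast
  have "B = (\<lambda>x. inverse (r * g) * x * (r * g)) ` S" unfolding g(2) image_image by (simp add: mult.assoc)
  then show "B \<in> conj_class G S" unfolding conj_class_def using subgrp_mult[OF assms g(1)] by blast
next
  fix B assume "B \<in> conj_class G S"
  then obtain g where g: "g \<in> G" "B = (\<lambda>x. inverse g * x * g) ` S"
    unfolding conj_class_def by blast
  let ?g = "inverse r * g"
  have "B = (\<lambda>x. inverse ?g * x * ?g) ` (\<lambda>x. inverse r * x * r) ` S"
    unfolding g(2) image_image by (simp add: mult.assoc)
  then show "B \<in> conj_class G ((\<lambda>x. inverse r * x * r) ` S)"
    unfolding conj_class_def using subgrp_mult[OF assms(1) subgrp_inverse[OF assms] g(1)] by blast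
qed

text \<open>The choice refers to \<open>\<delta>\<close> only through the conjugacy class of its
  range, so conjugate subgroups get the same representative with the same parametrization.\<close>

definition pick :: "'g::group_mult set \<Rightarrow> (bool \<times> int \<Rightarrow> 'g) \<Rightarrow> (bool \<times> int \<Rightarrow> 'g)" where
  "pick G \<delta> = (SOME \<delta>'. isolated G \<delta>' \<and> conj_class G (range \<delta>') = conj_class G (range \<delta>))"

definition reps :: "'g::group_mult set \<Rightarrow> (bool \<times> int \<Rightarrow> 'g) set" where
  "reps G = pick G ` {\<delta>. isolated G \<delta>}"

lemma pick:
  assumes "isolated G \<delta>"
  shows "isolated G (pick G \<delta>)" "conj_class G (range (pick G \<delta>)) = conj_class G (range \<delta>)"
proof -
  have "isolated G (pick G \<delta>) \<and> conj_class G (range (pick G \<delta>)) = conj_class G (range \<delta>)"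
    unfolding pick_def by (rule someI[of _ \<delta>]) (use assms in simp)
  then show "isolated G (pick G \<delta>)" "conj_class G (range (pick G \<delta>)) = conj_class G (range \<delta>)" by auto
qed

lemma pick_cong: "conj_class G (range \<delta>) = conj_class G (range \<delta>') \<Longrightarrow> pick G \<delta> = pick G \<delta>'"
  unfolding pick_def by simp

lemma reps_isolated: "\<delta> \<in> reps G \<Longrightarrow> isolated G \<delta>"
  unfolding reps_def using pick(1) by auto

lemma reps_pick: "\<delta> \<in> reps G \<Longrightarrow> pick G \<delta> = \<delta>"
proof -
  assume "\<delta> \<in> reps G"
  then obtain \<delta>' where "isolated G \<delta>'" "\<delta> = pick G \<delta>'" unfolding reps_def by blast
  then show ?thesis using pick_cong[OF pick(2)] by blast
qed

text \<open>The conjugate of one representative shares a translation with the other, so the two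
  subgroups are equal by \<open>isolated_eq\<close> and the representatives belong to one
  class.\<close>

lemma reps_separated:
  assumes "subgrp G" "\<delta> \<in> reps G" "\<delta>' \<in> reps G" "r \<in> G"
    and "z \<in> range \<delta>" "z * z \<noteq> 1" "inverse r * z * r \<in> range \<delta>'"
  shows "\<delta> = \<delta>'" "r \<in> range \<delta>"
proof -
  let ?c = "\<lambda>x. inverse r * \<delta> x * r"
  have "range ?c = range \<delta>'"
  proof (rule isolated_eq[OF isolated_conj[OF reps_isolated[OF assms(2)] assms(1,4)] reps_isolated[OF assms(3)] assms(1) _ assms(7)])
    show "inverse r * z * r \<in> range ?c" using assms(5) by auto
    show "inverse r * z * r * (inverse r * z * r) \<noteq> 1" using assms(6) unfolding square_conj by simp
  qed
  moreover have "range ?c = (\<lambda>x. inverse r * x * r) ` range \<delta>" by auto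
  ultimately have "conj_class G (range \<delta>') = conj_class G (range \<delta>)"
    using conj_class_conj[OF assms(1,4)] by metis
  then show eq: "\<delta> = \<delta>'" using pick_cong reps_pick assms(2,3) by metis
  show "r \<in> range \<delta>" using isolatedD(3)[OF reps_isolated[OF assms(2)] assms(4-6)] assms(7) eq by simp
qed

lemma reps_conj:
  assumes "subgrp G" "isolated G \<delta>"
  shows "\<exists>g\<in>G. \<exists>\<delta>'\<in>reps G. \<forall>x\<in>range \<delta>. inverse g * x * g \<in> range \<delta>'"
proof -
  have "range (pick G \<delta>) \<in> conj_class G (range \<delta>)"
    using conj_class_self[OF assms(1)] pick(2)[OF assms(2)] by blast
  then obtain g where "g \<in> G" "range (pick G \<delta>) = (\<lambda>x. inverse g * x * g) ` range \<delta>"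
    unfolding conj_class_def by blast
  moreover have "pick G \<delta> \<in> reps G" unfolding reps_def using assms(2) by blast
  ultimately show ?thesis by blast
qed

definition rep_of :: "'g::group_mult set \<Rightarrow> 'g \<Rightarrow> (bool \<times> int \<Rightarrow> 'g)" where
  "rep_of G i = (SOME \<delta>. \<delta> \<in> reps G \<and> \<delta> (True, 1) = i)"

text \<open>A representative \<open>\<delta>\<close> is named by its basic translation \<open>\<delta> (True, 1)\<close>. The name \<open>1\<close> is free
  and used for an additional stable letter with trivial edge groups.\<close>

definition names :: "'g::group_mult set \<Rightarrow> 'g set" where
  "names G = insert 1 ((\<lambda>\<delta>. \<delta> (True, 1)) ` reps G)"

lemma rep_of:
  assumes "i \<in> names G" "i \<noteq> 1" shows "rep_of G i \<in> reps G" "rep_of G i (True, 1) = i"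
proof -
  have "\<exists>\<delta>. \<delta> \<in> reps G \<and> \<delta> (True, 1) = i" using assms unfolding names_def by auto
  then have "rep_of G i \<in> reps G \<and> rep_of G i (True, 1) = i"
    unfolding rep_of_def by (rule someI_ex)
  then show "rep_of G i \<in> reps G" "rep_of G i (True, 1) = i" by auto
qed

lemma name:
  assumes "subgrp G" "\<delta> \<in> reps G"
  shows "\<delta> (True, 1) \<in> names G" "\<delta> (True, 1) \<noteq> 1" "rep_of G (\<delta> (True, 1)) = \<delta>"
proof -
  note d = isolatedD(1)[OF reps_isolated[OF assms(2)]]
  show n: "\<delta> (True, 1) \<in> names G" unfolding names_def using assms(2) by blast
  show n1: "\<delta> (True, 1) \<noteq> 1" using dihedral_eq[OF d, of "(True, 1)" "(True, 0)"] dihedral_one[OF d] by simp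
  have "\<delta> = rep_of G (\<delta> (True, 1))"
  proof (rule reps_separated(1)[OF assms(1,2) rep_of(1)[OF n n1] subgrp_one[OF assms(1)]])
    show "\<delta> (True, 1) \<in> range \<delta>" by blast
    show "\<delta> (True, 1) * \<delta> (True, 1) \<noteq> 1" by (simp add: dihedral_square[OF d])
    show "inverse 1 * \<delta> (True, 1) * 1 \<in> range (rep_of G (\<delta> (True, 1)))"
      using rep_of(2)[OF n n1] by (metis group_inverse_one mult_1_left mult_1_right rangeI)
  qed
  then show "rep_of G (\<delta> (True, 1)) = \<delta>" by simp
qed

lemma dihedral_transfer:
  assumes "dihedral \<delta>" "dihedral \<delta>'" "x \<in> range \<delta>" "y \<in> range \<delta>"
  shows "\<delta>' (inv_into UNIV \<delta> (x * y)) = \<delta>' (inv_into UNIV \<delta> x) * \<delta>' (inv_into UNIV \<delta> y)"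
    and "\<delta> (inv_into UNIV \<delta>' (\<delta>' (inv_into UNIV \<delta> x))) = x"
proof -
  have "inj \<delta>" "inj \<delta>'" using assms unfolding dihedral_def by blast+
  then show "\<delta> (inv_into UNIV \<delta>' (\<delta>' (inv_into UNIV \<delta> x))) = x"
    using assms(3) by (auto simp: f_inv_into_f)
  obtain a m b n where "x = \<delta> (a, m)" "y = \<delta> (b, n)" using assms(3,4) by auto
  then show "\<delta>' (inv_into UNIV \<delta> (x * y)) = \<delta>' (inv_into UNIV \<delta> x) * \<delta>' (inv_into UNIV \<delta> y)"
    using \<open>inj \<delta>\<close> by (simp add: dihedral_mult[OF assms(1)] dihedral_mult[OF assms(2)])
qed

lemma rep_of_isolated: "i \<in> names G \<Longrightarrow> i \<noteq> 1 \<Longrightarrow> isolated G (rep_of G i)"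
  using rep_of(1) reps_isolated by blast

section \<open>The affine group inside an admissible group\<close>

context
  fixes \<eta> :: "'k::field_char_0 \<times> 'k \<Rightarrow> 'g::group_mult"
  assumes affine_rep: "affine_rep \<eta>"
begin

lemma aff_mult: "a \<noteq> 0 \<Longrightarrow> c \<noteq> 0 \<Longrightarrow> \<eta> (a, b) * \<eta> (c, d) = \<eta> (a * c, a * d + b)"
  using affine_rep unfolding affine_rep_def by blast

lemma aff_eq: "a \<noteq> 0 \<Longrightarrow> c \<noteq> 0 \<Longrightarrow> \<eta> (a, b) = \<eta> (c, d) \<longleftrightarrow> a = c \<and> b = d"
proof -
  assume "a \<noteq> 0" "c \<noteq> 0"
  moreover have "inj_on \<eta> {(a, b). a \<noteq> 0}" using affine_rep unfolding affine_rep_def by blast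
  ultimately show ?thesis by (simp add: inj_on_eq_iff)
qed

lemma aff_one: "\<eta> (1, 0) = 1"
proof -
  have "\<eta> (1, 0) * \<eta> (1, 0) = \<eta> (1, 0) * 1" by (simp add: aff_mult)
  then show ?thesis by (simp only: group_cancel_left)
qed

lemma aff_inverse: "a \<noteq> 0 \<Longrightarrow> inverse (\<eta> (a, b)) = \<eta> (1 / a, - b / a)"
  by (rule group_inverse_unique) (simp add: aff_mult aff_one)

lemma aff_in: "a \<noteq> 0 \<Longrightarrow> \<eta> (a, b) \<in> affine_group \<eta>"
  unfolding affine_group_def by auto

lemma affE:
  assumes "x \<in> affine_group \<eta>" obtains a b where "x = \<eta> (a, b)" "a \<noteq> 0"
  using assms unfolding affine_group_def by auto

lemma aff_subgrp: "subgrp (affine_group \<eta>)"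
  unfolding subgrp_def
proof (intro conjI ballI)
  show "1 \<in> affine_group \<eta>" using aff_in[of 1 0] aff_one by simp
  fix x assume x: "x \<in> affine_group \<eta>"
  then obtain a b where ab: "x = \<eta> (a, b)" "a \<noteq> 0" by (rule affE)
  then show "inverse x \<in> affine_group \<eta>" by (simp add: aff_inverse aff_in)
  fix y assume "y \<in> affine_group \<eta>"
  then obtain c d where "y = \<eta> (c, d)" "c \<noteq> 0" by (rule affE)
  then show "x * y \<in> affine_group \<eta>" using ab by (simp add: aff_mult aff_in)
qed

lemma aff_eq_one: "a \<noteq> 0 \<Longrightarrow> \<eta> (a, b) = 1 \<longleftrightarrow> a = 1 \<and> b = 0"
  using aff_eq[of a 1 b 0] aff_one by simp

lemma aff_involution: "involution (\<eta> (-1, b))"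
  unfolding involution_def by (simp add: aff_mult aff_one aff_eq_one)

lemma aff_involutionE:
  assumes "x \<in> affine_group \<eta>" "involution x" obtains b where "x = \<eta> (-1, b)"
proof -
  obtain a b where ab: "x = \<eta> (a, b)" "a \<noteq> 0" using assms(1) by (rule affE)
  have "a * a = 1" "a * b + b = 0" "a \<noteq> 1 \<or> b \<noteq> 0"
    using assms(2) ab unfolding involution_def by (simp_all add: aff_mult aff_eq_one)
  then have "a = - 1" using square_eq_1_iff[of a] by auto
  then show thesis using that ab by simp
qed

definition aff_dihedral :: "bool \<times> int \<Rightarrow> 'g" where
  "aff_dihedral = (\<lambda>(s, n). \<eta> (if s then 1 else - 1, of_int n))"

text \<open>Characteristic 0 makes \<open>of_int\<close> injective and separates 1 from -1, so this
  dihedral group is infinite.\<close>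

lemma dihedral_aff_dihedral: "dihedral aff_dihedral"
  unfolding dihedral_def inj_def by (auto simp: aff_dihedral_def aff_mult aff_eq)

lemma aff_dihedral_in: "range aff_dihedral \<subseteq> affine_group \<eta>"
  by (auto simp: aff_dihedral_def aff_in)

lemma aff_dihedral_translation:
  assumes "z \<in> range aff_dihedral" "z * z \<noteq> 1"
  shows "z \<in> translation_group \<eta>"
proof -
  obtain m where "z = aff_dihedral (True, m)"
    using dihedral_translationE[OF dihedral_aff_dihedral assms] by blast
  then show ?thesis by (simp add: aff_dihedral_def translation_group_def)
qed

text \<open>A translation of the affine group is conjugate to its own square, one of a dihedral group is not.\<close>

lemma isolated_no_translation:
  assumes "admissible \<eta> G" "isolated G \<delta>" "x \<in> G" "z \<in> range \<delta>" "z * z \<noteq> 1"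
  shows "inverse x * z * x \<notin> translation_group \<eta>"
proof
  assume "inverse x * z * x \<in> translation_group \<eta>"
  then obtain b where b: "inverse x * z * x = \<eta> (1, b)" unfolding translation_group_def by blast
  then have z: "z = x * \<eta> (1, b) * inverse x" by (simp add: conj_eq_iff)
  have "b \<noteq> 0"
  proof
    assume "b = 0"
    then have "z = 1" using z by (simp add: aff_one)
    then show False using assms(5) by simp
  qed
  \<comment> \<open>Conjugation by the homothety with ratio 1/2 doubles translations. The dihedral
    group would force the doubled \<open>b\<close> to be \<open>b\<close> or \<open>- b\<close>,
    impossible in characteristic 0.\<close>
  let ?d = "\<eta> (1 / 2, 0)"
  let ?y = "x * ?d * inverse x"
  have "?d \<in> G" using aff_in[of "1 / 2" 0] admissibleD(2)[OF assms(1)] by auto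
  then have y: "?y \<in> G"
    using assms(3) admissibleD(1)[OF assms(1)] by (simp add: subgrp_mult subgrp_inverse)
  have conj: "inverse ?y * z * ?y = x * (inverse ?d * \<eta> (1, b) * ?d) * inverse x"
    unfolding z by (simp add: mult.assoc)
  have d: "inverse ?d * \<eta> (1, b) * ?d = \<eta> (1, 2 * b)"
    by (simp add: aff_inverse aff_mult)
  have zz: "z * z = x * \<eta> (1, 2 * b) * inverse x"
    unfolding z by (simp add: mult.assoc) (simp add: aff_mult flip: mult.assoc)
  have "inverse ?y * z * ?y = z * z" unfolding conj d zz ..
  moreover have "z * z \<in> range \<delta>"
    using subgrp_mult[OF dihedral_subgrp[OF isolatedD(1)[OF assms(2)]] assms(4,4)] .
  ultimately have "?y \<in> range \<delta>" using isolatedD(3)[OF assms(2) y assms(4,5)] by simp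
  then have "inverse ?y * z * ?y = z \<or> inverse ?y * z * ?y = inverse z"
    by (rule dihedral_conj[OF isolatedD(1)[OF assms(2)] assms(4,5)])
  moreover have "inverse z = x * \<eta> (1, - b) * inverse x"
    unfolding z by (simp add: mult.assoc aff_inverse)
  ultimately have "x * \<eta> (1, 2 * b) * inverse x = x * \<eta> (1, b) * inverse x
      \<or> x * \<eta> (1, 2 * b) * inverse x = x * \<eta> (1, - b) * inverse x"
    unfolding conj d using z by metis
  then have "2 * b = b \<or> 2 * b = - b" by (simp add: aff_eq)
  then have "b = 0 \<or> 3 * b = 0" by (auto simp: algebra_simps eq_neg_iff_add_eq_0)
  then show False using \<open>b \<noteq> 0\<close> by simp
qed

text \<open>In both alternatives the involutions are reflections of one affine or dihedral group; if
  they commute, their product is a translation equal to its inverse, hence trivial.\<close>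

lemma admissible_commuting:
  assumes "admissible \<eta> G" "i \<in> G" "j \<in> G" "involution i" "involution j" "i * j = j * i"
  shows "i = j"
proof (rule ccontr)
  assume "i \<noteq> j"
  then consider x where "x \<in> G" "inverse x * i * x \<in> affine_group \<eta>" "inverse x * j * x \<in> affine_group \<eta>"
    | \<delta> where "isolated G \<delta>" "i \<in> range \<delta>" "j \<in> range \<delta>"
    using admissibleD(5)[OF assms(1-5)] by blast
  then show False
  proof cases
    case 1
    obtain b where b: "inverse x * i * x = \<eta> (-1, b)" using aff_involutionE[OF 1(2)] assms(4) by auto
    obtain c where c: "inverse x * j * x = \<eta> (-1, c)" using aff_involutionE[OF 1(3)] assms(5) by auto
    have "inverse x * i * x * (inverse x * j * x) = inverse x * (i * j) * x" by (simp add: mult.assoc)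
    also have "\<dots> = inverse x * j * x * (inverse x * i * x)" unfolding assms(6) by (simp add: mult.assoc)
    finally have "\<eta> (1, b - c) = \<eta> (1, c - b)" unfolding b c by (simp add: aff_mult)
    then have "b - c = c - b" by (simp add: aff_eq)
    then have "2 * b = 2 * c" by (simp add: algebra_simps)
    then have "inverse x * i * x = inverse x * j * x" using b c by simp
    then show False using \<open>i \<noteq> j\<close> by simp
  next
    case 2
    note d = isolatedD(1)[OF 2(1)]
    obtain m where m: "i = \<delta> (False, m)" using dihedral_involutionE[OF d 2(2) assms(4)] by blast
    obtain n where n: "j = \<delta> (False, n)" using dihedral_involutionE[OF d 2(3) assms(5)] by blast
    have "\<delta> (True, m - n) = \<delta> (True, n - m)"
      using assms(6) unfolding m n by (simp add: dihedral_mult[OF d])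
    then have "m = n" by (simp add: dihedral_eq[OF d])
    then show False using \<open>i \<noteq> j\<close> m n by simp
  qed
qed

text \<open>The end \<open>(i, False)\<close> carries the isolated subgroup named \<open>i\<close>.
  All ends \<open>(i, True)\<close> with \<open>i \<noteq> 1\<close> carry the same target in the
  affine group, hence the exception for two ends of type \<open>True\<close> in
  \<open>separated\<close>.\<close>

definition edge_group :: "'g set \<Rightarrow> 'g \<times> bool \<Rightarrow> 'g set" where
  "edge_group G e = (if fst e = 1 then {1} else if snd e then range aff_dihedral
     else range (rep_of G (fst e)))"

definition edge_map :: "'g set \<Rightarrow> 'g \<times> bool \<Rightarrow> 'g \<Rightarrow> 'g" where
  "edge_map G e x = (if fst e = 1 then x
     else if snd e then rep_of G (fst e) (inv_into UNIV aff_dihedral x)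
     else aff_dihedral (inv_into UNIV (rep_of G (fst e)) x))"

lemma admissible_hnn:
  assumes "admissible \<eta> G"
  shows "hnn G (names G) (edge_group G) (edge_map G)"
proof
  note G = admissibleD(1)[OF assms]
  note dC = dihedral_aff_dihedral
  have d: "dihedral (rep_of G i)" if "i \<in> names G" "i \<noteq> 1" for i
    using isolatedD(1)[OF rep_of_isolated[OF that]] .
  have sub1: "subgrp {1 :: 'g}" unfolding subgrp_def by simp
  show "subgrp G" by (rule G)
  show "names G \<subseteq> G"
    using subgrp_one[OF G] isolatedD(2)[OF reps_isolated] unfolding names_def by blast
  fix e :: "'g \<times> bool" assume e: "fst e \<in> names G"
  show "subgrp (edge_group G e)"
    using e sub1 dihedral_subgrp[OF dC] dihedral_subgrp[OF d] by (simp add: edge_group_def)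
  show "edge_group G e \<subseteq> G"
    using subgrp_one[OF G] subset_trans[OF aff_dihedral_in admissibleD(2)[OF assms]]
      isolatedD(2)[OF rep_of_isolated[OF e]] by (simp add: edge_group_def)
  fix a assume a: "a \<in> edge_group G e"
  show "edge_map G e a \<in> edge_group G (bar e)"
    using a by (auto simp: edge_group_def edge_map_def)
  show "edge_map G (bar e) (edge_map G e a) = a"
    using a e dihedral_transfer(2)[OF dC d, of "fst e" a] dihedral_transfer(2)[OF d dC, of "fst e" a]
    by (auto simp: edge_group_def edge_map_def split: if_splits)
  fix b assume b: "b \<in> edge_group G e"
  show "edge_map G e (a * b) = edge_map G e a * edge_map G e b"
    using a b e dihedral_transfer(1)[OF dC d, of "fst e" a b] dihedral_transfer(1)[OF d dC, of "fst e" a b]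
    by (auto simp: edge_group_def edge_map_def split: if_splits)
qed

text \<open>Two isolated ends are handled by \<open>reps_separated\<close>; an isolated and an
  affine end share no conjugate translation by \<open>isolated_no_translation\<close>.\<close>

lemma admissible_separated:
  assumes "admissible \<eta> G" "fst e \<in> names G" "fst e' \<in> names G" "r \<in> G"
    and "z \<in> edge_group G e" "z * z \<noteq> 1" "inverse r * z * r \<in> edge_group G e'"
  shows "e = e' \<and> r \<in> edge_group G e \<or> snd e \<and> snd e'"
proof -
  note G = admissibleD(1)[OF assms(1)]
  let ?z = "inverse r * z * r"
  have zz: "?z * ?z \<noteq> 1" using assms(6) unfolding square_conj by simp
  have z1: "z \<noteq> 1" using assms(6) by auto
  have n: "fst e \<noteq> 1" "fst e' \<noteq> 1" using assms(5,7) z1 by (auto simp: edge_group_def)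
  note R = rep_of[OF assms(2) n(1)] rep_of[OF assms(3) n(2)]
  note I = rep_of_isolated[OF assms(2) n(1)] rep_of_isolated[OF assms(3) n(2)]
  consider "snd e" "snd e'" | "\<not> snd e" "\<not> snd e'" | "\<not> snd e" "snd e'" | "snd e" "\<not> snd e'" by blast
  then show ?thesis
  proof cases
    case 2
    have z: "z \<in> range (rep_of G (fst e))" "?z \<in> range (rep_of G (fst e'))"
      using assms(5,7) n 2 by (auto simp: edge_group_def)
    note s = reps_separated[OF G R(1,3) assms(4) z(1) assms(6) z(2)]
    have "fst e = fst e'" using R(2,4) unfolding s(1) by simp
    then show ?thesis using s(2) 2 n by (simp add: prod_eq_iff edge_group_def)
  next
    case 3
    have "z \<in> range (rep_of G (fst e))" "?z \<in> range aff_dihedral"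
      using assms(5,7) n 3 by (auto simp: edge_group_def)
    then show ?thesis
      using isolated_no_translation[OF assms(1) I(1) assms(4) _ assms(6)] aff_dihedral_translation[OF _ zz] by blast
  next
    case 4
    have z: "z \<in> range aff_dihedral" "?z \<in> range (rep_of G (fst e'))"
      using assms(5,7) n 4 by (auto simp: edge_group_def)
    have "inverse (inverse r) * ?z * inverse r = z" by (simp add: mult.assoc)
    then show ?thesis
      using isolated_no_translation[OF assms(1) I(2) subgrp_inverse[OF G assms(4)] z(2) zz]
        aff_dihedral_translation[OF z(1) assms(6)] by simp
  qed blast
qed

end

text \<open>The clauses are decided on the tree: whatever fixes a vertex is conjugate into
  \<open>G\<close>, where the clause is known, and two involutions without common fixed vertex lie
  in an isolated line stabilizer.\<close>

theorem admissible_extension: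
  fixes \<eta> :: "'k::field_char_0 \<times> 'k \<Rightarrow> 'u sym"
  assumes rep: "affine_rep \<eta>" and adm_G: "admissible \<eta> G" and roomy_G: "roomy G" and inf: "infinite (UNIV :: 'u set)"
  obtains \<Gamma> where "G \<subseteq> \<Gamma>" "admissible \<eta> \<Gamma>" "roomy \<Gamma>"
    and "\<And>i j. \<lbrakk>i \<in> G; j \<in> G; involution i; involution j; i \<noteq> j\<rbrakk> \<Longrightarrow>
        \<exists>x\<in>\<Gamma>. inverse x * i * x \<in> affine_group \<eta> \<and> inverse x * j * x \<in> affine_group \<eta>"
    and "\<exists>x\<in>\<Gamma>. x * \<eta> (-1, 0) * inverse x \<notin> G"
proof -
  let ?I = "names G" and ?A = "edge_group \<eta> G" and ?f = "edge_map \<eta> G"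
  obtain \<psi> where "hnn_realization G ?I ?A ?f \<psi>"
    using hnn_realization_exists[OF admissible_hnn[OF rep adm_G] roomy_G inf] by blast
  then interpret hnn_realization G ?I ?A ?f \<psi> .
  interpret separated_hnn G ?I ?A ?f \<psi>
    by unfold_locales (fact admissible_commuting[OF rep adm_G], fact admissible_separated[OF rep adm_G])
  note adm = admissibleD[OF adm_G]
  have sub: "G \<subseteq> \<Gamma>" using G_subset by blast
  have fixes_root: "inverse x * y * x \<in> G" if "x \<in> \<Gamma>" "y \<in> \<Gamma>" "act y (act x []) = act x []" for x y
    using stabilizer_root[OF grp_conj[OF that(1,2)]] act_conj[OF that(1,2), of "[]"] that
      act_inverse_cancel(1)[OF that(1), of "[]"] by simp
  have pairs: "\<exists>x\<in>\<Gamma>. inverse x * i * x \<in> affine_group \<eta> \<and> inverse x * j * x \<in> affine_group \<eta>"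
    if ij: "i \<in> G" "j \<in> G" "involution i" "involution j" "i \<noteq> j" for i j
  proof -
    consider x where "x \<in> G" "inverse x * i * x \<in> affine_group \<eta>" "inverse x * j * x \<in> affine_group \<eta>"
      | \<delta> where "isolated G \<delta>" "i \<in> range \<delta>" "j \<in> range \<delta>"
      using adm(5)[OF ij] by blast
    then show ?thesis
    proof cases
      case 1
      then show ?thesis using sub by blast
    next
      case 2
      obtain g \<delta>' where g: "g \<in> G" "\<delta>' \<in> reps G" "\<And>x. x \<in> range \<delta> \<Longrightarrow> inverse g * x * g \<in> range \<delta>'"
        using reps_conj[OF adm(1) 2(1)] by metis
      let ?e = "(\<delta>' (True, 1), False)"
      note nm = name[OF adm(1) g(2)]
      have e: "fst ?e \<in> ?I" "?A ?e = range \<delta>'" "?A (bar ?e) = range (aff_dihedral \<eta>)"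
        using nm by (simp_all add: edge_group_def[OF rep])
      \<comment> \<open>\<open>g\<close> conjugates to the representative, and the stable letter
        conjugates that to the target in the affine group.\<close>
      have "inverse (g * letter ?e) * y * (g * letter ?e) \<in> affine_group \<eta>" if "y \<in> range \<delta>" for y
      proof -
        have a: "inverse g * y * g \<in> ?A ?e" using g(3)[OF that] e(2) by simp
        have "inverse (g * letter ?e) * y * (g * letter ?e)
            = inverse (letter ?e) * (inverse g * y * g * letter ?e)" by (simp add: mult.assoc)
        also have "\<dots> = ?f ?e (inverse g * y * g)"
          unfolding letter_commute[OF e(1) a] by simp
        finally show ?thesis using \<phi>_in[OF e(1) a] e(3) aff_dihedral_in[OF rep] by auto
      qed
      moreover have "g * letter ?e \<in> \<Gamma>" using G_mult_in_\<Gamma>[OF g(1) letter_in[OF e(1)]] .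
      ultimately show ?thesis using 2 by blast
    qed
  qed
  have "admissible \<eta> \<Gamma>"
    unfolding admissible_def
  proof (intro conjI ballI allI impI)
    show "subgrp \<Gamma>" by (rule \<Gamma>_subgrp)
    show "affine_group \<eta> \<subseteq> \<Gamma>" using adm(2) sub by blast
  next
    fix i assume i: "i \<in> \<Gamma>" "involution i"
    obtain v where v: "reduced v" "act i v = v"
      using square_one_fixes_vertex[OF i(1)] i(2) unfolding involution_def by blast
    obtain x where x: "x \<in> \<Gamma>" "act x [] = v" using act_transitive v(1) by blast
    obtain y where y: "y \<in> G" "inverse y * (inverse x * i * x) * y = \<eta> (-1, 0)"
      using adm(3)[OF fixes_root[OF x(1) i(1)]] x v i by auto
    have "inverse (x * y) * i * (x * y) = \<eta> (-1, 0)" using y(2) by (simp add: mult.assoc)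
    then show "\<exists>x\<in>\<Gamma>. inverse x * i * x = \<eta> (-1, 0)" using \<Gamma>_mult[OF x(1)] y(1) sub by blast
  next
    fix x and b :: 'k
    let ?t = "\<eta> (1, b)"
    assume x: "x \<in> \<Gamma>" and b: "b \<noteq> 0" and xt: "inverse x * ?t * x \<in> translation_group \<eta>"
    obtain c where c: "inverse x * ?t * x = \<eta> (1, c)" using xt unfolding translation_group_def by blast
    have t: "\<eta> (1, d) \<in> G" for d using aff_in[OF rep, of 1 d] adm(2) by auto
    have tt: "?t * ?t \<noteq> 1" using b by (simp add: aff_mult[OF rep] aff_eq_one[OF rep])
    define w where "w = act x []"
    have w: "reduced w" using reduced_act[OF x] by (simp add: w_def)
    \<comment> \<open>Both translations fix the root, so \<open>?t\<close> also fixes its image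
      \<open>w\<close> under \<open>x\<close>.\<close>
    have "?t * x = x * \<eta> (1, c)" unfolding c[symmetric] by (simp add: mult.assoc)
    then have "act (?t * x) [] = act (x * \<eta> (1, c)) []" by simp
    then have tw: "vact ?t w = w"
      using act_mult[OF G_subset[OF t] x] act_mult[OF x G_subset[OF t]] act_G[OF t] w
      by (simp add: w_def)
    show "x \<in> affine_group \<eta>"
    proof (cases w)
      case Nil
      then have "x \<in> G" using stabilizer_root[OF x] w_def by simp
      then show ?thesis using adm(4) b xt by blast
    next
      \<comment> \<open>A fixed path of positive length would be a single edge entered at its affine
        end. Then \<open>x\<close> would carry the translation into a conjugate of an isolated
        subgroup, which contains no translation of the affine group.\<close>
      case (Cons y w')
      obtain r e where y: "y = (r, e)" by (cases y)
      note s = fix_step[OF w[unfolded Cons y] tt tw[unfolded Cons y]]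
      have r: "r \<in> G" "fst e \<in> ?I" using w Cons y by auto
      let ?a = "inverse r * ?t * r"
      have aa: "?a * ?a \<noteq> 1" using tt unfolding square_conj by simp
      have e1: "fst e \<noteq> 1" using s(1) aa by (auto simp: edge_group_def[OF rep])
      note iso = rep_of_isolated[OF r(2) e1]
      have "snd e"
      proof (rule ccontr)
        assume "\<not> snd e"
        then have a: "?a \<in> range (rep_of G (fst e))"
          using s(1) e1 by (simp add: edge_group_def[OF rep])
        have "inverse (inverse r) * ?a * inverse r = ?t" by (simp add: mult.assoc)
        then have "inverse (inverse r) * ?a * inverse r \<in> translation_group \<eta>"
          by (simp add: translation_group_def)
        then show False
          using isolated_no_translation[OF rep adm_G iso subgrp_inverse[OF adm(1) r(1)] a aa] by blast
      qed
      have "w' = []"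
      proof (rule ccontr)
        assume "w' \<noteq> []"
        then obtain r' e' w'' where w': "w' = (r', e') # w''" by (cases w') auto
        show False using fix_turn(1)[OF w[unfolded Cons y w'] tt tw[unfolded Cons y w']] \<open>snd e\<close> by simp
      qed
      then obtain g where g: "g \<in> G" "x = r * (letter e * g)"
        using act_root_eq[OF x, of w] Cons y by (auto simp: w_def mult.assoc)
      have "inverse x * ?t * x = inverse g * (inverse (letter e) * (?a * letter e)) * g"
        unfolding g(2) by (simp add: mult.assoc)
      also have "\<dots> = inverse g * ?f e ?a * g"
        unfolding letter_commute[OF r(2) s(1)] by simp
      finally have "inverse g * ?f e ?a * g \<in> translation_group \<eta>" using xt by simp
      moreover have "?f e ?a \<in> range (rep_of G (fst e))"
        using s(2) e1 \<open>snd e\<close> by (simp add: edge_group_def[OF rep])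
      ultimately show ?thesis using isolated_no_translation[OF rep adm_G iso g(1) _ s(3)] by blast
    qed
  next
    fix i j assume ij: "i \<in> \<Gamma>" "j \<in> \<Gamma>" "involution i" "involution j" "i \<noteq> j"
    show "(\<exists>x\<in>\<Gamma>. inverse x * i * x \<in> affine_group \<eta> \<and> inverse x * j * x \<in> affine_group \<eta>) \<or>
        (\<exists>\<delta>. isolated \<Gamma> \<delta> \<and> i \<in> range \<delta> \<and> j \<in> range \<delta>)"
    proof (cases "\<exists>v. reduced v \<and> act i v = v \<and> act j v = v")
      case False
      then show ?thesis using involutions_without_common_fixed_vertex[OF ij(1,3,2,4)] by blast
    next
      case True
      then obtain v where v: "reduced v" "act i v = v" "act j v = v" by blast
      obtain x where x: "x \<in> \<Gamma>" "act x [] = v" using act_transitive v(1) by blast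
      obtain y where y: "y \<in> \<Gamma>" "inverse y * (inverse x * i * x) * y \<in> affine_group \<eta>"
        "inverse y * (inverse x * j * x) * y \<in> affine_group \<eta>"
        using pairs[OF fixes_root[OF x(1) ij(1)] fixes_root[OF x(1) ij(2)]] x v ij by auto
      have "inverse (x * y) * k * (x * y) = inverse y * (inverse x * k * x) * y" for k
        by (simp add: mult.assoc)
      then show ?thesis using y \<Gamma>_mult[OF x(1) y(1)] by metis
    qed
  qed
  moreover have "\<exists>x\<in>\<Gamma>. x * \<eta> (-1, 0) * inverse x \<notin> G"
  proof (intro bexI)
    \<comment> \<open>The free letter has trivial edge groups, so nothing cancels around
      \<open>?t \<noteq> 1\<close>, and the conjugate moves the root.\<close>
    define e f :: "'u sym \<times> bool" where "e = (1, False)" and "f = bar e"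
    let ?t = "\<eta> (-1, 0)"
    let ?r = "coset_rep f ?t"
    have e: "fst e \<in> names G" "fst f \<in> names G" by (simp_all add: names_def e_def f_def)
    have f: "\<not> starts (bar f) []" "bar e = f" "e \<noteq> f" by (simp_all add: f_def)
    have t: "?t \<in> G" using aff_in[OF rep, of "-1" 0] adm(2) by auto
    have in_\<Gamma>: "letter e \<in> \<Gamma>" "letter f \<in> \<Gamma>" "?t \<in> \<Gamma>"
      using letter_in e G_subset[OF t] by simp_all
    show "letter e \<in> \<Gamma>" by fact
    have "?t \<notin> edge_group \<eta> G f"
      by (simp add: aff_eq_one[OF rep] edge_group_def[OF rep] f_def e_def)
    then have r: "?r \<noteq> 1" using coset_rep_eq_1[OF e(2)] by simp
    have f0: "eact f [] = [(1, f)]" by (simp add: eact_def)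
    have red: "reduced [(1, f)]" using reduced_eact[OF e(2), of "[]"] unfolding f0 by simp
    have tf: "vact ?t [(1, f)] = [(?r, f)]" by simp
    have red': "reduced [(?r, f)]" using reduced_vact[OF red t] unfolding tf .
    have "act (letter e * ?t * letter f) [] = act (letter e) (act ?t (act (letter f) []))"
      using in_\<Gamma> by (simp add: act_mult \<Gamma>_mult reduced_act)
    also have "\<dots> = eact e [(?r, f)]"
      unfolding act_letter[OF e(2) reduced.simps(1)[THEN iffD2, OF TrueI]] f0 act_G[OF t red] tf
        act_letter[OF e(1) red'] ..
    also have "\<dots> \<noteq> []" using r by (simp add: eact_def)
    finally show "letter e * ?t * inverse (letter e) \<notin> G"
      unfolding inverse_letter[OF e(1)] f(2) using act_G[of _ "[]"] by fastforce
  qed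
  ultimately show thesis using that[OF sub _ \<Gamma>_roomy pairs] by blast
qed

section \<open>The limit group and its action on involutions\<close>

lemma aff_reflection_conj:
  assumes "affine_rep \<eta>"
  shows "inverse (\<eta> (1, b / 2)) * \<eta> (-1, b) * \<eta> (1, b / 2) = \<eta> (-1, 0)"
  using assms by (simp add: aff_inverse aff_mult)

lemma admissible_affine_group:
  assumes rep: "affine_rep \<eta>"
  shows "admissible \<eta> (affine_group \<eta>)"
  unfolding admissible_def
proof (intro conjI ballI allI impI)
  fix i assume "i \<in> affine_group \<eta>" "involution i"
  then obtain b where "i = \<eta> (-1, b)" by (rule aff_involutionE[OF rep])
  then show "\<exists>x\<in>affine_group \<eta>. inverse x * i * x = \<eta> (-1, 0)"
    using aff_reflection_conj[OF rep] aff_in[OF rep, of 1] by (intro bexI[of _ "\<eta> (1, b / 2)"]) auto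
next
  fix i j assume "i \<in> affine_group \<eta>" "j \<in> affine_group \<eta>"
  then have "\<exists>x\<in>affine_group \<eta>. inverse x * i * x \<in> affine_group \<eta> \<and> inverse x * j * x \<in> affine_group \<eta>"
    using subgrp_one[OF aff_subgrp[OF rep]] by (intro bexI[of _ 1]) auto
  then show "(\<exists>x\<in>affine_group \<eta>. inverse x * i * x \<in> affine_group \<eta> \<and> inverse x * j * x \<in> affine_group \<eta>) \<or>
        (\<exists>\<delta>. isolated (affine_group \<eta>) \<delta> \<and> i \<in> range \<delta> \<and> j \<in> range \<delta>)" ..
qed (simp_all add: aff_subgrp[OF rep])

text \<open>The left regular action of the affine group, one copy for each element of the field; an
  infinite field is in bijection with this set.\<close>

lemma roomy_affine_rep_exists:
  obtains \<eta> :: "'k::field_char_0 \<times> 'k \<Rightarrow> 'k sym" where "affine_rep \<eta>" "roomy (affine_group \<eta>)"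
proof -
  let ?C = "{(a, b :: 'k). a \<noteq> (0 :: 'k)}"
  obtain p :: "'k \<times> 'k \<Rightarrow> 'k" where p: "inj p" using infinite_inj_pair[OF infinite_UNIV_char_0] by blast
  have "inj_on (\<lambda>k :: 'k. ((1 :: 'k, 0 :: 'k), k)) UNIV" by (simp add: inj_on_def)
  moreover have "inj_on (\<lambda>(x, k). p (p x, k)) (?C \<times> (UNIV :: 'k set))"
    by (auto simp: inj_on_def inj_eq[OF p])
  moreover have "range (\<lambda>k :: 'k. ((1 :: 'k, 0 :: 'k), k)) \<subseteq> ?C \<times> UNIV" by auto
  ultimately obtain \<theta> :: "'k \<Rightarrow> ('k \<times> 'k) \<times> 'k" where \<theta>: "bij_betw \<theta> UNIV (?C \<times> UNIV)"
    using Schroeder_Bernstein[of "\<lambda>k :: 'k. ((1 :: 'k, 0 :: 'k), k)" UNIV "?C \<times> UNIV"] by blast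
  let ?\<Theta> = "inv_into UNIV \<theta>"
  have \<theta>\<Theta>: "\<theta> (?\<Theta> ((c, d), k)) = ((c, d), k)" if "c \<noteq> 0" for c d k
    using \<theta> that by (auto simp: bij_betw_def f_inv_into_f)
  have \<Theta>\<theta>: "?\<Theta> (\<theta> u) = u" for u using \<theta> by (simp add: bij_betw_def)
  have \<theta>_cases: "\<exists>c d k. c \<noteq> 0 \<and> u = ?\<Theta> ((c, d), k)" for u
  proof -
    obtain c d k where u: "\<theta> u = ((c, d), k)" by (metis surj_pair)
    then have "((c, d), k) \<in> ?C \<times> UNIV" using \<theta> unfolding bij_betw_def by (metis rangeI)
    then show ?thesis using u \<Theta>\<theta>[of u] by (intro exI[of _ c] exI[of _ d] exI[of _ k]) auto
  qed
  define F where "F = (\<lambda>(a, b) u. case \<theta> u of ((c, d), k) \<Rightarrow> ?\<Theta> ((a * c, a * d + b), k))"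
  have F: "F (a, b) (?\<Theta> ((c, d), k)) = ?\<Theta> ((a * c, a * d + b), k)" if "c \<noteq> 0" for a b c d k
    using that by (simp add: F_def \<theta>\<Theta>)
  have FF: "F (a, b) (F (c, d) u) = F (a * c, a * d + b) u" if "a \<noteq> 0" "c \<noteq> 0" for a b c d u
    using \<theta>_cases[of u] that by (auto simp: F algebra_simps)
  have F1: "F (1, 0) u = u" for u using \<theta>_cases[of u] by (auto simp: F)
  define \<eta> where "\<eta> x = Sym (F x)" for x
  have app: "app (\<eta> (a, b)) = F (a, b)" if "a \<noteq> 0" for a b
  proof -
    have "F (1 / a, - b / a) (F (a, b) u) = u" "F (a, b) (F (1 / a, - b / a) u) = u" for u
      using that FF[of "1 / a" a "- b / a" b u] FF[of a "1 / a" b "- b / a" u] F1[of u] by simp_all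
    then have "bij (F (a, b))"
      by (intro o_bij[of "F (1 / a, - b / a)"]) (simp_all add: fun_eq_iff)
    then show ?thesis by (simp add: \<eta>_def app_Sym)
  qed
  have \<Theta>_eq: "(c, d) = (c', d')" if "?\<Theta> ((c, d), k) = ?\<Theta> ((c', d'), k')" "c \<noteq> 0" "c' \<noteq> 0" for c d k c' d' k'
    using that \<theta>\<Theta> by (metis Pair_inject)
  have rep: "affine_rep \<eta>"
    unfolding affine_rep_def
  proof (intro conjI allI impI)
    show "inj_on \<eta> ?C"
    proof (rule inj_onI)
      fix x y assume "x \<in> ?C" "y \<in> ?C" "\<eta> x = \<eta> y"
      moreover obtain a b c d where xy: "x = (a, b)" "y = (c, d)" by (cases x; cases y)
      ultimately have "a \<noteq> 0" "c \<noteq> 0" "F (a, b) (?\<Theta> ((1, 0), 0)) = F (c, d) (?\<Theta> ((1, 0), 0))"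
        using app by (auto simp flip: app)
      then show "x = y" using \<Theta>_eq[of a b 0 c d 0] xy by (simp add: F)
    qed
    show "\<eta> (a, b) * \<eta> (c, d) = \<eta> (a * c, a * d + b)" if "a \<noteq> 0" "c \<noteq> 0" for a b c d
      using that by (intro sym_eqI) (simp add: app FF)
  qed
  have "roomy (affine_group \<eta>)"
    unfolding roomy_def
  proof (intro conjI ballI allI impI)
    fix g u assume g: "g \<in> affine_group \<eta>" "app g u = u"
    obtain a b where ab: "g = \<eta> (a, b)" "a \<noteq> 0" using g(1) by (rule affE[OF rep])
    obtain c d k where u: "c \<noteq> 0" "u = ?\<Theta> ((c, d), k)" using \<theta>_cases by blast
    have "(a * c, a * d + b) = (c, d)"
      using g(2) u ab by (intro \<Theta>_eq[of _ _ k _ _ k]) (simp_all add: app F)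
    then show "g = 1" using u(1) ab by (auto simp: aff_one[OF rep])
  next
    have "snd (\<theta> (?\<Theta> ((1, 0), k))) = k" for k by (simp add: \<theta>\<Theta>)
    then have "surj (\<lambda>u. snd (\<theta> u))" by (metis surjI)
    moreover have "snd (\<theta> (app g u)) = snd (\<theta> u)" if g: "g \<in> affine_group \<eta>" for g u
    proof -
      obtain a b where ab: "g = \<eta> (a, b)" "a \<noteq> 0" using g by (rule affE[OF rep])
      obtain c d k where u: "c \<noteq> 0" "u = ?\<Theta> ((c, d), k)" using \<theta>_cases by blast
      then show ?thesis using ab by (simp add: app F \<theta>\<Theta>)
    qed
    ultimately show "\<exists>c :: 'k \<Rightarrow> 'k. surj c \<and> (\<forall>g\<in>affine_group \<eta>. \<forall>u. c (app g u) = c u)"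
      by (intro exI[of _ "\<lambda>u. snd (\<theta> u)"]) blast
  qed
  then show thesis using that rep by blast
qed

section \<open>Involutions of the limit group\<close>

locale limit_group =
  fixes \<eta> :: "'k::field_char_0 \<times> 'k \<Rightarrow> 'g::group_mult" and W :: "'g set"
  assumes rep: "affine_rep \<eta>" and W: "subgrp W" and affine_subset: "affine_group \<eta> \<subseteq> W"
    and malnormal: "\<lbrakk>x \<in> W; b \<noteq> 0; inverse x * \<eta> (1, b) * x \<in> translation_group \<eta>\<rbrakk> \<Longrightarrow> x \<in> affine_group \<eta>"
    and pairs: "\<lbrakk>i \<in> W; j \<in> W; involution i; involution j; i \<noteq> j\<rbrakk> \<Longrightarrow>
        \<exists>x\<in>W. inverse x * i * x \<in> affine_group \<eta> \<and> inverse x * j * x \<in> affine_group \<eta>"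
    and proper: "\<exists>x\<in>W. x * \<eta> (-1, 0) * inverse x \<notin> affine_group \<eta>"
begin

lemmas W_mult = subgrp_mult[OF W] and W_inverse = subgrp_inverse[OF W] and W_one = subgrp_one[OF W]

abbreviation t where "t \<equiv> \<eta> (-1, 0)"

lemma aff_in_W: "a \<noteq> 0 \<Longrightarrow> \<eta> (a, b) \<in> W"
  using aff_in[OF rep] affine_subset by blast

definition J where "J = {i \<in> W. involution i}"

lemma JD: "i \<in> J \<Longrightarrow> i \<in> W" "i \<in> J \<Longrightarrow> involution i"
  unfolding J_def by auto

lemma aff_in_J: "\<eta> (-1, b) \<in> J"
  unfolding J_def using aff_in_W aff_involution[OF rep] by simp

lemma J_conj: "g \<in> W \<Longrightarrow> i \<in> J \<Longrightarrow> g * i * inverse g \<in> J"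
  unfolding J_def by (simp add: W_mult W_inverse)

lemma pair_conj:
  assumes "i \<in> J" "j \<in> J" "i \<noteq> j"
  obtains x where "x \<in> W" "i = x * t * inverse x" "j = x * \<eta> (-1, 1) * inverse x"
proof -
  obtain x where x: "x \<in> W" "inverse x * i * x \<in> affine_group \<eta>" "inverse x * j * x \<in> affine_group \<eta>"
    using pairs[OF JD(1)[OF assms(1)] JD(1)[OF assms(2)] JD(2)[OF assms(1)] JD(2)[OF assms(2)] assms(3)] by blast
  obtain b where b: "inverse x * i * x = \<eta> (-1, b)"
    using aff_involutionE[OF rep x(2)] JD(2)[OF assms(1)] by auto
  obtain c where c: "inverse x * j * x = \<eta> (-1, c)"
    using aff_involutionE[OF rep x(3)] JD(2)[OF assms(2)] by auto
  have bc: "c - b \<noteq> 0"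
  proof
    assume "c - b = 0"
    then have "inverse x * i * x = inverse x * j * x" using b c by simp
    then show False using assms(3) by simp
  qed
  \<comment> \<open>The reflection \<open>\<eta> (-1, b)\<close> has centre b/2. The map
    \<open>?y\<close> takes the centres 0 and 1/2 of \<open>t\<close> and
    \<open>\<eta> (-1, 1)\<close> to b/2 and c/2.\<close>
  let ?y = "\<eta> (c - b, b / 2)"
  have y: "\<eta> (-1, b) = ?y * t * inverse ?y" "\<eta> (-1, c) = ?y * \<eta> (-1, 1) * inverse ?y"
    using bc by (simp_all add: aff_inverse[OF rep] aff_mult[OF rep] aff_eq[OF rep] field_simps)
  show thesis
  proof
    show "x * ?y \<in> W" using W_mult[OF x(1) aff_in_W[OF bc]] .
    show "i = x * ?y * t * inverse (x * ?y)" "j = x * ?y * \<eta> (-1, 1) * inverse (x * ?y)"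
      using b c y unfolding conj_eq_iff by (simp_all add: mult.assoc)
  qed
qed

lemma conj_transitive:
  assumes "i \<in> J" "j \<in> J" "i \<noteq> j" "i' \<in> J" "j' \<in> J" "i' \<noteq> j'"
  shows "\<exists>g\<in>W. g * i * inverse g = i' \<and> g * j * inverse g = j'"
proof -
  obtain x where x: "x \<in> W" "i = x * t * inverse x" "j = x * \<eta> (-1, 1) * inverse x"
    using pair_conj assms(1-3) by blast
  obtain y where y: "y \<in> W" "i' = y * t * inverse y" "j' = y * \<eta> (-1, 1) * inverse y"
    using pair_conj assms(4-6) by blast
  show ?thesis
  proof (intro bexI conjI)
    show "y * inverse x \<in> W" using x(1) y(1) by (simp add: W_mult W_inverse)
    show "y * inverse x * i * inverse (y * inverse x) = i'" "y * inverse x * j * inverse (y * inverse x) = j'"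
      unfolding x(2,3) y(2,3) by (simp_all add: mult.assoc)
  qed
qed

text \<open>With the pair conjugated to \<open>t\<close> and \<open>\<eta> (-1, 1)\<close>, the
  element centralizes their product, a unit translation. By \<open>malnormal\<close> it is affine,
  and commuting with both reflections it fixes their centres 0 and 1/2.\<close>

lemma conj_stabilizer:
  assumes "i \<in> J" "j \<in> J" "i \<noteq> j" "g \<in> W" "g * i * inverse g = i" "g * j * inverse g = j"
  shows "g = 1"
proof -
  obtain x where x: "x \<in> W" "i = x * t * inverse x" "j = x * \<eta> (-1, 1) * inverse x"
    using pair_conj assms(1-3) by blast
  define z where "z = inverse x * g * x"
  have comm: "z * s = s * z" if "g * (x * s * inverse x) * inverse g = x * s * inverse x" for s
  proof -
    have "x * (z * s) * inverse x * inverse g = g * (x * s * inverse x) * inverse g"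
      by (simp add: z_def mult.assoc)
    also have "\<dots> = x * (s * z) * inverse x * inverse g" unfolding that by (simp add: z_def mult.assoc)
    finally show ?thesis by (simp only: group_cancel_left group_cancel_right)
  qed
  have 1: "z * t = t * z" "z * \<eta> (-1, 1) = \<eta> (-1, 1) * z"
    using comm assms(5,6) x(2,3) by blast+
  have e: "\<eta> (1, 1) = \<eta> (-1, 1) * t" by (simp add: aff_mult[OF rep])
  have "\<eta> (1, 1) * z = \<eta> (-1, 1) * (t * z)" unfolding e by (rule mult.assoc)
  also have "\<dots> = \<eta> (-1, 1) * z * t" by (simp only: mult.assoc 1(1))
  also have "\<dots> = z * \<eta> (1, 1)" unfolding e 1(2)[symmetric] by (rule mult.assoc)
  finally have "inverse z * \<eta> (1, 1) * z = \<eta> (1, 1)" by (simp add: mult.assoc)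
  then have "inverse z * \<eta> (1, 1) * z \<in> translation_group \<eta>" by (simp add: translation_group_def)
  moreover have "z \<in> W" using x(1) assms(4) by (simp add: z_def W_mult W_inverse)
  ultimately have "z \<in> affine_group \<eta>" using malnormal[of z 1] by simp
  then obtain a b where ab: "z = \<eta> (a, b)" "a \<noteq> 0" by (rule affE[OF rep])
  have "b = 0" using 1(1) ab by (simp add: aff_mult[OF rep] aff_eq[OF rep])
  moreover have "a = 1" using 1(2) ab \<open>b = 0\<close> by (simp add: aff_mult[OF rep] aff_eq[OF rep])
  ultimately have "z = 1" using ab(1) aff_one[OF rep] by simp
  then show ?thesis by (simp add: z_def)
qed

lemma power_conj: "(x * a * inverse x) ^ n = x * a ^ n * inverse (x :: 'g)"
  by (induction n) (simp_all add: mult.assoc)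

text \<open>The product of two distinct involutions is conjugate to the translation by -1, of
  infinite order in characteristic 0.\<close>

lemma involution_product_order:
  assumes "i \<in> J" "j \<in> J" "i \<noteq> j" "0 < n"
  shows "(i * j) ^ n \<noteq> 1"
proof
  assume 1: "(i * j) ^ n = 1"
  obtain x where x: "x \<in> W" "i = x * t * inverse x" "j = x * \<eta> (-1, 1) * inverse x"
    using pair_conj assms(1-3) by blast
  have "i * j = x * (t * \<eta> (-1, 1)) * inverse x" unfolding x(2,3) by (simp add: mult.assoc)
  then have "i * j = x * \<eta> (1, -1) * inverse x" by (simp add: aff_mult[OF rep])
  moreover have "\<eta> (1, -1) ^ n = \<eta> (1, - of_nat n)"
    by (induction n) (simp_all add: aff_mult[OF rep] aff_one[OF rep] algebra_simps)
  ultimately have "x * \<eta> (1, - of_nat n) * inverse x = 1" using 1 by (simp add: power_conj)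
  then have "\<eta> (1, - of_nat n) = 1" using conj_eq_iff[of x 1] by (simp add: group_conj_eq_one[of "inverse x", simplified])
  then show False using assms(4) by (simp add: aff_eq_one[OF rep])
qed

text \<open>For every involution \<open>j \<noteq> t\<close> there is an involution \<open>s\<close> with \<open>s t s = j\<close>. A regular normal subgroup
  contains \<open>s t\<close>, so by regularity it consists of such products. Hence it is inverted by \<open>t\<close> and abelian.\<close>

lemma no_regular_normal:
  assumes M: "subgrp M" "M \<subseteq> W" and normal: "\<And>g n. g \<in> W \<Longrightarrow> n \<in> M \<Longrightarrow> g * n * inverse g \<in> M"
    and regular: "\<And>i j. i \<in> J \<Longrightarrow> j \<in> J \<Longrightarrow> \<exists>!n. n \<in> M \<and> n * i * inverse n = j"
  shows False
proof -
  have t: "t \<in> W" "t \<in> J" "inverse t = t" "involution t"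
    using aff_in_W aff_in_J aff_involution[OF rep] involution_inverse[OF aff_involution[OF rep]] by auto
  have st: "s * t \<in> M" if s: "s \<in> J" for s
  proof -
    obtain n where n: "n \<in> M" "n * t * inverse n = s" using regular[OF t(2) s] by blast
    \<comment> \<open>As \<open>t\<close> is its own inverse, \<open>s * t\<close> is the commutator
      of \<open>n\<close> and \<open>t\<close>, which normality puts into \<open>M\<close>.\<close>
    have "n * (t * inverse n * inverse t) \<in> M"
      using normal[OF t(1) subgrp_inverse[OF M(1) n(1)]] n(1) subgrp_mult[OF M(1)] by blast
    then show ?thesis unfolding t(3) n(2)[symmetric] by (simp add: mult.assoc)
  qed
  have inverted: "t * n * t = inverse n" if n: "n \<in> M" for n
  proof (cases "n * t * inverse n = t")
    case True
    have "1 * t * inverse 1 = t" by simp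
    then have "n = 1" using regular[OF t(2) t(2)] n True subgrp_one[OF M(1)] by blast
    then show ?thesis using t(4) by (simp add: involution_def)
  next
    case False
    let ?j = "n * t * inverse n"
    have j: "?j \<in> J" using J_conj t(2) n M(2) by blast
    obtain x where x: "x \<in> W" "t = x * t * inverse x" "?j = x * \<eta> (-1, 1) * inverse x"
      using pair_conj[OF t(2) j] False by metis
    \<comment> \<open>The reflection in 1/4 exchanges the centres 0 and 1/2 of \<open>t\<close> and
      \<open>\<eta> (-1, 1)\<close>.\<close>
    define s where "s = x * \<eta> (-1, 1 / 2) * inverse x"
    have s: "s \<in> J" unfolding s_def by (rule J_conj[OF x(1) aff_in_J])
    have "s * (x * t * inverse x) * s = x * (\<eta> (-1, 1 / 2) * t * \<eta> (-1, 1 / 2)) * inverse x"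
      unfolding s_def by (simp add: mult.assoc)
    also have "\<dots> = ?j" unfolding x(3) by (simp add: aff_mult[OF rep])
    finally have sts: "s * t * s = ?j" unfolding x(2)[symmetric] .
    have "s * t * t * inverse (s * t) = s * t * s"
      using involution_inverse[OF JD(2)[OF s]] t(3,4) involution_cancel[OF t(4)] by (simp add: mult.assoc)
    then have "n = s * t" using regular[OF t(2) j] st[OF s] n sts by metis
    then show ?thesis
      using involution_inverse[OF JD(2)[OF s]] t(3) involution_cancel[OF t(4)] t(4)
      by (simp add: mult.assoc involution_def)
  qed
  have commute: "n * m = m * n" if "n \<in> M" "m \<in> M" for n m
  proof -
    have "inverse n * inverse m = t * n * t * (t * m * t)" using inverted that by simp
    also have "\<dots> = t * (n * m) * t" by (simp add: mult.assoc involution_cancel[OF t(4)])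
    also have "\<dots> = inverse (n * m)" using inverted subgrp_mult[OF M(1) that] by blast
    finally have "inverse (inverse n * inverse m) = n * m" by simp
    then show ?thesis by simp
  qed
  obtain x where x: "x \<in> W" "x * t * inverse x \<notin> affine_group \<eta>" using proper by blast
  \<comment> \<open>\<open>\<sigma>\<close> and the unit translation both lie in the abelian group
    \<open>M\<close>, so \<open>malnormal\<close> forces \<open>\<sigma>\<close> into the affine
    group, against the choice of \<open>x\<close>.\<close>
  define \<sigma> where "\<sigma> = x * t * inverse x * t"
  have \<sigma>: "\<sigma> \<in> M" unfolding \<sigma>_def by (rule st[OF J_conj[OF x(1) t(2)]])
  have "\<eta> (-1, 1) * t \<in> M" by (rule st[OF aff_in_J])
  then have "\<eta> (1, 1) \<in> M" by (simp add: aff_mult[OF rep])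
  then have "inverse \<sigma> * \<eta> (1, 1) * \<sigma> = \<eta> (1, 1)" using commute[OF \<sigma>] by (metis group_left_cancel mult.assoc)
  then have "inverse \<sigma> * \<eta> (1, 1) * \<sigma> \<in> translation_group \<eta>" by (simp add: translation_group_def)
  then have "\<sigma> \<in> affine_group \<eta>" using malnormal[of \<sigma> 1] \<sigma> M(2) by auto
  then have "x * t * inverse x \<in> affine_group \<eta>"
    unfolding \<sigma>_def using subgrp_cancel_right[OF aff_subgrp[OF rep] aff_in[OF rep, of "-1" 0]] by simp
  then show False using x(2) by blast
qed

end

text \<open>Freeness on \<open>'k\<close> is exported because it bounds the number of involutions by
  the size of \<open>'k\<close>.\<close>

theorem limit_group_exists:
  obtains \<eta> :: "'k::field_char_0 \<times> 'k \<Rightarrow> 'k sym" and W where "limit_group \<eta> W"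
    "\<And>g u. g \<in> W \<Longrightarrow> app g u = u \<Longrightarrow> g = 1"
proof -
  obtain \<eta> :: "'k \<times> 'k \<Rightarrow> 'k sym" where rep: "affine_rep \<eta>" and room: "roomy (affine_group \<eta>)"
    by (rule roomy_affine_rep_exists)
  let ?H = "affine_group \<eta>"
  define step where "step G \<Gamma> \<longleftrightarrow> G \<subseteq> \<Gamma> \<and>
      (\<forall>i j. i \<in> G \<longrightarrow> j \<in> G \<longrightarrow> involution i \<longrightarrow> involution j \<longrightarrow> i \<noteq> j \<longrightarrow>
        (\<exists>x\<in>\<Gamma>. inverse x * i * x \<in> ?H \<and> inverse x * j * x \<in> ?H)) \<and>
      (\<exists>x\<in>\<Gamma>. x * \<eta> (-1, 0) * inverse x \<notin> G)" for G \<Gamma>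
  \<comment> \<open>The start of the chain is recorded because \<open>proper\<close> is read off its
    first step.\<close>
  define P where "P n G \<longleftrightarrow> admissible \<eta> G \<and> roomy G \<and> (n = 0 \<longrightarrow> G = ?H)" for n :: nat and G
  have "\<exists>f. \<forall>n. P n (f n) \<and> step (f n) (f (Suc n))"
  proof (rule dependent_nat_choice)
    show "\<exists>G. P 0 G" unfolding P_def using admissible_affine_group[OF rep] room by blast
    fix G n assume "P n G"
    then obtain \<Gamma> where "admissible \<eta> \<Gamma>" "roomy \<Gamma>" "step G \<Gamma>"
      using admissible_extension[OF rep _ _ infinite_UNIV_char_0, of G] unfolding P_def step_def by metis
    then show "\<exists>\<Gamma>. P (Suc n) \<Gamma> \<and> step G \<Gamma>" unfolding P_def by blast
  qed
  then obtain f where f: "\<And>n. P n (f n)" "\<And>n. step (f n) (f (Suc n))" by blast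
  have f_mono: "f m \<subseteq> f n" if "m \<le> n" for m n
    by (rule lift_Suc_mono_le[OF _ that]) (use f(2) in \<open>auto simp: step_def\<close>)
  have adm: "admissible \<eta> (f n)" and rm: "roomy (f n)" for n using f(1) unfolding P_def by blast+
  define W where "W = (\<Union>n. f n)"
  have W1: "\<exists>n. x \<in> f n" if "x \<in> W" for x using that unfolding W_def by blast
  have W2: "\<exists>n. x \<in> f n \<and> y \<in> f n" if "x \<in> W" "y \<in> W" for x y
  proof -
    obtain m n where "x \<in> f m" "y \<in> f n" using W1 \<open>x \<in> W\<close> \<open>y \<in> W\<close> by blast
    then show ?thesis using f_mono[of m "max m n"] f_mono[of n "max m n"] by auto
  qed
  have sub: "f n \<subseteq> W" for n unfolding W_def by blast
  have "limit_group \<eta> W"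
  proof
    show "affine_rep \<eta>" by (rule rep)
    show "subgrp W"
      unfolding subgrp_def
    proof (intro conjI ballI)
      show "1 \<in> W" using subgrp_one[OF admissibleD(1)[OF adm]] sub by blast
      show "x * y \<in> W" if "x \<in> W" "y \<in> W" for x y
        using W2[OF that] subgrp_mult[OF admissibleD(1)[OF adm]] sub by blast
      show "inverse x \<in> W" if "x \<in> W" for x
        using W1[OF that] subgrp_inverse[OF admissibleD(1)[OF adm]] sub by blast
    qed
    show "?H \<subseteq> W" using admissibleD(2)[OF adm] sub by blast
    show "x \<in> ?H" if "x \<in> W" "b \<noteq> 0" "inverse x * \<eta> (1, b) * x \<in> translation_group \<eta>" for x b
      using W1[OF that(1)] admissibleD(4)[OF adm _ that(2,3)] by blast
    show "\<exists>x\<in>W. inverse x * i * x \<in> ?H \<and> inverse x * j * x \<in> ?H"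
      if ij: "i \<in> W" "j \<in> W" "involution i" "involution j" "i \<noteq> j" for i j
    proof -
      obtain n where "i \<in> f n" "j \<in> f n" using W2 ij(1,2) by blast
      then show ?thesis using f(2)[of n] ij(3-5) sub[of "Suc n"] unfolding step_def by blast
    qed
    have "f 0 = ?H" using f(1)[of 0] unfolding P_def by blast
    then show "\<exists>x\<in>W. x * \<eta> (-1, 0) * inverse x \<notin> ?H"
      using f(2)[of 0] sub[of "Suc 0"] unfolding step_def by blast
  qed
  moreover have "g = 1" if "g \<in> W" "app g u = u" for g u
    using W1[OF that(1)] rm that(2) unfolding roomy_def by blast
  ultimately show thesis using that by blast
qed

section \<open>The limit group as a permutation group of its involutions\<close>

context limit_group
begin

context
  fixes p :: "'g \<Rightarrow> 'x"
  assumes p: "inj_on p J"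
begin

abbreviation points where "points \<equiv> p ` J"

text \<open>Conjugation of involutions, transported to their labels; the function is extensional, as
  \<open>BijGroup\<close> requires.\<close>

definition \<rho> :: "'g \<Rightarrow> 'x \<Rightarrow> 'x" where
  "\<rho> g = (\<lambda>s\<in>points. p (g * inv_into J p s * inverse g))"

lemma \<rho>_point: "i \<in> J \<Longrightarrow> \<rho> g (p i) = p (g * i * inverse g)"
  using p by (simp add: \<rho>_def)

lemma p_eq: "i \<in> J \<Longrightarrow> j \<in> J \<Longrightarrow> p i = p j \<longleftrightarrow> i = j"
  using p by (rule inj_on_eq_iff)

lemma \<rho>_one: "\<rho> 1 = (\<lambda>s\<in>points. s)"
  by (rule ext) (auto simp: \<rho>_def f_inv_into_f)

lemma \<rho>_compose: "h \<in> W \<Longrightarrow> compose points (\<rho> g) (\<rho> h) = \<rho> (g * h)"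
proof (rule ext)
  fix s assume h: "h \<in> W"
  show "compose points (\<rho> g) (\<rho> h) s = \<rho> (g * h) s"
  proof (cases "s \<in> points")
    case True
    then obtain i where "i \<in> J" "s = p i" by blast
    then show ?thesis using J_conj[OF h] by (simp add: compose_def \<rho>_point mult.assoc)
  qed (simp add: compose_def \<rho>_def)
qed

lemma \<rho>_Bij: "g \<in> W \<Longrightarrow> \<rho> g \<in> Bij points"
proof -
  assume g: "g \<in> W"
  have "bij_betw (\<rho> g) points points"
  proof (rule bij_betw_byWitness[of _ "\<rho> (inverse g)"])
    show "\<forall>a\<in>points. \<rho> (inverse g) (\<rho> g a) = a" "\<forall>a\<in>points. \<rho> g (\<rho> (inverse g) a) = a"
      using J_conj[OF g] J_conj[OF W_inverse[OF g]] by (auto simp: \<rho>_point mult.assoc)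
    show "\<rho> g ` points \<subseteq> points" "\<rho> (inverse g) ` points \<subseteq> points"
      using J_conj[OF g] J_conj[OF W_inverse[OF g]] by (auto simp: \<rho>_point)
  qed
  then show ?thesis by (simp add: Bij_def \<rho>_def)
qed

lemma \<rho>_inj: "inj_on \<rho> W"
proof (rule inj_onI)
  fix g h assume gh: "g \<in> W" "h \<in> W" "\<rho> g = \<rho> h"
  let ?k = "inverse h * g"
  have "?k * i * inverse ?k = i" if i: "i \<in> J" for i
  proof -
    have "p (g * i * inverse g) = p (h * i * inverse h)" using \<rho>_point[OF i] gh(3) by metis
    then have e: "g * i * inverse g = h * i * inverse h" using p_eq J_conj gh(1,2) i by blast
    have "?k * i * inverse ?k = inverse h * (g * i * inverse g) * h" by (simp add: mult.assoc)
    also have "\<dots> = i" unfolding e by (simp add: mult.assoc)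
    finally show ?thesis .
  qed
  then have "?k * t * inverse ?k = t" "?k * \<eta> (-1, 1) * inverse ?k = \<eta> (-1, 1)"
    using aff_in_J by blast+
  moreover have "t \<noteq> \<eta> (-1, 1)" by (simp add: aff_eq[OF rep])
  moreover have "?k \<in> W" using gh by (simp add: W_mult W_inverse)
  ultimately have "?k = 1" using conj_stabilizer[OF aff_in_J aff_in_J] by blast
  then have "h * ?k = h * 1" by simp
  then show "g = h" by simp
qed

abbreviation \<G> where "\<G> \<equiv> \<rho> ` W"

lemma mult_\<rho>: "g \<in> W \<Longrightarrow> h \<in> W \<Longrightarrow> \<rho> g \<otimes>\<^bsub>perm_group points \<G>\<^esub> \<rho> h = \<rho> (g * h)"
  by (simp add: perm_group_def BijGroup_def \<rho>_Bij \<rho>_compose)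

lemma one_\<rho>: "\<one>\<^bsub>perm_group points \<G>\<^esub> = \<rho> 1"
  by (simp add: perm_group_def BijGroup_def \<rho>_one)

lemma \<G>_subgroup: "subgroup \<G> (BijGroup points)"
proof
  show "\<G> \<subseteq> carrier (BijGroup points)" using \<rho>_Bij by (auto simp: BijGroup_def)
  show "x \<otimes>\<^bsub>BijGroup points\<^esub> y \<in> \<G>" if "x \<in> \<G>" "y \<in> \<G>" for x y
    using that mult_\<rho> W_mult by (auto simp: perm_group_def)
  show "\<one>\<^bsub>BijGroup points\<^esub> \<in> \<G>" using one_\<rho> W_one by (auto simp: perm_group_def)
  fix x assume "x \<in> \<G>"
  then obtain g where g: "g \<in> W" "x = \<rho> g" by blast
  have "inv\<^bsub>BijGroup points\<^esub> \<rho> g = \<rho> (inverse g)"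
  proof (rule group.inv_equality[OF group_BijGroup])
    show "\<rho> (inverse g) \<otimes>\<^bsub>BijGroup points\<^esub> \<rho> g = \<one>\<^bsub>BijGroup points\<^esub>"
      using mult_\<rho>[OF W_inverse[OF g(1)] g(1)] one_\<rho> by (simp add: perm_group_def)
  qed (use g W_inverse \<rho>_Bij in \<open>auto simp: BijGroup_def\<close>)
  then show "inv\<^bsub>BijGroup points\<^esub> x \<in> \<G>" using g W_inverse by simp
qed

lemma perm_group_group: "group (perm_group points \<G>)"
  using subgroup.subgroup_is_group[OF \<G>_subgroup group_BijGroup] by (simp add: perm_group_def)

lemma carrier_perm_group: "carrier (perm_group points \<G>) = \<G>"
  by (simp add: perm_group_def)

lemma inv_\<rho>: "g \<in> W \<Longrightarrow> inv\<^bsub>perm_group points \<G>\<^esub> \<rho> g = \<rho> (inverse g)"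
  by (rule group.inv_equality[OF perm_group_group])
     (simp_all add: carrier_perm_group mult_\<rho> one_\<rho> W_inverse)

lemma pow_\<rho>: "g \<in> W \<Longrightarrow> \<rho> g [^]\<^bsub>perm_group points \<G>\<^esub> (n :: nat) = \<rho> (g ^ n) \<and> g ^ n \<in> W"
proof (induction n)
  case 0
  then show ?case
    using group.is_monoid[OF perm_group_group] by (simp add: monoid.nat_pow_0 one_\<rho> W_one)
next
  case (Suc n)
  then show ?case
    using group.is_monoid[OF perm_group_group]
    by (simp add: monoid.nat_pow_Suc mult_\<rho> W_mult flip: power_Suc2)
qed

lemma \<rho>_eq_one: "g \<in> W \<Longrightarrow> \<rho> g = \<rho> 1 \<longleftrightarrow> g = 1"
  using inj_on_eq_iff[OF \<rho>_inj _ W_one] .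

lemma involutions_\<rho>: "involutions points \<G> = \<rho> ` J"
proof -
  have "\<rho> g \<in> involutions points \<G> \<longleftrightarrow> g \<in> J" if "g \<in> W" for g
  proof -
    have "g \<in> J \<longleftrightarrow> g \<noteq> 1 \<and> g * g = 1" using that by (simp add: J_def involution_def)
    then show ?thesis
      using that W_mult[OF that that] by (simp add: involutions_def one_\<rho> mult_\<rho> \<rho>_eq_one)
  qed
  moreover have "involutions points \<G> \<subseteq> \<G>" by (auto simp: involutions_def)
  ultimately show ?thesis using JD(1) by blast
qed

lemma \<G>_sharply_2_transitive: "sharply_2_transitive points \<G>"
  unfolding sharply_2_transitive_def
proof (intro conjI ballI impI)
  show "subgroup \<G> (BijGroup points)" by (rule \<G>_subgroup)
  have "p t \<noteq> p (\<eta> (-1, 1))" using p_eq aff_in_J by (simp add: aff_eq[OF rep])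
  then show "\<exists>x\<in>points. \<exists>y\<in>points. x \<noteq> y" using aff_in_J by blast
next
  fix x y x' y' assume "x \<in> points" "y \<in> points" "x' \<in> points" "y' \<in> points" "x \<noteq> y" "x' \<noteq> y'"
  then obtain i j i' j' where ij: "i \<in> J" "j \<in> J" "i' \<in> J" "j' \<in> J" "i \<noteq> j" "i' \<noteq> j'"
    and xy: "x = p i" "y = p j" "x' = p i'" "y' = p j'" by blast
  obtain g where g: "g \<in> W" "g * i * inverse g = i'" "g * j * inverse g = j'"
    using conj_transitive[OF ij(1,2,5,3,4,6)] by blast
  show "\<exists>!g. g \<in> \<G> \<and> g x = x' \<and> g y = y'"
  proof (rule ex1I[of _ "\<rho> g"])
    show "\<rho> g \<in> \<G> \<and> \<rho> g x = x' \<and> \<rho> g y = y'" using g ij xy by (simp add: \<rho>_point)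
    fix f assume f: "f \<in> \<G> \<and> f x = x' \<and> f y = y'"
    then obtain h where h: "h \<in> W" "f = \<rho> h" by blast
    have hij: "h * i * inverse h = i'" "h * j * inverse h = j'"
      using f h xy ij J_conj[OF h(1)] by (simp_all add: \<rho>_point p_eq)
    let ?k = "inverse g * h"
    have k: "?k * s * inverse ?k = inverse g * (h * s * inverse h) * g" for s by (simp add: mult.assoc)
    have "?k = 1"
    proof (rule conj_stabilizer[OF ij(1,2,5)])
      show "?k \<in> W" using g h by (simp add: W_mult W_inverse)
      show "?k * i * inverse ?k = i" "?k * j * inverse ?k = j"
        unfolding k hij using g(2,3) by (simp_all add: conj_eq_iff)
    qed
    then have "g * ?k = g * 1" by simp
    then show "f = \<rho> g" using h by simp
  qed
qed

lemma \<G>_char_0: "s2t_char_0 points \<G>"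
  unfolding s2t_char_0_def involutions_\<rho>
proof (intro conjI ballI allI impI)
  fix f assume "f \<in> \<rho> ` J"
  then obtain i where i: "i \<in> J" "f = \<rho> i" by blast
  then have "f (p i) = p i" by (simp add: \<rho>_point mult.assoc)
  then show "\<exists>x\<in>points. f x = x" using i by blast
next
  fix f f' n assume "f \<in> \<rho> ` J" "f' \<in> \<rho> ` J" "f \<noteq> f'" "0 < (n :: nat)"
  then obtain i j where ij: "i \<in> J" "j \<in> J" "i \<noteq> j" "f = \<rho> i" "f' = \<rho> j" by blast
  have W: "i * j \<in> W" using ij JD(1) W_mult by blast
  have "(i * j) ^ n \<noteq> 1" by (rule involution_product_order[OF ij(1-3) \<open>0 < n\<close>])
  then show "(f \<otimes>\<^bsub>perm_group points \<G>\<^esub> f') [^]\<^bsub>perm_group points \<G>\<^esub> n \<noteq> \<one>\<^bsub>perm_group points \<G>\<^esub>"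
    using pow_\<rho>[OF W, of n] ij JD(1) by (simp add: mult_\<rho> one_\<rho> \<rho>_eq_one)
qed

lemma \<G>_not_split: "\<not> has_regular_normal_subgroup points \<G>"
proof
  assume "has_regular_normal_subgroup points \<G>"
  then obtain N where N: "N \<lhd> perm_group points \<G>" and reg: "regular_subgroup points N"
    unfolding has_regular_normal_subgroup_def by blast
  have sub: "subgroup N (perm_group points \<G>)" using N by (rule normal_imp_subgroup)
  define M where "M = {g \<in> W. \<rho> g \<in> N}"
  show False
  proof (rule no_regular_normal)
    show "subgrp M"
      unfolding subgrp_def
    proof (intro conjI ballI)
      show "1 \<in> M" using subgroup.one_closed[OF sub] W_one by (simp add: M_def one_\<rho>)
      show "x * y \<in> M" if "x \<in> M" "y \<in> M" for x y
        using that subgroup.m_closed[OF sub, of "\<rho> x" "\<rho> y"] by (simp add: M_def W_mult mult_\<rho>)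
      show "inverse x \<in> M" if "x \<in> M" for x
        using that subgroup.m_inv_closed[OF sub, of "\<rho> x"] by (simp add: M_def W_inverse inv_\<rho>)
    qed
    show "M \<subseteq> W" by (auto simp: M_def)
    show "g * n * inverse g \<in> M" if "g \<in> W" "n \<in> M" for g n
      using that normal.inv_op_closed2[OF N, of "\<rho> g" "\<rho> n"]
      by (simp add: M_def carrier_perm_group W_mult W_inverse inv_\<rho> mult_\<rho>)
    fix i j assume ij: "i \<in> J" "j \<in> J"
    obtain f where f: "f \<in> N" "f (p i) = p j" and uniq: "\<And>f'. f' \<in> N \<Longrightarrow> f' (p i) = p j \<Longrightarrow> f' = f"
      using reg ij unfolding regular_subgroup_def by blast
    have "f \<in> \<G>" using f(1) subgroup.subset[OF sub] by (auto simp: carrier_perm_group)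
    then obtain g where g: "g \<in> W" "f = \<rho> g" by blast
    have \<rho>_iff: "\<rho> h (p i) = p j \<longleftrightarrow> h * i * inverse h = j" if "h \<in> W" for h
      using J_conj[OF that ij(1)] ij by (simp add: \<rho>_point p_eq)
    show "\<exists>!n. n \<in> M \<and> n * i * inverse n = j"
    proof (rule ex1I[of _ g])
      show "g \<in> M \<and> g * i * inverse g = j" using f g \<rho>_iff by (simp add: M_def)
      fix h assume h: "h \<in> M \<and> h * i * inverse h = j"
      then have "\<rho> h = \<rho> g" using uniq[of "\<rho> h"] \<rho>_iff g(2) by (simp add: M_def)
      then show "h = g" using h g(1) \<rho>_inj by (auto simp: M_def dest: inj_onD)
    qed
  qed
qed

lemma \<rho>_\<eta>_hom: "\<rho> \<circ> \<eta> \<in> hom (AGL1 K) (perm_group points \<G>)"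
  by (auto simp: hom_def AGL1_def carrier_perm_group aff_in_W mult_\<rho> aff_mult[OF rep])

lemma \<rho>_\<eta>_inj: "inj_on (\<rho> \<circ> \<eta>) (carrier (AGL1 K))"
proof (rule comp_inj_on)
  show "inj_on \<eta> (carrier (AGL1 K))" using rep by (simp add: affine_rep_def AGL1_def)
  show "inj_on \<rho> (\<eta> ` carrier (AGL1 K))"
    by (rule inj_on_subset[OF \<rho>_inj]) (auto simp: AGL1_def aff_in_W)
qed

end

end

theorem theorem1p1:
  fixes K :: "'k::field_char_0 itself"
  shows "\<exists>(S :: 'k set set) (G :: ('k set \<Rightarrow> 'k set) set) h.
           sharply_2_transitive S G \<and> s2t_char_0 S G \<and>
           \<not> has_regular_normal_subgroup S G \<and>
           h \<in> hom (AGL1 K) (perm_group S G) \<and> inj_on h (carrier (AGL1 K))"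
proof -
  obtain \<eta> :: "'k \<times> 'k \<Rightarrow> 'k sym" and W where "limit_group \<eta> W"
    and free: "\<And>g u. g \<in> W \<Longrightarrow> app g u = u \<Longrightarrow> g = 1"
    by (rule limit_group_exists) blast
  then interpret limit_group \<eta> W by blast
  \<comment> \<open>An element of \<open>W\<close> is determined by its value at 0, since the action
    is free; the singleton is a label of the required type.\<close>
  have p: "inj_on (\<lambda>i. {app i 0}) J"
  proof (rule inj_onI)
    fix i j assume ij: "i \<in> J" "j \<in> J" "{app i 0} = {app j 0}"
    then have "app (inverse j * i) 0 = 0" by simp
    then have "inverse j * i = 1" using free ij JD(1) by (meson W_mult W_inverse)
    then have "j * (inverse j * i) = j * 1" by simp
    then show "i = j" by simp
  qed
  show ?thesis
    using \<G>_sharply_2_transitive[OF p] \<G>_char_0[OF p] \<G>_not_split[OF p] \<rho>_\<eta>_hom[OF p] \<rho>_\<eta>_inj[OF p]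
    by blast
qed

end
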